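(* Let $G=\mathbb{R}^n$ be a free nilpotent Lie group (identified with $\mathbb{R}^n$ as described below) and let $\gamma:[0,1]\to G$ be a horizontal curve with $\gamma(0)=0$. The following statements are equivalent: A) The curve $\gamma$ is an abnormal extremal of corank $m\geq 1$. B) There exist $m$ linearly independent vectors $v_1,\ldots,v_m\in\mathbb{R}^n$ such that $\gamma(t)\in Z_{v_1}\cap\ldots\cap Z_{v_m}$ for all $t\in[0,1]$.
   Context: Let $\mathfrak g$ be the free nilpotent real Lie algebra of step $s\geq 2$ and rank $r\geq 2$, of dimension $n$, and let $X_1,\ldots,X_n$ be a Hall basis of $\mathfrak g$ (constructed by M. Hall's algorithm), where $X_1,\ldots,X_r$ are the generators (first layer). Each $X_\ell$ is written uniquely as $X_\ell=[\cdots[[X_{\ell_0},X_{\ell_1}],X_{\ell_2}],\dots,X_{\ell_h}]$ with $\ell_0>\ell_1$, $\ell_0,\ell_1\le r$, $\ell_1\le\ell_2\le\dots\le\ell_h$; we write $i\prec\ell$ if $X_i=[\cdots[X_{\ell_0},X_{\ell_1}],\dots,X_{\ell_k}]$ for some $k\le h$, and let $I(\ell)\in\mathbb{N}^n$ be the multi-index with $I(\ell)_j=\#\{s\geq1:\ell_s=j\}$. By Grayson–Grossman, $\mathfrak g$ is realized as a Lie algebra of vector fields on $\mathbb{R}^n$ with $X_i(x)=\sum_{\ell: i\prec\ell}\frac{(-1)^{|I(\ell)|}}{I(\ell)!}x^{I(\ell)}\partial_{x_\ell}$ for $i=1,\ldots,r$, completed to a basis $X_1,\ldots,X_n$ (a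 Hall–Grayson–Grossman basis); these are left invariant for the free nilpotent group $G$, which is identified with $\mathbb{R}^n$ via exponential coordinates of the second type $x\mapsto \exp(x_nX_n)\cdots\exp(x_1X_1)$. Here $x^\alpha=x_1^{\alpha_1}\cdots x_n^{\alpha_n}$, $|\alpha|=\alpha_1+\dots+\alpha_n$, $\alpha!=\alpha_1!\cdots\alpha_n!$ for $\alpha\in\mathbb{N}^n$. For $\alpha\in\mathbb{N}^n$, let $[X_i,X_\alpha]$ denote the iterated commutator $[\cdots[[X_i,X_1],\ldots,X_1],X_2,\ldots,X_n]$ with $X_j$ appearing $\alpha_j$ times (identity if $\alpha=0$), and define the generalized structure constants $c^k_{i\alpha}\in\mathbb{R}$ by $[X_i,X_\alpha]=\sum_{k=1}^n c^k_{i\alpha}X_k$. For $v\in\mathbb{R}^n$ and $i=1,\ldots,n$, the extremal polynomial is $P_i^v(x)=\sum_{\alpha\in\mathbb{N}^n}\frac{(-1)^{|\alpha|}}{\alpha!}\Big(\sum_{k=1}^n c^k_{i\alpha}v_k\Big)x^\alpha$, and for $v\neq0$ the abnormal variety of corank $1$ is $Z_v=\{x\in\mathbb{R}^n: P_1^v(x)=\ldots=P_r^v(x)=0\}$. A Lipschitz curve $\gamma$ is horizontal if $\dot\gamma=\sum_{j=1}^r h_jX_j(\gamma)$ a.e. for some $h\in L^\infty([0,1];\mathbb{R}^r)$. With $\mathcal E$ the end-point map $h\mapsto\gamma^h(1)$ (initial point $0$), $\gamma$ with controls $h$ is an abnormal extremal if $d\mathcal E(h)$ is not surjective, and its corank is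 $n-\dim(\mathrm{Im}\, d\mathcal E(h))\geq1$; equivalently, corank $m$ means there are $m$ linearly independent nonvanishing Lipschitz dual curves $\xi$ solving the adjoint equations $\dot\xi_k=-\sum_{j=1}^r\sum_{i=1}^n \frac{\partial X_{ji}}{\partial x_k}(\gamma)h_j\xi_i$ (where $X_j=\sum_i X_{ji}\partial_{x_i}$) with $\langle\xi,X_j(\gamma)\rangle=0$ for $j=1,\ldots,r$.
   Formalization: In A), "corank m" is read as "corank at least m"; with corank exactly m, B) does not imply A) (for example the constant curve in rank 2, step 3 has corank 3 but satisfies B) with m=1). *)

theory Defs
  imports "HOL-Analysis.Analysis"
begin

text \<open>Points of R^n are functions nat => real vanishing outside the coordinates 1..n.
  A vector field is a map from points to such vectors (component k at x is X x k).\<close>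

type_synonym point = "nat \<Rightarrow> real"
type_synonym vfield = "point \<Rightarrow> nat \<Rightarrow> real"

definition Rn :: "nat \<Rightarrow> point set" where
  "Rn n = {x. \<forall>k. k \<notin> {1..n} \<longrightarrow> x k = 0}"

datatype br = Gen nat | Br br br

fun wt :: "br \<Rightarrow> nat" where
  "wt (Gen i) = 1"
| "wt (Br u v) = wt u + wt v"

definition hidx :: "br list \<Rightarrow> br \<Rightarrow> nat" where
  "hidx hb u = Suc (LEAST i. i < length hb \<and> hb ! i = u)"

definition hall_ok :: "br list \<Rightarrow> br \<Rightarrow> br \<Rightarrow> bool" where
  "hall_ok hb u v \<longleftrightarrow> hidx hb v < hidx hb u \<and> (\<forall>w z. u = Br w z \<longrightarrow> hidx hb z \<le> hidx hb v)"

fun hall_el :: "nat \<Rightarrow> br list \<Rightarrow> br \<Rightarrow> bool" where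
  "hall_el r hb (Gen i) = (1 \<le> i \<and> i \<le> r)"
| "hall_el r hb (Br u v) = (u \<in> set hb \<and> v \<in> set hb \<and> hall_ok hb u v)"

text \<open>hb is the ordered Hall basis (M. Hall's algorithm) of the free nilpotent Lie algebra
  of rank r and step s: X_l corresponds to hb ! (l-1), n = length hb.\<close>
definition hall_basis :: "nat \<Rightarrow> nat \<Rightarrow> br list \<Rightarrow> bool" where
  "hall_basis r s hb \<longleftrightarrow>
     distinct hb \<and>
     (\<forall>i\<in>{1..r}. i \<le> length hb \<and> hb ! (i - 1) = Gen i) \<and>
     (\<forall>i<length hb. \<forall>j<length hb. i \<le> j \<longrightarrow> wt (hb ! i) \<le> wt (hb ! j)) \<and>
     (\<forall>u\<in>set hb. wt u \<le> s \<and> hall_el r hb u) \<and>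
     (\<forall>u\<in>set hb. \<forall>v\<in>set hb. hall_ok hb u v \<and> wt u + wt v \<le> s \<longrightarrow> Br u v \<in> set hb)"

text \<open>Left-normed form X_l = [...[[X_l0, X_l1], X_l2], ..., X_lh]: lhead gives l0,
  Imul gives the multi-index I(l) (counting l1,...,lh). For a generator l, l0 = l, I(l) = 0.\<close>
fun lhead :: "br \<Rightarrow> nat" where
  "lhead (Gen i) = i"
| "lhead (Br u v) = lhead u"

fun Imul :: "br list \<Rightarrow> br \<Rightarrow> nat \<Rightarrow> nat" where
  "Imul hb (Gen i) = (\<lambda>j. 0)"
| "Imul hb (Br u v) = (\<lambda>j. Imul hb u j + (if j = hidx hb v then 1 else 0))"

definition mabs :: "nat \<Rightarrow> (nat \<Rightarrow> nat) \<Rightarrow> nat" where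
  "mabs n \<alpha> = (\<Sum>j=1..n. \<alpha> j)"

definition mfact :: "nat \<Rightarrow> (nat \<Rightarrow> nat) \<Rightarrow> nat" where
  "mfact n \<alpha> = (\<Prod>j=1..n. fact (\<alpha> j))"

definition mono :: "nat \<Rightarrow> point \<Rightarrow> (nat \<Rightarrow> nat) \<Rightarrow> real" where
  "mono n x \<alpha> = (\<Prod>j=1..n. x j ^ \<alpha> j)"

definition pd :: "(point \<Rightarrow> real) \<Rightarrow> nat \<Rightarrow> point \<Rightarrow> real" where
  "pd f j x = deriv (\<lambda>t. f (x(j := t))) (x j)"

definition lie :: "nat \<Rightarrow> vfield \<Rightarrow> vfield \<Rightarrow> vfield" where
  "lie n X Y = (\<lambda>x k. \<Sum>j=1..n. X x j * pd (\<lambda>y. Y y k) j x - Y x j * pd (\<lambda>y. X y k) j x)"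

text \<open>Grayson--Grossman generator fields
  X_i(x) = sum over l with i \<prec> l of (-1)^|I(l)| / I(l)! x^I(l) d/dx_l.\<close>
definition GG :: "br list \<Rightarrow> nat \<Rightarrow> vfield" where
  "GG hb i = (\<lambda>x k. if k \<in> {1..length hb} \<and> lhead (hb ! (k - 1)) = i
       then (-1) ^ mabs (length hb) (Imul hb (hb ! (k - 1)))
              / real (mfact (length hb) (Imul hb (hb ! (k - 1))))
              * mono (length hb) x (Imul hb (hb ! (k - 1)))
       else 0)"

fun vf :: "br list \<Rightarrow> br \<Rightarrow> vfield" where
  "vf hb (Gen i) = GG hb i"
| "vf hb (Br u v) = lie (length hb) (vf hb u) (vf hb v)"

definition HX :: "br list \<Rightarrow> nat \<Rightarrow> vfield" where
  "HX hb l = vf hb (hb ! (l - 1))"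

definition itbr :: "br list \<Rightarrow> nat \<Rightarrow> (nat \<Rightarrow> nat) \<Rightarrow> vfield" where
  "itbr hb i \<alpha> = foldl (\<lambda>Y j. ((\<lambda>Z. lie (length hb) Z (HX hb j)) ^^ \<alpha> j) Y)
                        (HX hb i) [1..<Suc (length hb)]"

definition sconst :: "br list \<Rightarrow> nat \<Rightarrow> (nat \<Rightarrow> nat) \<Rightarrow> nat \<Rightarrow> real" where
  "sconst hb i \<alpha> = (THE c. (\<forall>k. k \<notin> {1..length hb} \<longrightarrow> c k = 0) \<and>
       itbr hb i \<alpha> = (\<lambda>x j. \<Sum>k=1..length hb. c k * HX hb k x j))"

text \<open>Extremal polynomial P_i^v (a finite sum, written as a sum over all of N^n).\<close>
definition extP :: "br list \<Rightarrow> point \<Rightarrow> nat \<Rightarrow> point \<Rightarrow> real" where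
  "extP hb v i x = infsum (\<lambda>\<alpha>. (-1) ^ mabs (length hb) \<alpha> / real (mfact (length hb) \<alpha>)
        * (\<Sum>k=1..length hb. sconst hb i \<alpha> k * v k) * mono (length hb) x \<alpha>)
      {\<alpha>. \<forall>j. j \<notin> {1..length hb} \<longrightarrow> \<alpha> j = 0}"

definition Zv :: "br list \<Rightarrow> nat \<Rightarrow> point \<Rightarrow> point set" where
  "Zv hb r v = {x \<in> Rn (length hb). \<forall>i\<in>{1..r}. extP hb v i x = 0}"

definition lin_indep :: "nat \<Rightarrow> nat \<Rightarrow> (nat \<Rightarrow> point) \<Rightarrow> bool" where
  "lin_indep n m w \<longleftrightarrow> (\<forall>c::nat \<Rightarrow> real.
      (\<forall>l\<in>{1..n}. (\<Sum>i<m. c i * w i l) = 0) \<longrightarrow> (\<forall>i<m. c i = 0))"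

definition dimR :: "nat \<Rightarrow> point set \<Rightarrow> nat" where
  "dimR n S = (GREATEST k. \<exists>w. (\<forall>i<k. w i \<in> S) \<and> lin_indep n k w)"

definition controls :: "nat \<Rightarrow> (nat \<Rightarrow> real \<Rightarrow> real) set" where
  "controls r = {h. \<forall>j\<in>{1..r}. h j \<in> borel_measurable lborel \<and>
      (\<exists>B. AE t in lborel. t \<in> {0..1} \<longrightarrow> \<bar>h j t\<bar> \<le> B)}"

definition horizontal_with :: "br list \<Rightarrow> nat \<Rightarrow> (real \<Rightarrow> point) \<Rightarrow> (nat \<Rightarrow> real \<Rightarrow> real) \<Rightarrow> bool" where
  "horizontal_with hb r \<gamma> h \<longleftrightarrow>
     h \<in> controls r \<and>
     \<gamma> 0 = (\<lambda>k. 0) \<and>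
     (\<forall>t\<in>{0..1}. \<gamma> t \<in> Rn (length hb)) \<and>
     (\<exists>L. \<forall>s\<in>{0..1}. \<forall>t\<in>{0..1}. \<forall>k. \<bar>\<gamma> s k - \<gamma> t k\<bar> \<le> L * \<bar>s - t\<bar>) \<and>
     (AE t in lborel. t \<in> {0..1} \<longrightarrow>
        (\<forall>k\<in>{1..length hb}. ((\<lambda>\<tau>. \<gamma> \<tau> k) has_real_derivative
            (\<Sum>j=1..r. h j t * HX hb j (\<gamma> t) k)) (at t within {0..1})))"

definition endpt :: "br list \<Rightarrow> nat \<Rightarrow> (nat \<Rightarrow> real \<Rightarrow> real) \<Rightarrow> point" where
  "endpt hb r h = (THE y. \<exists>\<gamma>. horizontal_with hb r \<gamma> h \<and> y = \<gamma> 1)"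

text \<open>Image of the differential dE(h) (computed as directional derivatives d/de E(h + e k) at e = 0).\<close>
definition dE_image :: "br list \<Rightarrow> nat \<Rightarrow> (nat \<Rightarrow> real \<Rightarrow> real) \<Rightarrow> point set" where
  "dE_image hb r h = {D \<in> Rn (length hb). \<exists>k\<in>controls r. \<forall>l\<in>{1..length hb}.
      ((\<lambda>e. endpt hb r (\<lambda>j t. h j t + e * k j t) l) has_real_derivative D l) (at 0)}"

definition corank :: "br list \<Rightarrow> nat \<Rightarrow> (nat \<Rightarrow> real \<Rightarrow> real) \<Rightarrow> nat" where
  "corank hb r h = length hb - dimR (length hb) (dE_image hb r h)"

definition abnormal_extremal :: "br list \<Rightarrow> nat \<Rightarrow> (nat \<Rightarrow> real \<Rightarrow> real) \<Rightarrow> bool" where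
  "abnormal_extremal hb r h \<longleftrightarrow> dE_image hb r h \<noteq> Rn (length hb)"

end

theory Submission
  imports Defs
begin

text \<open>
  Let Ad(x) be the adjoint action of the group element exp(x_n X_n) ... exp(x_1 X_1). The extremal
  polynomial P_j^v(x) is the pairing of v with Ad(x) X_j, so it satisfies
  X_i P_j^v = \<Sum>_l c_ij^l P_l^v for every generator X_i. Along a trajectory with controls h, write the
  first variation of the end point in direction k in the left-invariant frame, y = \<Sum>_l c_l X_l(\<gamma>). Then
  c' = k - \<Sum>_i h_i ad(X_i) c, and the identity above turns this into
  (Ad(\<gamma>) c)' = \<Sum>_j k_j Ad(\<gamma>) X_j. Hence a covector annihilates the image of dE(h) iff the vector v
  obtained from it by an (invertible) change of frame at \<gamma>(1) satisfies
  \<integral> \<Sum>_j k_j P_j^v(\<gamma>) = 0 for all k, that is, iff \<gamma> stays in Z_v; and the corank is the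
  dimension of this annihilator.

  The identity X_i P_j^v = \<Sum>_l c_ij^l P_l^v is proved without the group: on the slices
  {x_1 = ... = x_(m-1) = 0} the Grayson--Grossman fields reduce to explicit monomial fields and
  X_m becomes d/dx_m, which allows a descending induction on m.
\<close>

section \<open>Lipschitz primitives on the unit interval\<close>

text \<open>Two orders do the work of group theory and of differential equations. Weights: all
  coefficients are weighted homogeneous polynomials, so negative degree means zero and degree 0
  means constant; nilpotency and the unitriangularity of both change-of-frame matrices are degree
  counts. Indices: each coordinate of the control system involves earlier coordinates only, so
  perturbed trajectories, variations and frame coordinates arise one after the other by integration,
  and the end point is a polynomial in the perturbation parameter. The slice induction cannot be run
  for generators alone, since commuting X_u with d/dx_m produces [X_u, X_m]. It is run for all Hall
  elements u with last letter at most m and index at least m: if the index exceeds m, then [u, m] is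
  again basic, or zero by weight. At m = 1 this covers every generator on the whole space. That an
  annihilating covector forces the curve into Z_v is seen with the control k_j = P_j^v(\<gamma>),
  which makes the integrand a sum of squares.\<close>

definition lip :: "(real \<Rightarrow> real) \<Rightarrow> bool" where
  "lip F \<longleftrightarrow> (\<exists>L. \<forall>s\<in>{0..1}. \<forall>t\<in>{0..1}. \<bar>F s - F t\<bar> \<le> L * \<bar>s - t\<bar>)"

text \<open>The Lipschitz condition excludes Cantor-type functions: with it, a derivative known
  almost everywhere still determines \<open>F\<close> up to a constant. The form matches the notion
  of horizontal curve.\<close>

definition prim :: "(real \<Rightarrow> real) \<Rightarrow> (real \<Rightarrow> real) \<Rightarrow> bool" where
  "prim F f \<longleftrightarrow> lip F \<and>
     (AE t in lborel. t \<in> {0..1} \<longrightarrow> (F has_real_derivative f t) (at t within {0..1}))"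

text \<open>Measurability is asked on \<open>{0..1}\<close> only, because \<open>lip\<close> says
  nothing about a function outside this interval and products with Lipschitz functions must stay in
  the class.\<close>

definition ess_bdd :: "(real \<Rightarrow> real) \<Rightarrow> bool" where
  "ess_bdd f \<longleftrightarrow> f \<in> borel_measurable (lebesgue_on {0..1}) \<and>
     (\<exists>B. AE t in lborel. t \<in> {0..1} \<longrightarrow> \<bar>f t\<bar> \<le> B)"

lemma AE_lborel_iff_negligible: "(AE t in lborel. P t) \<longleftrightarrow> negligible {t. \<not> P t}"
proof -
  have "(AE t in lborel. P t) \<longleftrightarrow> (AE t in lebesgue. P t)"
    by (simp add: AE_completion_iff)
  also have "\<dots> \<longleftrightarrow> (\<exists>N. negligible N \<and> {t. \<not> P t} \<subseteq> N)"
    by (auto simp: eventually_ae_filter negligible_iff_null_sets)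
  also have "\<dots> \<longleftrightarrow> negligible {t. \<not> P t}" using negligible_subset by blast
  finally show ?thesis .
qed

lemma lipE:
  assumes "lip F"
  obtains L where "L \<ge> 0" "\<And>s t. s \<in> {0..1} \<Longrightarrow> t \<in> {0..1} \<Longrightarrow> \<bar>F s - F t\<bar> \<le> L * \<bar>s - t\<bar>"
proof -
  obtain L where L: "\<And>s t. s \<in> {0..1} \<Longrightarrow> t \<in> {0..1} \<Longrightarrow> \<bar>F s - F t\<bar> \<le> L * \<bar>s - t\<bar>"
    using assms unfolding lip_def by blast
  have "\<bar>F s - F t\<bar> \<le> max L 0 * \<bar>s - t\<bar>" if "s \<in> {0..1}" "t \<in> {0..1}" for s t
    using L[OF that] mult_right_mono[of L "max L 0" "\<bar>s - t\<bar>"] by linarith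
  then show ?thesis using that[of "max L 0"] by simp
qed

lemma lip_const: "lip (\<lambda>t. c)"
  unfolding lip_def by (intro exI[of _ 0]) simp

lemma lip_bounded:
  assumes "lip F" obtains B where "\<And>t. t \<in> {0..1} \<Longrightarrow> \<bar>F t\<bar> \<le> B"
proof -
  obtain L where L: "L \<ge> 0" "\<And>s t. s \<in> {0..1} \<Longrightarrow> t \<in> {0..1} \<Longrightarrow> \<bar>F s - F t\<bar> \<le> L * \<bar>s - t\<bar>"
    using lipE[OF assms] by metis
  have "\<bar>F t\<bar> \<le> \<bar>F 0\<bar> + L" if "t \<in> {0..1}" for t
  proof -
    have "L * \<bar>t - 0\<bar> \<le> L * 1" by (rule mult_left_mono) (use that L in auto)
    moreover have "\<bar>F t - F 0\<bar> \<le> L * \<bar>t - 0\<bar>" by (rule L(2)) (use that in auto)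
    ultimately show ?thesis by linarith
  qed
  then show ?thesis using that by blast
qed

lemma lip_add: assumes "lip F" "lip G" shows "lip (\<lambda>t. F t + G t)"
proof -
  obtain L where L: "\<And>s t. s \<in> {0..1} \<Longrightarrow> t \<in> {0..1} \<Longrightarrow> \<bar>F s - F t\<bar> \<le> L * \<bar>s - t\<bar>"
    using lipE[OF assms(1)] by metis
  obtain M where M: "\<And>s t. s \<in> {0..1} \<Longrightarrow> t \<in> {0..1} \<Longrightarrow> \<bar>G s - G t\<bar> \<le> M * \<bar>s - t\<bar>"
    using lipE[OF assms(2)] by metis
  have "\<bar>(F s + G s) - (F t + G t)\<bar> \<le> (L + M) * \<bar>s - t\<bar>" if "s \<in> {0..1}" "t \<in> {0..1}" for s t
    using L[OF that] M[OF that] by (simp add: algebra_simps)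
  then show ?thesis unfolding lip_def by blast
qed

lemma lip_mult: assumes "lip F" "lip G" shows "lip (\<lambda>t. F t * G t)"
proof -
  obtain L where L: "\<And>s t. s \<in> {0..1} \<Longrightarrow> t \<in> {0..1} \<Longrightarrow> \<bar>F s - F t\<bar> \<le> L * \<bar>s - t\<bar>"
    using lipE[OF assms(1)] by metis
  obtain M where M: "\<And>s t. s \<in> {0..1} \<Longrightarrow> t \<in> {0..1} \<Longrightarrow> \<bar>G s - G t\<bar> \<le> M * \<bar>s - t\<bar>"
    using lipE[OF assms(2)] by metis
  obtain A where A: "\<And>t. t \<in> {0..1} \<Longrightarrow> \<bar>F t\<bar> \<le> A" using lip_bounded[OF assms(1)] by metis
  obtain B where B: "\<And>t. t \<in> {0..1} \<Longrightarrow> \<bar>G t\<bar> \<le> B" using lip_bounded[OF assms(2)] by metis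
  have "\<bar>F s * G s - F t * G t\<bar> \<le> (L * B + A * M) * \<bar>s - t\<bar>" if "s \<in> {0..1}" "t \<in> {0..1}" for s t
  proof -
    have "F s * G s - F t * G t = (F s - F t) * G s + F t * (G s - G t)" by (simp add: algebra_simps)
    then have "\<bar>F s * G s - F t * G t\<bar> \<le> \<bar>F s - F t\<bar> * \<bar>G s\<bar> + \<bar>F t\<bar> * \<bar>G s - G t\<bar>"
      by (metis abs_mult abs_triangle_ineq)
    also have "\<dots> \<le> (L * \<bar>s - t\<bar>) * B + A * (M * \<bar>s - t\<bar>)"
      using L[OF that] M[OF that] A[OF that(2)] B[OF that(1)]
      by (intro add_mono mult_mono) (auto intro: order_trans[OF abs_ge_zero])
    finally show ?thesis by (simp add: algebra_simps)
  qed
  then show ?thesis unfolding lip_def by blast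
qed

lemma lip_sum: "finite A \<Longrightarrow> (\<And>i. i \<in> A \<Longrightarrow> lip (F i)) \<Longrightarrow> lip (\<lambda>t. \<Sum>i\<in>A. F i t)"
  by (induction A rule: finite_induct) (auto intro: lip_const lip_add)

lemma lip_continuous: assumes "lip F" shows "continuous_on {0..1} F"
proof -
  obtain L where L: "L \<ge> 0" "\<And>s t. s \<in> {0..1} \<Longrightarrow> t \<in> {0..1} \<Longrightarrow> \<bar>F s - F t\<bar> \<le> L * \<bar>s - t\<bar>"
    using lipE[OF assms] by metis
  have "L-lipschitz_on {0..1} F" by (rule lipschitz_onI) (use L in \<open>auto simp: dist_real_def\<close>)
  then show ?thesis by (rule lipschitz_on_continuous_on)
qed

lemma lip_cong: assumes "\<And>t. t \<in> {0..1} \<Longrightarrow> F t = G t" shows "lip F \<longleftrightarrow> lip G"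
  unfolding lip_def using assms by simp

text \<open>On the exceptional null set a gauge is available from the vanishing integral of its indicator;
  the Lipschitz bound then makes all tags in that set contribute little.\<close>

lemma lipschitz_ftc:
  fixes f f' :: "real \<Rightarrow> real"
  assumes "a \<le> b" and L: "L \<ge> 0" "\<And>x y. x \<in> {a..b} \<Longrightarrow> y \<in> {a..b} \<Longrightarrow> \<bar>f x - f y\<bar> \<le> L * \<bar>x - y\<bar>"
    and N: "negligible N"
    and der: "\<And>x. x \<in> {a..b} - N \<Longrightarrow> (f has_real_derivative f' x) (at x within {a..b})"
  shows "(f' has_integral (f b - f a)) {a..b}"
proof -
  define g where "g x = (if x \<in> N then 0 else f' x)" for x
  have "(g has_integral (f b - f a)) {a..b}"
    unfolding has_integral_factor_content_real
  proof (intro allI impI)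
    fix e :: real assume e: "e > 0"
    have "\<forall>x. \<exists>d>0. x \<in> {a..b} - N \<longrightarrow>
         (\<forall>y\<in>{a..b}. norm (y-x) < d \<longrightarrow> norm (f y - f x - (y-x) *\<^sub>R f' x) \<le> (e/2) * norm (y-x))"
    proof
      fix x show "\<exists>d>0. x \<in> {a..b} - N \<longrightarrow>
         (\<forall>y\<in>{a..b}. norm (y-x) < d \<longrightarrow> norm (f y - f x - (y-x) *\<^sub>R f' x) \<le> (e/2) * norm (y-x))"
      proof (cases "x \<in> {a..b} - N")
        case True
        then have "(f has_vector_derivative f' x) (at x within {a..b})"
          using der[OF True] by (simp add: has_real_derivative_iff_has_vector_derivative)
        then show ?thesis unfolding has_vector_derivative_def has_derivative_within_alt
          using e by (meson half_gt_zero)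
      qed (auto intro: exI[of _ 1])
    qed
    then obtain d where d: "\<And>x. 0 < d x"
      "\<And>x y. \<lbrakk>x \<in> {a..b} - N; y \<in> {a..b}; norm (y-x) < d x\<rbrakk>
           \<Longrightarrow> norm (f y - f x - (y-x) *\<^sub>R f' x) \<le> (e/2) * norm (y-x)"
      by metis
    have ind: "((indicator N :: real \<Rightarrow> real) has_integral 0) {a..b}"
      using N by (metis box_real(2) negligible_def)
    \<comment> \<open>Half of the error is reserved for tags in \<open>N\<close>, whose total length
      is weighted by \<open>L\<close>; the summand 1 keeps the quotient meaningful for
      \<open>L = 0\<close>.\<close>
    have "e / (2 * (L + 1)) > 0" using e L by simp
    then obtain g2 where g2: "gauge g2" "\<And>p. p tagged_division_of {a..b} \<Longrightarrow> g2 fine p \<Longrightarrow>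
       norm ((\<Sum>(x,K)\<in>p. measure lborel K *\<^sub>R (indicator N x :: real)) - 0) \<le> e / (2 * (L + 1)) * measure lborel {a..b}"
      using ind unfolding has_integral_factor_content_real by metis
    show "\<exists>D. gauge D \<and> (\<forall>p. p tagged_division_of {a..b} \<and> D fine p \<longrightarrow>
       norm ((\<Sum>(x,k)\<in>p. measure lborel k *\<^sub>R g x) - (f b - f a)) \<le> e * measure lborel {a..b})"
    proof (intro exI[of _ "\<lambda>x. ball x (d x) \<inter> g2 x"] conjI allI impI)
      show "gauge (\<lambda>x. ball x (d x) \<inter> g2 x)"
        using g2(1) d(1) by (intro gauge_Int gauge_ball_dependent) auto
    next
      fix p assume "p tagged_division_of {a..b} \<and> (\<lambda>x. ball x (d x) \<inter> g2 x) fine p"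
      then have p: "p tagged_division_of {a..b}" and f1: "(\<lambda>x. ball x (d x)) fine p" and f2: "g2 fine p"
        by (auto simp: fine_Int)
      have tel: "f b - f a = (\<Sum>(x,K)\<in>p. f(Sup K) - f(Inf K))" "b - a = (\<Sum>(x,K)\<in>p. Sup K - Inf K)"
        using additive_tagged_division_1[OF \<open>a \<le> b\<close> p, of f] additive_tagged_division_1[OF \<open>a \<le> b\<close> p, of "\<lambda>x. x"]
        by auto
      have trm: "\<bar>measure lborel K * g x - (f (Sup K) - f (Inf K))\<bar>
              \<le> e/2 * (Sup K - Inf K) + L * (measure lborel K * indicator N x)" if xK: "(x,K) \<in> p" for x K
      proof -
        from p xK obtain u v where K: "K = {u..v}" and x: "x \<in> K" and sub: "K \<subseteq> {a..b}"
          by (metis box_real(2) tagged_division_ofD(2,3,4))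
        then have uv: "u \<le> x" "x \<le> v" "u \<in> {a..b}" "v \<in> {a..b}" "x \<in> {a..b}" "u \<le> v" by auto
        have c: "measure lborel K = v - u" "Sup K = v" "Inf K = u" using uv K by auto
        have bl: "K \<subseteq> ball x (d x)" using f1 xK by (auto simp: fine_def)
        show ?thesis
        proof (cases "x \<in> N")
          case True
          have "\<bar>f v - f u\<bar> \<le> L * (v - u)" using L(2)[of v u] uv by simp
          moreover have "0 \<le> e/2 * (v - u)" using e uv by simp
          ultimately show ?thesis using True by (simp add: c g_def)
        next
          case False
          have du: "norm (u - x) < d x" "norm (v - x) < d x"
            using subsetD[OF bl, of u] subsetD[OF bl, of v] K uv by (auto simp: dist_real_def abs_minus_commute)
          have "\<bar>f u - f x - (u - x) * f' x\<bar> \<le> e/2 * \<bar>u - x\<bar>"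
            using d(2)[of x u] du uv False by simp
          moreover have "\<bar>f v - f x - (v - x) * f' x\<bar> \<le> e/2 * \<bar>v - x\<bar>"
            using d(2)[of x v] du uv False by simp
          \<comment> \<open>Straddling: the increment is split at the tag \<open>x\<close>, which
            lies between \<open>u\<close> and \<open>v\<close>, so the two one-sided errors add up
            to a multiple of \<open>v - u\<close>.\<close>
          moreover have "(v-u) * f' x - (f v - f u) = (f u - f x - (u - x) * f' x) - (f v - f x - (v - x) * f' x)"
            by (simp add: algebra_simps)
          moreover have "e/2 * \<bar>u - x\<bar> + e/2 * \<bar>v - x\<bar> = e/2 * (v - u)" using uv by (simp add: field_simps)
          ultimately have "\<bar>(v-u) * f' x - (f v - f u)\<bar> \<le> e/2 * (v - u)" by linarith
          then show ?thesis using False by (simp add: c g_def)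
        qed
      qed
      have "norm ((\<Sum>(x,k)\<in>p. measure lborel k *\<^sub>R g x) - (f b - f a))
         = \<bar>\<Sum>(x,K)\<in>p. measure lborel K * g x - (f(Sup K) - f(Inf K))\<bar>"
        unfolding tel by (simp add: sum_subtractf[symmetric] split_def)
      also have "\<dots> \<le> (\<Sum>(x,K)\<in>p. \<bar>measure lborel K * g x - (f(Sup K) - f(Inf K))\<bar>)"
        by (simp add: split_def sum_abs)
      also have "\<dots> \<le> (\<Sum>(x,K)\<in>p. e/2 * (Sup K - Inf K) + L * (measure lborel K * indicator N x))"
        by (rule sum_mono) (use trm in auto)
      also have "\<dots> = e/2 * (b - a) + L * (\<Sum>(x,K)\<in>p. measure lborel K * indicator N x)"
        unfolding tel by (simp add: split_def sum.distrib sum_distrib_left)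
      also have "\<dots> \<le> e/2 * (b - a) + L * (e / (2 * (L + 1)) * (b - a))"
      proof -
        have "(\<Sum>(x,K)\<in>p. measure lborel K * indicator N x) \<le> e / (2 * (L + 1)) * (b - a)"
          using g2(2)[OF p f2] \<open>a \<le> b\<close> by simp
        then show ?thesis using L(1) mult_left_mono by fastforce
      qed
      also have "\<dots> \<le> e/2 * (b - a) + e/2 * (b-a)"
      proof -
        have "L * (e / (2 * (L + 1))) \<le> e/2" using L e by (simp add: field_simps)
        then have "L * (e / (2 * (L + 1))) * (b-a) \<le> e/2 * (b-a)"
          by (rule mult_right_mono) (use \<open>a \<le> b\<close> in simp)
        then show ?thesis unfolding mult.assoc by linarith
      qed
      finally show "norm ((\<Sum>(x,k)\<in>p. measure lborel k *\<^sub>R g x) - (f b - f a)) \<le> e * measure lborel {a..b}"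
        using \<open>a \<le> b\<close> by simp
    qed
  qed
  then show ?thesis
    by (rule has_integral_spike[OF N, rotated]) (simp add: g_def)
qed

lemma prim_has_integral:
  assumes "prim F f" "t \<in> {0..1}"
  shows "(f has_integral (F t - F 0)) {0..t}"
proof -
  obtain L where L: "L \<ge> 0" "\<And>s t. s \<in> {0..1} \<Longrightarrow> t \<in> {0..1} \<Longrightarrow> \<bar>F s - F t\<bar> \<le> L * \<bar>s - t\<bar>"
    using lipE[OF conjunct1[OF assms(1)[unfolded prim_def]]] by metis
  define N where "N = {t. \<not> (t \<in> {0..1} \<longrightarrow> (F has_real_derivative f t) (at t within {0..1}))}"
  have N: "negligible N" unfolding N_def using conjunct2[OF assms(1)[unfolded prim_def]] by (simp only: AE_lborel_iff_negligible)
  show ?thesis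
  proof (rule lipschitz_ftc[OF _ L(1) _ N])
    fix x assume "x \<in> {0..t} - N"
    then have "(F has_real_derivative f x) (at x within {0..1})" using assms(2) by (auto simp: N_def)
    then show "(F has_real_derivative f x) (at x within {0..t})"
      by (rule has_field_derivative_subset) (use assms(2) in auto)
  next
    fix x y assume "x \<in> {0..t}" "y \<in> {0..t}"
    then show "\<bar>F x - F y\<bar> \<le> L * \<bar>x - y\<bar>" using L(2)[of x y] assms(2) by simp
  qed (use assms(2) in simp)
qed

text \<open>Plays the part of a uniqueness theorem for differential equations: applied to one
  coordinate at a time, with right-hand sides that agree because they involve only coordinates
  already treated.\<close>

lemma prim_unique:
  assumes "prim F f" "prim G g" "AE t in lborel. t \<in> {0..1} \<longrightarrow> f t = g t" "F 0 = G 0" "t \<in> {0..1}"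
  shows "F t = G t"
proof -
  have 1: "(f has_integral (F t - F 0)) {0..t}" and 2: "(g has_integral (G t - G 0)) {0..t}"
    using prim_has_integral[OF assms(1,5)] prim_has_integral[OF assms(2,5)] by auto
  have "(f has_integral (G t - G 0)) {0..t}"
  proof (rule has_integral_spike[OF _ _ 2])
    show "negligible {t. \<not> (t \<in> {0..1} \<longrightarrow> f t = g t)}"
      using assms(3) by (simp only: AE_lborel_iff_negligible)
  qed (use assms(5) in auto)
  then have "F t - F 0 = G t - G 0" by (rule has_integral_unique[OF 1])
  then show ?thesis using assms(4) by simp
qed

section \<open>Essentially bounded functions and the existence of Lipschitz primitives\<close>

lemma ess_bddE:
  assumes "ess_bdd f"
  obtains B where "f \<in> borel_measurable (lebesgue_on {0..1})" "AE t in lborel. t \<in> {0..1} \<longrightarrow> \<bar>f t\<bar> \<le> B"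
  using assms unfolding ess_bdd_def by (elim conjE exE) (rule that)

lemma ess_bddI:
  assumes "f \<in> borel_measurable (lebesgue_on {0..1})" "AE t in lborel. t \<in> {0..1} \<longrightarrow> \<bar>f t\<bar> \<le> B"
  shows "ess_bdd f"
  unfolding ess_bdd_def by (rule conjI, rule assms(1), rule exI, rule assms(2))

lemma ess_bdd_add: assumes "ess_bdd f" "ess_bdd g" shows "ess_bdd (\<lambda>t. f t + g t)"
proof -
  obtain A where A: "f \<in> borel_measurable (lebesgue_on {0..1})" "AE t in lborel. t \<in> {0..1} \<longrightarrow> \<bar>f t\<bar> \<le> A"
    using assms(1) by (rule ess_bddE)
  obtain B where B: "g \<in> borel_measurable (lebesgue_on {0..1})" "AE t in lborel. t \<in> {0..1} \<longrightarrow> \<bar>g t\<bar> \<le> B"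
    using assms(2) by (rule ess_bddE)
  have "AE t in lborel. t \<in> {0..1} \<longrightarrow> \<bar>f t + g t\<bar> \<le> A + B" using A(2) B(2)
  proof eventually_elim
    case (elim t)
    show ?case
    proof
      assume "t \<in> {0..1}"
      then have "\<bar>f t\<bar> \<le> A" "\<bar>g t\<bar> \<le> B" using elim by blast+
      then show "\<bar>f t + g t\<bar> \<le> A + B" by linarith
    qed
  qed
  then show ?thesis by (rule ess_bddI[OF borel_measurable_add[OF A(1) B(1)]])
qed

lemma ess_bdd_mult: assumes "ess_bdd f" "ess_bdd g" shows "ess_bdd (\<lambda>t. f t * g t)"
proof -
  obtain A where A: "f \<in> borel_measurable (lebesgue_on {0..1})" "AE t in lborel. t \<in> {0..1} \<longrightarrow> \<bar>f t\<bar> \<le> A"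
    using assms(1) by (rule ess_bddE)
  obtain B where B: "g \<in> borel_measurable (lebesgue_on {0..1})" "AE t in lborel. t \<in> {0..1} \<longrightarrow> \<bar>g t\<bar> \<le> B"
    using assms(2) by (rule ess_bddE)
  have "AE t in lborel. t \<in> {0..1} \<longrightarrow> \<bar>f t * g t\<bar> \<le> A * B" using A(2) B(2)
  proof eventually_elim
    case (elim t)
    show ?case
    proof
      assume "t \<in> {0..1}"
      then have "\<bar>f t\<bar> \<le> A" "\<bar>g t\<bar> \<le> B" using elim by auto
      then show "\<bar>f t * g t\<bar> \<le> A * B" unfolding abs_mult by (intro mult_mono) auto
    qed
  qed
  then show ?thesis by (rule ess_bddI[OF borel_measurable_times[OF A(1) B(1)]])
qed

lemma lip_ess_bdd: assumes "lip f" shows "ess_bdd f"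
proof -
  obtain B where "\<And>t. t \<in> {0..1} \<Longrightarrow> \<bar>f t\<bar> \<le> B" using lip_bounded[OF assms] by metis
  then have b: "AE t in lborel. t \<in> {0..1} \<longrightarrow> \<bar>f t\<bar> \<le> B" by (intro AE_I2) simp
  have m: "f \<in> borel_measurable (lebesgue_on {0..1})"
    by (rule continuous_imp_measurable_on_sets_lebesgue[OF lip_continuous[OF assms]]) auto
  show ?thesis by (rule ess_bddI[OF m b])
qed

lemma ess_bdd_sum: "finite A \<Longrightarrow> (\<And>i. i \<in> A \<Longrightarrow> ess_bdd (f i)) \<Longrightarrow> ess_bdd (\<lambda>t. \<Sum>i\<in>A. f i t)"
  by (induction A rule: finite_induct) (simp_all add: lip_ess_bdd lip_const ess_bdd_add)

lemma indefinite_integral_right_derivative: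
  fixes f :: "real \<Rightarrow> real"
  assumes "\<And>a b. f integrable_on {a..b}"
  obtains N where "negligible N"
    "\<And>x. x \<notin> N \<Longrightarrow> ((\<lambda>h. integral {x..x+h} f / h) \<longlongrightarrow> f x) (at_right 0)"
proof -
  have "\<And>a b::real. f integrable_on cbox a b" using assms by simp
  then obtain N where N: "negligible N"
       "\<And>x e. \<lbrakk>x \<notin> N; 0 < e\<rbrakk> \<Longrightarrow>
               \<exists>d>0. \<forall>h. 0 < h \<and> h < d \<longrightarrow>
                         norm(integral (cbox x (x + h *\<^sub>R One)) f /\<^sub>R h ^ DIM(real) - f x) < e"
    using integrable_ccontinuous_explicit[of f] by blast
  show ?thesis
  proof (rule that[OF N(1)])
    fix x assume x: "x \<notin> N"
    show "((\<lambda>h. integral {x..x+h} f / h) \<longlongrightarrow> f x) (at_right 0)"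
      unfolding tendsto_iff eventually_at_right_field
    proof (intro allI impI)
      fix e :: real assume "0 < e"
      from N(2)[OF x this] obtain d where d: "d > 0" "\<And>h. 0 < h \<Longrightarrow> h < d \<Longrightarrow>
        norm(integral (cbox x (x + h *\<^sub>R One)) f /\<^sub>R h ^ DIM(real) - f x) < e" by metis
      have "dist (integral {x..x+h} f / h) (f x) < e" if "0 < h" "h < d" for h
        using d(2)[OF that] by (simp add: dist_real_def divide_inverse mult.commute)
      then show "\<exists>b>0. \<forall>y>0. y < b \<longrightarrow> dist (integral {x..x+y} f / y) (f x) < e" using d(1) by blast
    qed
  qed
qed

text \<open>The library differentiates indefinite integrals from the right only; the left derivative comes
  from the reflected function.\<close>

lemma ess_bdd_prim:
  assumes "ess_bdd f" obtains F where "prim F f" "F 0 = 0"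
proof -
  obtain B where meas: "f \<in> borel_measurable (lebesgue_on {0..1})"
    and B0: "AE t in lborel. t \<in> {0..1} \<longrightarrow> \<bar>f t\<bar> \<le> B" using assms by (rule ess_bddE)
  \<comment> \<open>Truncation turns the essential bound into a bound everywhere, which makes the
    primitive Lipschitz; extension by 0 gives integrability on every interval, as the
    differentiation theorem requires.\<close>
  define g where "g t = (if t \<in> {0..1} \<and> \<bar>f t\<bar> \<le> B then f t else 0)" for t
  have gB: "\<bar>g t\<bar> \<le> \<bar>B\<bar>" for t by (auto simp: g_def)
  have fg: "(AE t in lborel. t \<in> {0..1} \<longrightarrow> g t = f t)" using B0 by eventually_elim (simp add: g_def)
  have "g \<in> borel_measurable (lebesgue_on {0..1})"
  proof -
    have "(\<lambda>t. if \<bar>f t\<bar> \<le> B then f t else 0) \<in> borel_measurable (lebesgue_on {0..1})"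
      using meas by measurable
    then show ?thesis by (rule measurable_cong[THEN iffD1, rotated]) (simp add: g_def)
  qed
  moreover have "(\<lambda>x. if x \<in> {0..1} then g x else 0) = g" by (auto simp: g_def)
  ultimately have gm: "g \<in> borel_measurable lebesgue"
    using borel_measurable_if_I[of g "{0..1}"] by simp
  have int: "g integrable_on {a..b}" for a b
  proof (rule measurable_bounded_by_integrable_imp_integrable_real)
    show "g \<in> borel_measurable (lebesgue_on {a..b})" using gm by (rule measurable_restrict_space1)
    show "(\<lambda>x. \<bar>B\<bar>) integrable_on {a..b}" by (rule integrable_const_ivl)
  qed (use gB in auto)
  define F where "F t = integral {0..t} g" for t
  have diff: "F y - F x = integral {x..y} g" if "0 \<le> x" "x \<le> y" for x y
    unfolding F_def using Henstock_Kurzweil_Integration.integral_combine[OF that int] by simp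
  have bnd: "\<bar>integral {x..y} g\<bar> \<le> \<bar>B\<bar> * (y - x)" if "x \<le> y" for x y
    using has_integral_bound_real[of "\<bar>B\<bar>" "{}" g "integral {x..y} g" x y]
      integrable_integral[OF int[of x y]] gB that by simp
  have lip: "lip F" unfolding lip_def
  proof (intro exI ballI)
    fix s t :: real assume st: "s \<in> {0..1}" "t \<in> {0..1}"
    show "\<bar>F s - F t\<bar> \<le> \<bar>B\<bar> * \<bar>s - t\<bar>"
    proof (cases "s \<le> t")
      case True
      then show ?thesis using diff[of s t] bnd[of s t] st by (simp add: abs_minus_commute)
    next
      case False
      then show ?thesis using diff[of t s] bnd[of t s] st by simp
    qed
  qed
  obtain N1 where N1: "negligible N1"
    "\<And>x. x \<notin> N1 \<Longrightarrow> ((\<lambda>h. integral {x..x+h} g / h) \<longlongrightarrow> g x) (at_right 0)"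
    using indefinite_integral_right_derivative[OF int] by metis
  have "(\<lambda>x. g (- x)) integrable_on {a..b}" for a b
    using int[of "-b" "-a"] Henstock_Kurzweil_Integration.integrable_reflect_real[of g "-a" "-b"] by simp
  then obtain N2 where N2: "negligible N2"
    "\<And>x. x \<notin> N2 \<Longrightarrow> ((\<lambda>h. integral {x..x+h} (\<lambda>x. g (-x)) / h) \<longlongrightarrow> g (-x)) (at_right 0)"
    using indefinite_integral_right_derivative[of "\<lambda>x. g (- x)"] by metis
  define N where "N = N1 \<union> uminus ` N2"
  have negN: "negligible N" unfolding N_def
    by (intro negligible_Un N1 negligible_differentiable_image_negligible[OF order_refl N2(1)])
      (simp add: differentiable_on_def)
  \<comment> \<open>The two end points are discarded along with \<open>N\<close>, so that small
    steps to either side stay in the interval.\<close>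
  have der: "(F has_real_derivative g x) (at x within {0..1})" if x: "x \<in> {0..1} - N - {0,1}" for x
  proof -
    have x01: "0 < x" "x < 1" using x by auto
    have xN: "x \<notin> N1" "-x \<notin> N2" using x by (auto simp: N_def image_iff) 
    have r: "((\<lambda>h. (F (x+h) - F x) / h) \<longlongrightarrow> g x) (at_right 0)"
    proof (rule Lim_transform_eventually[OF N1(2)[OF xN(1)]])
      show "\<forall>\<^sub>F h in at_right 0. integral {x..x+h} g / h = (F (x+h) - F x) / h"
        using eventually_at_right_less[of 0]
      proof eventually_elim
        case (elim h)
        show ?case using diff[of x "x+h"] x01(1) elim by simp
      qed
    qed
    have l: "((\<lambda>h. (F (x-h) - F x) / (-h)) \<longlongrightarrow> g x) (at_right 0)"
    proof (rule Lim_transform_eventually)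
      show "((\<lambda>h. integral {-x..-x+h} (\<lambda>x. g (-x)) / h) \<longlongrightarrow> g x) (at_right 0)" using N2(2)[OF xN(2)] by simp
      have "integral {-x..-x+h} (\<lambda>x. g (-x)) / h = (F (x-h) - F x) / (-h)" if "0 < h" "h < x" for h
      proof -
        have "integral {-x..-x+h} (\<lambda>x. g (-x)) = integral {x-h..x} g"
          using Henstock_Kurzweil_Integration.integral_reflect_real[of x "x-h" g] by simp
        also have "\<dots> = F x - F (x-h)" using diff[of "x-h" x] that by simp
        finally have e: "integral {-x..-x+h} (\<lambda>x. g (-x)) = F x - F (x-h)" .
        show ?thesis unfolding e using that by (simp add: divide_simps)
      qed
      then show "\<forall>\<^sub>F h in at_right 0. integral {-x..-x+h} (\<lambda>x. g (-x)) / h = (F (x-h) - F x) / (-h)"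
        unfolding eventually_at_right_field using x01(1) by blast
    qed
    have "((\<lambda>h. (F (x+h) - F x) / h) \<longlongrightarrow> g x) (at 0)"
      using r l by (simp add: filterlim_split_at filterlim_at_left_to_right)
    then have "(F has_real_derivative g x) (at x)" by (simp add: DERIV_def)
    then show ?thesis by (rule has_field_derivative_at_within)
  qed
  have "negligible (N \<union> {0,1})" using negN by (simp add: negligible_Un)
  then have "AE x in lborel. x \<in> {0..1} \<longrightarrow> (F has_real_derivative g x) (at x within {0..1})"
    unfolding AE_lborel_iff_negligible by (rule negligible_subset) (use der in auto)
  then have "AE x in lborel. x \<in> {0..1} \<longrightarrow> (F has_real_derivative f x) (at x within {0..1})"
    using fg by eventually_elim simp
  then have "prim F f" unfolding prim_def by (rule conjI[OF lip])
  moreover have "F 0 = 0" by (simp add: F_def)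
  ultimately show ?thesis by (rule that)
qed

lemma prim_cong:
  assumes "prim F f" "\<And>t. t \<in> {0..1} \<Longrightarrow> G t = F t" "\<And>t. t \<in> {0..1} \<Longrightarrow> f t = g t"
  shows "prim G g"
proof -
  have "AE t in lborel. t \<in> {0..1} \<longrightarrow> (F has_real_derivative f t) (at t within {0..1})"
    using assms(1) by (simp add: prim_def)
  then have "AE t in lborel. t \<in> {0..1} \<longrightarrow> (G has_real_derivative g t) (at t within {0..1})"
  proof eventually_elim
    case (elim t)
    show ?case
    proof
      assume t: "t \<in> {0..1}"
      then have "(F has_real_derivative g t) (at t within {0..1})" using elim assms(3) by simp
      then show "(G has_real_derivative g t) (at t within {0..1})"
        by (rule has_field_derivative_transform_within[OF _ zero_less_one t]) (use assms(2) in auto)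
    qed
  qed
  moreover have "lip G" using assms(1) lip_cong[OF assms(2)] by (simp add: prim_def)
  ultimately show ?thesis unfolding prim_def by (rule conjI[rotated])
qed

text \<open>Intended for \<open>f\<close> a sum of squares of extremal polynomials along the curve;
  continuity upgrades vanishing almost everywhere to vanishing at every time.\<close>

lemma prim_nonneg_zero:
  assumes "prim F f" "continuous_on {0..1} f" "\<And>t. t \<in> {0..1} \<Longrightarrow> 0 \<le> f t" "F 1 = F 0" "t \<in> {0..1}"
  shows "f t = 0"
proof -
  have "(f has_integral 0) {0..1}" using prim_has_integral[OF assms(1), of 1] assms(4) by simp
  then have "integral {0..1} f = 0" by (rule integral_unique)
  moreover have "integral {0..1} f = 0 \<longleftrightarrow> (\<forall>t\<in>{0..1}. f t = 0)"
    by (rule integral_eq_0_iff) (use assms(2,3) in simp_all)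
  ultimately show ?thesis using assms(5) by blast
qed

section \<open>Weighted homogeneous polynomials and vector fields\<close>

locale graded =
  fixes n :: nat and W :: "nat \<Rightarrow> nat"
  assumes W_pos: "0 < W j"
begin

text \<open>Degrees are integers: a negative degree forces the zero polynomial, so differentiation lowers
  the degree without side conditions and nilpotency becomes a degree count.\<close>

inductive wpoly :: "int \<Rightarrow> (point \<Rightarrow> real) \<Rightarrow> bool" where
  const: "wpoly 0 (\<lambda>x. c)"
| zero: "wpoly d (\<lambda>x. 0)"
| var: "j \<in> {1..n} \<Longrightarrow> wpoly (int (W j)) (\<lambda>x. x j)"
| add: "wpoly d f \<Longrightarrow> wpoly d g \<Longrightarrow> wpoly d (\<lambda>x. f x + g x)"
| mult: "wpoly d f \<Longrightarrow> wpoly e g \<Longrightarrow> wpoly (d + e) (\<lambda>x. f x * g x)"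

lemma wpoly_scale: "wpoly d f \<Longrightarrow> wpoly d (\<lambda>x. c * f x)"
  using mult[OF const, of d f c] by simp

lemma wpoly_diff: "wpoly d f \<Longrightarrow> wpoly d g \<Longrightarrow> wpoly d (\<lambda>x. f x - g x)"
  using add[OF _ wpoly_scale[of d g "-1"], of f] by simp

lemma wpoly_sum: "(\<And>i. i \<in> A \<Longrightarrow> wpoly d (f i)) \<Longrightarrow> wpoly d (\<lambda>x. \<Sum>i\<in>A. f i x)"
  by (induction A rule: infinite_finite_induct) (simp_all add: zero add)

lemma wpoly_mult_deg: "wpoly d f \<Longrightarrow> wpoly e g \<Longrightarrow> k = d + e \<Longrightarrow> wpoly k (\<lambda>x. f x * g x)"
  using mult by simp

text \<open>Positivity of the weights enters here. The two claims need a joint induction: in a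
  product of degree 0 either a factor has negative degree and is zero, or both factors have degree 0
  and are constant.\<close>

lemma wpoly_nonpos:
  "wpoly d f \<Longrightarrow> (d < 0 \<longrightarrow> f = (\<lambda>x. 0)) \<and> (d = 0 \<longrightarrow> (\<exists>c. f = (\<lambda>x. c)))"
proof (induction rule: wpoly.induct)
  case (var j)
  then show ?case using W_pos[of j] by simp
next
  case (add d f g)
  show ?case
  proof (intro conjI impI)
    assume "d < 0" then show "(\<lambda>x. f x + g x) = (\<lambda>x. 0)" using add by simp
  next
    assume "d = 0" then obtain a b where "f = (\<lambda>x. a)" "g = (\<lambda>x. b)" using add by blast
    then show "\<exists>c. (\<lambda>x. f x + g x) = (\<lambda>x. c)" by auto
  qed
next
  case (mult d f e g)
  show ?case
  proof (cases "d < 0 \<or> e < 0")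
    case True
    then have "f = (\<lambda>x. 0) \<or> g = (\<lambda>x. 0)" using mult by blast
    then have "(\<lambda>x. f x * g x) = (\<lambda>x. 0)" by auto
    then show ?thesis by blast
  next
    case False
    show ?thesis
    proof (intro conjI impI)
      assume "d + e < 0" then show "(\<lambda>x. f x * g x) = (\<lambda>x. 0)" using False by simp
    next
      assume "d + e = 0" then have "d = 0" "e = 0" using False by auto
      then obtain a b where "f = (\<lambda>x. a)" "g = (\<lambda>x. b)" using mult by blast
      then show "\<exists>c. (\<lambda>x. f x * g x) = (\<lambda>x. c)" by auto
    qed
  qed
qed auto

lemma wpoly_neg: "wpoly d f \<Longrightarrow> d < 0 \<Longrightarrow> f x = 0"
  using wpoly_nonpos by (metis (no_types))

lemma wpoly_deg0: "wpoly 0 f \<Longrightarrow> f x = f y"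
  using wpoly_nonpos[of 0 f] by auto

section \<open>Partial derivatives of weighted homogeneous polynomials\<close>

lemma wpoly_DERIV_ex: "wpoly d f \<Longrightarrow> \<exists>D. ((\<lambda>t. f (x(j := t))) has_real_derivative D) (at t)"
proof (induction rule: wpoly.induct)
  case (var i)
  show ?case by (cases "i = j") (auto intro: DERIV_ident DERIV_const)
next
  case (add d f g)
  then obtain D E where "((\<lambda>t. f (x(j := t))) has_real_derivative D) (at t)"
    "((\<lambda>t. g (x(j := t))) has_real_derivative E) (at t)" by blast
  then show ?case using DERIV_add by blast
next
  case (mult d f e g)
  then obtain D E where "((\<lambda>t. f (x(j := t))) has_real_derivative D) (at t)"
    "((\<lambda>t. g (x(j := t))) has_real_derivative E) (at t)" by blast
  then show ?case using DERIV_mult by blast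
qed (auto intro: DERIV_const)

lemma wpoly_DERIV: "wpoly d f \<Longrightarrow> ((\<lambda>t. f (x(j := t))) has_real_derivative pd f j (x(j := t))) (at t)"
  using wpoly_DERIV_ex[of d f x j t] by (auto simp: pd_def dest: DERIV_imp_deriv)

lemma wpoly_DERIV0: "wpoly d f \<Longrightarrow> ((\<lambda>t. f (x(j := t))) has_real_derivative pd f j x) (at (x j))"
  using wpoly_DERIV[of d f x j "x j"] by simp

lemma pd_eqI: "((\<lambda>t. f (x(j := t))) has_real_derivative D) (at (x j)) \<Longrightarrow> pd f j x = D"
  by (simp add: pd_def DERIV_imp_deriv)

lemma pd_const [simp]: "pd (\<lambda>x. c) j x = 0"
  by (rule pd_eqI) simp

lemma pd_var: "pd (\<lambda>x. x i) j x = (if i = j then 1 else 0)"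
  by (rule pd_eqI) auto

lemma pd_add: "wpoly d f \<Longrightarrow> wpoly e g \<Longrightarrow> pd (\<lambda>x. f x + g x) j x = pd f j x + pd g j x"
  by (rule pd_eqI) (intro DERIV_add wpoly_DERIV0)

lemma pd_diff: "wpoly d f \<Longrightarrow> wpoly e g \<Longrightarrow> pd (\<lambda>x. f x - g x) j x = pd f j x - pd g j x"
  by (rule pd_eqI) (intro DERIV_diff wpoly_DERIV0)

lemma pd_mult: "wpoly d f \<Longrightarrow> wpoly e g \<Longrightarrow> pd (\<lambda>x. f x * g x) j x = pd f j x * g x + f x * pd g j x"
  by (rule pd_eqI) (use DERIV_mult[OF wpoly_DERIV0[of d f x j] wpoly_DERIV0[of e g x j]] in \<open>simp add: algebra_simps\<close>)

lemma pd_scale: "wpoly d f \<Longrightarrow> pd (\<lambda>x. c * f x) j x = c * pd f j x"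
  by (rule pd_eqI) (intro DERIV_cmult wpoly_DERIV0)

lemma pd_sum:
  "(\<And>i. i \<in> A \<Longrightarrow> wpoly (d i) (f i)) \<Longrightarrow> pd (\<lambda>x. \<Sum>i\<in>A. f i x) j x = (\<Sum>i\<in>A. pd (f i) j x)"
  by (rule pd_eqI) (intro DERIV_sum wpoly_DERIV0)

lemma wpoly_pd: "wpoly d f \<Longrightarrow> wpoly (d - int (W j)) (pd f j)"
proof (induction rule: wpoly.induct)
  case (var i)
  have e: "pd (\<lambda>x. x i) j = (\<lambda>x. if i = j then 1 else 0)" using pd_var by blast
  show ?case unfolding e by (cases "i = j") (simp_all add: wpoly.const wpoly.zero)
next
  case (add d f g)
  have e: "pd (\<lambda>x. f x + g x) j = (\<lambda>x. pd f j x + pd g j x)" using pd_add add.hyps by blast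
  show ?case unfolding e by (rule wpoly.add[OF add.IH])
next
  case (mult d f e g)
  have e: "pd (\<lambda>x. f x * g x) j = (\<lambda>x. pd f j x * g x + f x * pd g j x)" using pd_mult mult.hyps by blast
  show ?case unfolding e
    by (rule wpoly.add; rule wpoly_mult_deg) (use mult in auto)
qed (simp_all add: pd_def wpoly.zero)

lemma pd_commute: "wpoly d f \<Longrightarrow> pd (pd f i) j x = pd (pd f j) i x"
proof (induction arbitrary: x rule: wpoly.induct)
  case (const c)
  have "pd (\<lambda>x. c) j = (\<lambda>x. 0)" for j by (rule ext) simp
  then show ?case by simp
next
  case (zero d)
  have "pd (\<lambda>x. 0) j = (\<lambda>x. 0)" for j by (rule ext) simp
  then show ?case by simp
next
  case (var k)
  have e: "pd (\<lambda>x. x k) j = (\<lambda>x. if k = j then 1 else 0)" for j using pd_var by blast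
  show ?case unfolding e by simp
next
  case (add d f g)
  have e: "pd (\<lambda>x. f x + g x) j = (\<lambda>x. pd f j x + pd g j x)" for j using pd_add add.hyps by blast
  show ?case unfolding e
    by (simp add: pd_add[OF wpoly_pd[OF add.hyps(1)] wpoly_pd[OF add.hyps(2)]] add.IH)
next
  case (mult d f e g)
  have e: "pd (\<lambda>x. f x * g x) j = (\<lambda>x. pd f j x * g x + f x * pd g j x)" for j using pd_mult mult.hyps by blast
  have "pd (\<lambda>x. pd f i x * g x + f x * pd g i x) j x =
     pd (pd f i) j x * g x + pd f i x * pd g j x + (pd f j x * pd g i x + f x * pd (pd g i) j x)" for i j x
    using pd_add[OF mult(1)[THEN wpoly_pd, THEN wpoly.mult, OF mult(2)] mult(2)[THEN wpoly_pd, THEN wpoly.mult[OF mult(1)]], of i i j x]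
      pd_mult[OF mult(1)[THEN wpoly_pd] mult(2)] pd_mult[OF mult(1) mult(2)[THEN wpoly_pd]] by simp
  then show ?case unfolding e by (simp add: mult.IH)
qed

lemma wpoly_chain:
  assumes "wpoly d f" "\<And>k. k \<in> {1..n} \<Longrightarrow> ((\<lambda>t. g t k) has_real_derivative g' k) (at t within S)"
  shows "((\<lambda>t. f (g t)) has_real_derivative (\<Sum>k=1..n. pd f k (g t) * g' k)) (at t within S)"
  using assms(1)
proof (induction rule: wpoly.induct)
  case (var j)
  have "(\<Sum>k=1..n. pd (\<lambda>x. x j) k (g t) * g' k) = (\<Sum>k=1..n. if j = k then g' k else 0)"
    by (rule sum.cong) (auto simp: pd_var)
  also have "\<dots> = g' j" using var by simp
  finally show ?case using assms(2)[OF var] by simp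
next
  case (add d f h)
  show ?case using DERIV_add[OF add.IH] by (simp add: pd_add[OF add.hyps] distrib_right sum.distrib)
next
  case (mult d f e h)
  show ?case using DERIV_mult[OF mult.IH]
    by (simp add: pd_mult[OF mult.hyps] distrib_right sum.distrib sum_distrib_left sum_distrib_right distrib_left mult_ac)
qed simp_all

text \<open>The sign convention makes a field of weight \<open>w\<close> lower degrees by
  \<open>w\<close>. Weights then add under brackets, and a field whose weight exceeds every
  \<open>W k\<close> is zero.\<close>

definition vpoly :: "int \<Rightarrow> vfield \<Rightarrow> bool" where
  "vpoly w X \<longleftrightarrow> (\<forall>x k. k \<notin> {1..n} \<longrightarrow> X x k = 0) \<and> (\<forall>k\<in>{1..n}. wpoly (int (W k) - w) (\<lambda>x. X x k))"

definition act :: "vfield \<Rightarrow> (point \<Rightarrow> real) \<Rightarrow> point \<Rightarrow> real" where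
  "act X f = (\<lambda>x. \<Sum>j=1..n. X x j * pd f j x)"

lemma vpoly_comp: "vpoly w X \<Longrightarrow> k \<in> {1..n} \<Longrightarrow> wpoly (int (W k) - w) (\<lambda>x. X x k)"
  by (simp add: vpoly_def)

lemma vpoly_outside: "vpoly w X \<Longrightarrow> k \<notin> {1..n} \<Longrightarrow> X x k = 0"
  by (simp add: vpoly_def)

lemma vpoly_wpoly: "vpoly w X \<Longrightarrow> wpoly (int (W k) - w) (\<lambda>x. X x k)"
  using zero[of "int (W k) - w"] by (cases "k \<in> {1..n}") (simp_all add: vpoly_def)

lemma vpoly_zero: "vpoly w (\<lambda>x k. 0)"
  by (simp add: vpoly_def zero)

lemma vpoly_scale: "vpoly w X \<Longrightarrow> vpoly w (\<lambda>x k. c * X x k)"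
  by (simp add: vpoly_def wpoly_scale)

lemma vpoly_sum: "(\<And>i. i \<in> A \<Longrightarrow> vpoly w (X i)) \<Longrightarrow> vpoly w (\<lambda>x k. \<Sum>i\<in>A. X i x k)"
  by (simp add: vpoly_def wpoly_sum)

lemma wpoly_act:
  assumes "vpoly w X" "wpoly d f" shows "wpoly (d - w) (act X f)"
  unfolding act_def
proof (rule wpoly_sum)
  fix j assume "j \<in> {1..n}"
  show "wpoly (d - w) (\<lambda>x. X x j * pd f j x)"
    by (rule wpoly_mult_deg[OF vpoly_wpoly[OF assms(1)] wpoly_pd[OF assms(2)]]) auto
qed

lemma act_diff: "wpoly d f \<Longrightarrow> wpoly e g \<Longrightarrow> act X (\<lambda>x. f x - g x) x = act X f x - act X g x"
  by (simp add: act_def pd_diff right_diff_distrib sum_subtractf)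

lemma act_scale: "wpoly d f \<Longrightarrow> act X (\<lambda>x. c * f x) x = c * act X f x"
  by (simp add: act_def pd_scale sum_distrib_left mult_ac)

lemma act_sum:
  "(\<And>i. i \<in> A \<Longrightarrow> wpoly (d i) (f i)) \<Longrightarrow> act X (\<lambda>x. \<Sum>i\<in>A. f i x) x = (\<Sum>i\<in>A. act X (f i) x)"
proof -
  assume a: "\<And>i. i \<in> A \<Longrightarrow> wpoly (d i) (f i)"
  have "act X (\<lambda>x. \<Sum>i\<in>A. f i x) x = (\<Sum>j=1..n. \<Sum>i\<in>A. X x j * pd (f i) j x)"
    by (simp add: act_def pd_sum[OF a] sum_distrib_left)
  also have "\<dots> = (\<Sum>i\<in>A. \<Sum>j=1..n. X x j * pd (f i) j x)" by (rule sum.swap)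
  finally show ?thesis by (simp add: act_def)
qed

lemma lie_act: "lie n X Y x k = act X (\<lambda>y. Y y k) x - act Y (\<lambda>y. X y k) x"
  by (simp add: lie_def act_def sum_subtractf)

lemma lie_fun: "(\<lambda>x. lie n X Y x k) = (\<lambda>x. act X (\<lambda>y. Y y k) x - act Y (\<lambda>y. X y k) x)"
  by (rule ext) (rule lie_act)

lemma vpoly_lie:
  assumes "vpoly a X" "vpoly b Y" shows "vpoly (a + b) (lie n X Y)"
  unfolding vpoly_def
proof (intro conjI allI impI ballI)
  fix x k assume "k \<notin> {1..n}"
  then have "(\<lambda>y. X y k) = (\<lambda>y. 0)" "(\<lambda>y. Y y k) = (\<lambda>y. 0)" using assms vpoly_outside by blast+
  then show "lie n X Y x k = 0" by (simp add: lie_def)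
next
  fix k
  show "wpoly (int (W k) - (a + b)) (\<lambda>x. lie n X Y x k)"
    unfolding lie_fun
    using wpoly_diff[of "int (W k) - (a+b)" "act X (\<lambda>y. Y y k)" "act Y (\<lambda>y. X y k)"]
      wpoly_act[OF assms(1) vpoly_wpoly[OF assms(2)], of k] wpoly_act[OF assms(2) vpoly_wpoly[OF assms(1)], of k]
    by (simp add: algebra_simps)
qed

text \<open>Both compositions contain the same second-order part, by symmetry of the mixed partial
  derivatives; the commutator keeps only the first-order terms.\<close>

lemma act_lie:
  assumes X: "vpoly a X" and Y: "vpoly b Y" and f: "wpoly d f"
  shows "act (lie n X Y) f x = act X (act Y f) x - act Y (act X f) x"
proof -
  have exp: "act X (act Y f) x = (\<Sum>i=1..n. \<Sum>j=1..n. X x i * pd (\<lambda>y. Y y j) i x * pd f j x)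
      + (\<Sum>i=1..n. \<Sum>j=1..n. X x i * Y x j * pd (pd f j) i x)"
    if X: "vpoly a X" and Y: "vpoly b Y" for a b X Y
  proof -
    have "pd (act Y f) i x = (\<Sum>j=1..n. pd (\<lambda>y. Y y j) i x * pd f j x + Y x j * pd (pd f j) i x)" for i
    proof -
      have "pd (act Y f) i x = (\<Sum>j=1..n. pd (\<lambda>y. Y y j * pd f j y) i x)"
        unfolding act_def by (rule pd_sum[OF wpoly.mult[OF vpoly_wpoly[OF Y] wpoly_pd[OF f]]])
      then show ?thesis by (simp add: pd_mult[OF vpoly_wpoly[OF Y] wpoly_pd[OF f]])
    qed
    then show ?thesis by (simp add: act_def[of X] sum_distrib_left sum.distrib algebra_simps)
  qed
  have s: "(\<Sum>i=1..n. \<Sum>j=1..n. X x i * Y x j * pd (pd f j) i x) = (\<Sum>i=1..n. \<Sum>j=1..n. Y x i * X x j * pd (pd f j) i x)"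
    by (subst sum.swap) (simp add: pd_commute[OF f] mult.commute)
  have "act (lie n X Y) f x = (\<Sum>j=1..n. \<Sum>i=1..n. X x i * pd (\<lambda>y. Y y j) i x * pd f j x)
      - (\<Sum>j=1..n. \<Sum>i=1..n. Y x i * pd (\<lambda>y. X y j) i x * pd f j x)"
    by (simp add: act_def lie_def sum_distrib_right sum_subtractf left_diff_distrib)
  also have "\<dots> = (\<Sum>i=1..n. \<Sum>j=1..n. X x i * pd (\<lambda>y. Y y j) i x * pd f j x)
      - (\<Sum>i=1..n. \<Sum>j=1..n. Y x i * pd (\<lambda>y. X y j) i x * pd f j x)"
    by (intro arg_cong2[where f="(-)"] sum.swap)
  finally show ?thesis using exp[OF X Y] exp[OF Y X] s by simp
qed

lemma lie_anti: "lie n X Y = (\<lambda>x k. - lie n Y X x k)"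
  by (rule ext)+ (simp add: lie_act)

text \<open>Written as the rule for moving \<open>Y\<close> past \<open>Z\<close> in a left-normed
  bracket, the form used both in Hall's collection and in the slice induction.\<close>

lemma lie_jacobi:
  assumes "vpoly a X" "vpoly b Y" "vpoly c Z"
  shows "lie n (lie n X Y) Z x k = lie n (lie n X Z) Y x k + lie n X (lie n Y Z) x k"
proof -
  have e: "act A (\<lambda>y. lie n B C y k) x = act A (act B (\<lambda>y. C y k)) x - act A (act C (\<lambda>y. B y k)) x"
    if "vpoly b B" "vpoly c C" for A B C b c
    unfolding lie_fun
    by (rule act_diff[OF wpoly_act[OF that(1) vpoly_wpoly[OF that(2)]] wpoly_act[OF that(2) vpoly_wpoly[OF that(1)]]])
  show ?thesis
    unfolding lie_act[of "lie n X Y"] lie_act[of "lie n X Z"] lie_act[of X "lie n Y Z"]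
      e[OF assms(1,2)] e[OF assms(1,3)] e[OF assms(2,3)]
      act_lie[OF assms(1,2) vpoly_wpoly[OF assms(3)]] act_lie[OF assms(1,3) vpoly_wpoly[OF assms(2)]]
      act_lie[OF assms(2,3) vpoly_wpoly[OF assms(1)]]
    by simp
qed

lemma lie_sum_left:
  assumes "\<And>l. l \<in> A \<Longrightarrow> vpoly (w l) (Z l)" "vpoly b Y"
  shows "lie n (\<lambda>x k. \<Sum>l\<in>A. c l * Z l x k) Y x k = (\<Sum>l\<in>A. c l * lie n (Z l) Y x k)"
proof -
  have "act Y (\<lambda>y. \<Sum>l\<in>A. c l * Z l y k) x = (\<Sum>l\<in>A. c l * act Y (\<lambda>y. Z l y k) x)"
  proof -
    have "wpoly (int (W k) - w l) (\<lambda>y. c l * Z l y k)" if "l \<in> A" for l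
      by (rule wpoly_scale[OF vpoly_wpoly[OF assms(1)[OF that]]])
    from act_sum[of A "\<lambda>l. int (W k) - w l" "\<lambda>l y. c l * Z l y k" Y x, OF this] show ?thesis
      by (simp add: act_scale[OF vpoly_wpoly[OF assms(1)]])
  qed
  moreover have "act (\<lambda>x k. \<Sum>l\<in>A. c l * Z l x k) (\<lambda>y. Y y k) x = (\<Sum>l\<in>A. c l * act (Z l) (\<lambda>y. Y y k) x)"
    by (simp add: act_def sum_distrib_left sum_distrib_right sum.swap[of _ A] mult_ac)
  ultimately show ?thesis by (simp add: lie_act sum_subtractf right_diff_distrib)
qed

lemma lie_sum_right:
  assumes "\<And>l. l \<in> A \<Longrightarrow> vpoly (w l) (Z l)" "vpoly b Y"
  shows "lie n Y (\<lambda>x k. \<Sum>l\<in>A. c l * Z l x k) x k = (\<Sum>l\<in>A. c l * lie n Y (Z l) x k)"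
proof -
  have "lie n Y (\<lambda>x k. \<Sum>l\<in>A. c l * Z l x k) x k = - lie n (\<lambda>x k. \<Sum>l\<in>A. c l * Z l x k) Y x k"
    using fun_cong[OF fun_cong[OF lie_anti]] .
  also have "\<dots> = - (\<Sum>l\<in>A. c l * lie n (Z l) Y x k)" using lie_sum_left[OF assms] by simp
  also have "\<dots> = (\<Sum>l\<in>A. c l * lie n Y (Z l) x k)"
    by (simp add: sum_negf[symmetric] fun_cong[OF fun_cong[OF lie_anti[of Y]]])
  finally show ?thesis .
qed

end

section \<open>Grayson--Grossman fields of a Hall basis\<close>

text \<open>The left-normed prefixes of a bracket: membership of u in the prefixes of l is the relation
  written i \<prec> l in the paper, for arbitrary u in place of a generator.\<close>

fun prefs :: "br \<Rightarrow> br set" where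
  "prefs (Gen i) = {Gen i}"
| "prefs (Br a b) = insert (Br a b) (prefs a)"

lemma prefs_self [simp]: "u \<in> prefs u" by (cases u) auto

lemma prefs_step: "Br u b \<in> prefs l \<Longrightarrow> u \<in> prefs l"
  by (induction l) auto

lemma prefs_next: "u \<in> prefs l \<Longrightarrow> u = l \<or> (\<exists>b. Br u b \<in> prefs l)"
  by (induction l) auto

lemma prefs_Gen: "Gen i \<in> prefs l \<longleftrightarrow> lhead l = i"
  by (induction l) auto

lemma prefs_Imul_le: "u \<in> prefs l \<Longrightarrow> Imul hb u j \<le> Imul hb l j"
  by (induction l) (auto intro: le_trans)

lemma wt_pos: "0 < wt u"
  by (induction u) auto

text \<open>The value 0 for generators lies below every index, so Hall's second condition on
  \<open>Br u v\<close> becomes \<open>lastidx hb u \<le> hidx hb v\<close> without a case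
  distinction.\<close>

fun lastidx :: "br list \<Rightarrow> br \<Rightarrow> nat" where
  "lastidx hb (Gen i) = 0"
| "lastidx hb (Br w z) = hidx hb z"

text \<open>The sign and the factorials are absorbed into the monomial, so that minus a partial derivative
  just lowers an exponent by one.\<close>

definition DM :: "nat \<Rightarrow> (nat \<Rightarrow> nat) \<Rightarrow> point \<Rightarrow> real" where
  "DM n \<beta> x = (\<Prod>j=1..n. (- x j) ^ \<beta> j / fact (\<beta> j))"

lemma DM_mono: "DM n \<beta> x = (-1) ^ mabs n \<beta> / real (mfact n \<beta>) * mono n x \<beta>"
proof -
  have "DM n \<beta> x = (\<Prod>j=1..n. (-1) ^ \<beta> j * x j ^ \<beta> j / fact (\<beta> j))"
    unfolding DM_def by (intro prod.cong refl) (subst power_minus, simp)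
  then show ?thesis
    by (simp add: mabs_def mfact_def mono_def power_sum prod.distrib prod_dividef)
qed

lemma pd_cong: "(\<And>t. f (x(j := t)) = g (x(j := t))) \<Longrightarrow> pd f j x = pd g j x"
  by (simp add: pd_def)

lemma pd_DM:
  assumes "z \<in> {1..n}"
  shows "pd (DM n \<beta>) z x = (if \<beta> z = 0 then 0 else - DM n (\<beta>(z := \<beta> z - 1)) x)"
proof -
  define R where "R = (\<Prod>j\<in>{1..n}-{z}. (- x j) ^ \<beta> j / fact (\<beta> j))"
  have split: "DM n \<gamma> (x(z := t)) = (- t) ^ \<gamma> z / fact (\<gamma> z) * R" if "\<And>j. j \<noteq> z \<Longrightarrow> \<gamma> j = \<beta> j" for t \<gamma>
  proof -
    have "DM n \<gamma> (x(z := t)) = (- t) ^ \<gamma> z / fact (\<gamma> z)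
        * (\<Prod>j\<in>{1..n}-{z}. (- (x(z:=t)) j) ^ \<gamma> j / fact (\<gamma> j))"
      unfolding DM_def using assms by (subst prod.remove[of _ z]) auto
    moreover have "(\<Prod>j\<in>{1..n}-{z}. (- (x(z:=t)) j) ^ \<gamma> j / fact (\<gamma> j)) = R"
      unfolding R_def using that by (intro prod.cong) auto
    ultimately show ?thesis by simp
  qed
  have e: "(\<lambda>t. DM n \<beta> (x(z := t))) = (\<lambda>t. (- t) ^ \<beta> z / fact (\<beta> z) * R)"
    using split[of \<beta>] by blast
  show ?thesis
  proof (cases "\<beta> z")
    case 0
    then show ?thesis by (simp add: pd_def e)
  next
    case (Suc b)
    have "((\<lambda>t. (- t) ^ Suc b) has_real_derivative - (real (Suc b) * (- x z) ^ b)) (at (x z))"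
      by (auto intro!: derivative_eq_intros simp del: power_Suc)
    then have "((\<lambda>t. (- t) ^ Suc b / fact (Suc b) * R) has_real_derivative
        - (real (Suc b) * (- x z) ^ b) / fact (Suc b) * R) (at (x z))"
      by (intro DERIV_cmult_right DERIV_cdivide)
    moreover have "- (real (Suc b) * (- x z) ^ b) / fact (Suc b) * R = - ((- x z) ^ b / fact b * R)"
      by (simp add: field_simps del: of_nat_Suc)
    moreover have "DM n (\<beta>(z := \<beta> z - 1)) x = (- x z) ^ b / fact b * R"
      using split[of "\<beta>(z := \<beta> z - 1)" "x z"] Suc by simp
    ultimately show ?thesis using Suc by (simp add: pd_def e DERIV_imp_deriv del: power_Suc fact_Suc)
  qed
qed

lemma DM_eq_0: "j \<in> {1..n} \<Longrightarrow> 0 < \<beta> j \<Longrightarrow> x j = 0 \<Longrightarrow> DM n \<beta> x = 0"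
  unfolding DM_def by (rule prod_zero) auto

lemma DM_zero: "(\<And>j. j \<in> {1..n} \<Longrightarrow> \<beta> j = 0) \<Longrightarrow> DM n \<beta> x = 1"
  unfolding DM_def by (rule prod.neutral) auto

context graded begin

lemma wpoly_power: "wpoly d f \<Longrightarrow> wpoly (int k * d) (\<lambda>x. f x ^ k)"
proof (induction k)
  case (Suc k)
  then show ?case using mult[of d f "int k * d" "\<lambda>x. f x ^ k"] by (simp add: algebra_simps)
qed (simp add: const)

lemma wpoly_DM: "wpoly (\<Sum>j=1..n. int (\<beta> j) * int (W j)) (DM n \<beta>)"
proof -
  have "wpoly (\<Sum>j\<in>A. int (\<beta> j) * int (W j)) (\<lambda>x. \<Prod>j\<in>A. (- x j) ^ \<beta> j / fact (\<beta> j))"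
    if "finite A" "A \<subseteq> {1..n}" for A
    using that
  proof (induction A rule: finite_induct)
    case (insert j A)
    have "wpoly (int (W j)) (\<lambda>x. - x j)" using wpoly_scale[OF var[of j], of "-1"] insert by simp
    from wpoly_scale[OF wpoly_power[OF this, of "\<beta> j"], of "1 / fact (\<beta> j)"]
    have "wpoly (int (\<beta> j) * int (W j)) (\<lambda>x. (- x j) ^ \<beta> j / fact (\<beta> j))" by simp
    from mult[OF this insert.IH] insert.prems show ?case
      by (simp only: prod.insert[OF insert.hyps] sum.insert[OF insert.hyps]) simp
  qed (simp add: const)
  from this[of "{1..n}"] show ?thesis unfolding DM_def by simp
qed

end

section \<open>Indices, weights and prefixes in a Hall basis\<close>

locale hall =
  fixes r s :: nat and hb :: "br list"
  assumes hb: "hall_basis r s hb"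
begin

definition W :: "nat \<Rightarrow> nat" where "W j = wt (hb ! (j - 1))"

sublocale graded "length hb" W
  by standard (simp add: W_def wt_pos)

abbreviation N where "N \<equiv> length hb"
abbreviation idx where "idx \<equiv> hidx hb"
abbreviation X where "X \<equiv> HX hb"
abbreviation el where "el l \<equiv> hb ! (l - 1)"

lemma idx_nth: assumes "l \<in> {1..N}" shows "idx (el l) = l"
proof -
  have d: "distinct hb" using hb by (simp add: hall_basis_def)
  have "(LEAST i. i < N \<and> hb ! i = el l) = l - 1"
    by (rule Least_equality) (use assms nth_eq_iff_index_eq[OF d] in auto)
  then show ?thesis using assms by (simp add: hidx_def)
qed

lemma hb_mem: "l \<in> {1..N} \<Longrightarrow> el l \<in> set hb"
  by (rule List.nth_mem) auto

lemma memE: assumes "u \<in> set hb" obtains l where "l \<in> {1..N}" "u = el l" "idx u = l"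
proof -
  obtain i where "i < N" "hb ! i = u" using assms by (metis in_set_conv_nth)
  then show thesis using that[of "Suc i"] idx_nth[of "Suc i"] by simp
qed

lemma idx_range: "u \<in> set hb \<Longrightarrow> idx u \<in> {1..N}"
  and nth_idx: "u \<in> set hb \<Longrightarrow> hb ! (idx u - 1) = u"
  by (metis memE)+

lemma idx_inj: "u \<in> set hb \<Longrightarrow> v \<in> set hb \<Longrightarrow> idx u = idx v \<Longrightarrow> u = v"
  using nth_idx by metis

lemma W_idx: "u \<in> set hb \<Longrightarrow> W (idx u) = wt u"
  by (simp add: W_def nth_idx[simplified])

lemma W_mono: "a \<in> {1..N} \<Longrightarrow> b \<in> {1..N} \<Longrightarrow> a \<le> b \<Longrightarrow> W a \<le> W b"
  using hb unfolding hall_basis_def W_def by auto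

lemma W_less: "a \<in> {1..N} \<Longrightarrow> b \<in> {1..N} \<Longrightarrow> W a < W b \<Longrightarrow> a < b"
  using W_mono[of b a] by fastforce

lemma wt_less_idx: "u \<in> set hb \<Longrightarrow> v \<in> set hb \<Longrightarrow> wt u < wt v \<Longrightarrow> idx u < idx v"
  using W_less[of "idx u" "idx v"] idx_range W_idx by simp

lemma wt_le_s: "u \<in> set hb \<Longrightarrow> wt u \<le> s"
  using hb by (simp add: hall_basis_def)

lemma W_le_s: "l \<in> {1..N} \<Longrightarrow> W l \<le> s"
  using wt_le_s[OF hb_mem] by (simp add: W_def)

lemma Br_mem:
  assumes "Br u v \<in> set hb"
  shows "u \<in> set hb" "v \<in> set hb" "idx v < idx u" "idx u < idx (Br u v)" "lastidx hb u \<le> idx v"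
proof -
  have "hall_el r hb (Br u v)" using hb assms by (auto simp: hall_basis_def)
  then show uv: "u \<in> set hb" "v \<in> set hb" and "idx v < idx u" and "lastidx hb u \<le> idx v"
    by (auto simp: hall_ok_def) (cases u; auto)
  show "idx u < idx (Br u v)" by (rule wt_less_idx) (use uv assms wt_pos in auto)
qed

lemma Br_memI:
  assumes "u \<in> set hb" "v \<in> set hb" "idx v < idx u" "lastidx hb u \<le> idx v" "wt u + wt v \<le> s"
  shows "Br u v \<in> set hb"
proof -
  have "hall_ok hb u v" using assms by (auto simp: hall_ok_def)
  then show ?thesis using hb assms by (simp add: hall_basis_def)
qed

lemma Gen_mem: assumes "i \<in> {1..r}" shows "Gen i \<in> set hb" "idx (Gen i) = i" "i \<in> {1..N}" "el i = Gen i"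
proof -
  have "i \<le> N" "el i = Gen i" using hb assms by (auto simp: hall_basis_def)
  then show "i \<in> {1..N}" "el i = Gen i" using assms by auto
  then show "Gen i \<in> set hb" "idx (Gen i) = i" using hb_mem[of i] idx_nth[of i] by simp_all
qed

lemma Gen_range: "Gen i \<in> set hb \<Longrightarrow> i \<in> {1..r}"
  using hb by (force simp: hall_basis_def)

lemma lhead_range: "u \<in> set hb \<Longrightarrow> lhead u \<in> {1..r}"
  by (induction u) (use Gen_range Br_mem(1) in auto)

lemma HX_idx: "u \<in> set hb \<Longrightarrow> X (idx u) = vf hb u"
  by (simp add: HX_def nth_idx[simplified])

lemma Imul_support: "u \<in> set hb \<Longrightarrow> Imul hb u j \<noteq> 0 \<Longrightarrow> j \<in> {1..N} \<and> j < idx u"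
proof (induction u)
  case (Br u v)
  then show ?case using Br_mem[OF Br.prems(1)] idx_range by (cases "j = idx v") fastforce+
qed simp

text \<open>The multi-index counts every letter except the head generator, whose weight is the
  missing 1. Hence each Grayson-Grossman field is homogeneous of weight 1.\<close>

lemma Imul_weight: "u \<in> set hb \<Longrightarrow> (\<Sum>j=1..N. int (Imul hb u j) * int (W j)) = int (wt u) - 1"
proof (induction u)
  case (Br u v)
  have "(\<Sum>j=1..N. int (Imul hb (Br u v) j) * int (W j))
     = (\<Sum>j=1..N. int (Imul hb u j) * int (W j)) + (\<Sum>j=1..N. if j = idx v then int (W j) else 0)"
    unfolding sum.distrib[symmetric] by (rule sum.cong) (auto simp: algebra_simps)
  also have "(\<Sum>j=1..N. if j = idx v then int (W j) else 0) = int (wt v)"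
    using idx_range[OF Br_mem(2)[OF Br.prems]] W_idx[OF Br_mem(2)[OF Br.prems]] by simp
  finally show ?case using Br by (simp add: Br_mem(1))
qed simp

lemma GG_DM: "GG hb i x k = (if k \<in> {1..N} \<and> lhead (el k) = i then DM N (Imul hb (el k)) x else 0)"
  by (simp add: GG_def DM_mono)

lemma vpoly_GG: "vpoly 1 (GG hb i)"
  unfolding vpoly_def
proof (intro conjI allI impI ballI)
  fix k assume k: "k \<in> {1..N}"
  show "wpoly (int (W k) - 1) (\<lambda>x. GG hb i x k)"
  proof (cases "lhead (el k) = i")
    case True
    then show ?thesis using k wpoly_DM[of "Imul hb (el k)"] Imul_weight[OF hb_mem[OF k]]
      by (simp add: GG_DM W_def)
  next
    case False
    then show ?thesis by (simp add: GG_DM zero)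
  qed
qed (auto simp: GG_DM)

lemma vpoly_vf: "vpoly (int (wt u)) (vf hb u)"
  by (induction u) (auto simp: vpoly_GG vpoly_lie)

lemma vpoly_HX: "vpoly (int (W l)) (X l)"
  by (simp add: HX_def W_def vpoly_vf)

lemma vpoly_large_zero: "vpoly w Y \<Longrightarrow> int s < w \<Longrightarrow> Y x k = 0"
  using wpoly_neg[OF vpoly_comp[of w Y k]] W_le_s[of k] vpoly_outside[of w Y k x] by (cases "k \<in> {1..N}") auto

lemma prefs_mem: "l \<in> set hb \<Longrightarrow> u \<in> prefs l \<Longrightarrow> u \<in> set hb \<and> idx u \<le> idx l \<and> lastidx hb u \<le> lastidx hb l"
proof (induction l)
  case (Br a b)
  show ?case
  proof (cases "u = Br a b")
    case False
    then have "u \<in> prefs a" using Br.prems by auto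
    then show ?thesis using Br Br_mem[OF Br.prems(1)] by fastforce
  qed (use Br in auto)
qed auto

text \<open>Letters after the head never decrease in a Hall element, so from \<open>b\<close> on no
  letter smaller than \<open>idx b\<close> is added.\<close>

lemma prefs_Imul_small:
  "l \<in> set hb \<Longrightarrow> Br w b \<in> prefs l \<Longrightarrow> j < idx b \<Longrightarrow> Imul hb l j = Imul hb w j"
proof (induction l)
  case (Br a c)
  show ?case
  proof (cases "Br w b = Br a c")
    case False
    then have p: "Br w b \<in> prefs a" using Br.prems by auto
    have "idx b \<le> lastidx hb a" using prefs_mem[OF _ p] Br_mem[OF Br.prems(1)] by simp
    then have "j < idx c" using Br_mem(5)[OF Br.prems(1)] Br.prems by linarith
    then show ?thesis using Br p Br_mem(1)[OF Br.prems(1)] by simp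
  qed (use Br in auto)
qed simp

definition slice :: "nat \<Rightarrow> point set" where "slice z = {x. \<forall>j. 1 \<le> j \<and> j < z \<longrightarrow> x j = 0}"

lemma slice_mono: "x \<in> slice z \<Longrightarrow> y \<le> z \<Longrightarrow> x \<in> slice y"
  by (auto simp: slice_def)

lemma slice_upd: "x \<in> slice z \<Longrightarrow> z \<le> j \<Longrightarrow> x(j := t) \<in> slice z"
  by (auto simp: slice_def)

abbreviation "IM l \<equiv> Imul hb (el l)"

text \<open>If \<open>el l\<close> properly extends \<open>z\<close>, the next letter
  \<open>b\<close> has \<open>idx b < idx z\<close> by Hall's condition; its coordinate is 0 on the
  slice and divides the monomial. This is why X_z becomes d/dx_z there.\<close>

lemma DM_prefs_slice:
  assumes z: "z \<in> set hb" and l: "l \<in> {1..N}" and x: "x \<in> slice (idx z)" and p: "z \<in> prefs (el l)"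
  shows "DM N (\<lambda>j. IM l j - Imul hb z j) x = (if l = idx z then 1 else 0)"
proof (cases "l = idx z")
  case True
  then show ?thesis by (simp add: nth_idx[OF z, simplified] DM_zero)
next
  case False
  then have "z \<noteq> el l" using idx_nth[OF l] by auto
  then obtain b where b: "Br z b \<in> prefs (el l)" using prefs_next[OF p] by blast
  then have m: "Br z b \<in> set hb" using prefs_mem[OF hb_mem[OF l]] by blast
  have "Imul hb (Br z b) (idx b) \<le> IM l (idx b)" by (rule prefs_Imul_le[OF b])
  then have "0 < IM l (idx b) - Imul hb z (idx b)" by simp
  moreover have "x (idx b) = 0" using x Br_mem(3)[OF m] idx_range[OF Br_mem(2)[OF m]] by (simp add: slice_def)
  ultimately show ?thesis using False DM_eq_0[OF idx_range[OF Br_mem(2)[OF m]]] by simp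
qed

lemma lastidx_le: assumes "z \<in> set hb" shows "lastidx hb z \<le> idx z"
proof (cases z)
  case (Br a b)
  then show ?thesis using Br_mem(3,4)[of a b] assms by simp
qed simp

text \<open>For u = [w, z], the field X_z equals d/dx_z on the slice of z and X_w is tangent to it, so there
  [X_w, X_z] is obtained from the explicit formula for X_w by applying -d/dx_z.\<close>

lemma vf_slice:
  "u \<in> set hb \<Longrightarrow> l \<in> {1..N} \<Longrightarrow> x \<in> slice (lastidx hb u) \<Longrightarrow>
    vf hb u x l = (if u \<in> prefs (el l) then DM N (\<lambda>j. IM l j - Imul hb u j) x else 0)"
proof (induction u arbitrary: l x)
  case (Gen i)
  then show ?case by (simp add: GG_DM prefs_Gen)
next
  case (Br w z)
  note m = Br_mem[OF Br.prems(1)]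
  define q where "q = idx z"
  have qN: "q \<in> {1..N}" using idx_range[OF m(2)] by (simp add: q_def)
  have x: "x \<in> slice q" using Br.prems(3) by (simp add: q_def)
  have lz: "lastidx hb z \<le> q" using lastidx_le[OF m(2)] by (simp add: q_def)
  have z_at: "vf hb z y j = (if j = q then 1 else 0)" if "y \<in> slice q" "j \<in> {1..N}" for y j
  proof -
    have e: "vf hb z y j = (if z \<in> prefs (el j) then DM N (\<lambda>i. IM j i - Imul hb z i) y else 0)"
      by (rule Br.IH(2)[OF m(2) that(2) slice_mono[OF that(1) lz]])
    show ?thesis
    proof (cases "z \<in> prefs (el j)")
      case True
      then show ?thesis using e DM_prefs_slice[OF m(2) that(2) _ True] that(1) by (simp add: q_def)
    next
      case False
      then have "j \<noteq> q" using nth_idx[OF m(2)] by (auto simp: q_def)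
      then show ?thesis using e False by simp
    qed
  qed
  let ?D = "\<lambda>y. if w \<in> prefs (el l) then DM N (\<lambda>j. IM l j - Imul hb w j) y else 0"
  have w_at: "vf hb w y j = (if w \<in> prefs (el j) then DM N (\<lambda>i. IM j i - Imul hb w i) y else 0)"
    if "y \<in> slice q" "j \<in> {1..N}" for y j
    by (rule Br.IH(1)[OF m(1) that(2) slice_mono[OF that(1)]]) (use m(5) in \<open>simp add: q_def\<close>)
  have w0: "vf hb w x j = 0" if "j \<in> {1..N}" "j < q" for j
  proof -
    have "w \<notin> prefs (el j)"
      using prefs_mem[OF hb_mem[OF that(1)], of w] idx_nth[OF that(1)] that(2) m(3) by (auto simp: q_def)
    then show ?thesis using w_at[OF x that(1)] by simp
  qed
  \<comment> \<open>One half of the bracket drops out: \<open>vf hb w\<close> has no component below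
    \<open>q\<close>, and moving in a direction \<open>j \<ge> q\<close> stays in the slice, where
    \<open>vf hb z\<close> is constant.\<close>
  have first: "vf hb w x j * pd (\<lambda>y. vf hb z y l) j x = 0" if j: "j \<in> {1..N}" for j
  proof (cases "j < q")
    case False
    have "pd (\<lambda>y. vf hb z y l) j x = pd (\<lambda>y. if l = q then 1 else 0) j x"
      by (rule pd_cong) (use z_at[OF slice_upd[OF x] Br.prems(2)] False in auto)
    then show ?thesis by simp
  qed (use w0 j in simp)
  have "lie N (vf hb w) (vf hb z) x l = (\<Sum>j=1..N. - (vf hb z x j * pd (\<lambda>y. vf hb w y l) j x))"
    unfolding lie_def by (intro sum.cong refl) (simp add: first)
  also have "\<dots> = (\<Sum>j=1..N. if j = q then - pd (\<lambda>y. vf hb w y l) j x else 0)"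
    by (intro sum.cong refl) (simp add: z_at[OF x])
  also have "\<dots> = - pd (\<lambda>y. vf hb w y l) q x" using qN by simp
  also have "pd (\<lambda>y. vf hb w y l) q x = pd ?D q x"
    by (rule pd_cong) (use w_at[OF slice_upd[OF x] Br.prems(2)] in auto)
  also have "- pd ?D q x = (if Br w z \<in> prefs (el l) then DM N (\<lambda>j. IM l j - Imul hb (Br w z) j) x else 0)"
  proof (cases "w \<in> prefs (el l)")
    case False
    then show ?thesis using prefs_step by auto
  next
    case True
    define \<beta> where "\<beta> = (\<lambda>j. IM l j - Imul hb w j)"
    have D: "- pd ?D q x = (if \<beta> q = 0 then 0 else DM N (\<beta>(q := \<beta> q - 1)) x)"
      using True pd_DM[OF qN, of \<beta> x] by (simp add: \<beta>_def)
    show ?thesis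
    proof (cases "Br w z \<in> prefs (el l)")
      case T: True
      have "Imul hb (Br w z) q \<le> IM l q" by (rule prefs_Imul_le[OF T])
      then have "\<beta> q \<noteq> 0" by (simp add: \<beta>_def q_def)
      moreover have "\<beta>(q := \<beta> q - 1) = (\<lambda>j. IM l j - Imul hb (Br w z) j)"
        by (rule ext) (auto simp: \<beta>_def q_def)
      ultimately show ?thesis using T D by simp
    next
      case F: False
      \<comment> \<open>The letter \<open>b\<close> following \<open>w\<close> in
        \<open>el l\<close> is not \<open>z\<close>. If \<open>idx b < q\<close>, the lowered
        monomial still contains a coordinate that is 0 on the slice; if \<open>idx b > q\<close>,
        later letters do not return to \<open>q\<close>, so \<open>x q\<close> does not occur. If
        \<open>w = el l\<close>, the monomial is constant.\<close>
      have "(if \<beta> q = 0 then 0 else DM N (\<beta>(q := \<beta> q - 1)) x) = 0"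
      proof (cases "w = el l")
        case False
        then obtain b where b: "Br w b \<in> prefs (el l)" using prefs_next[OF True] by blast
        then have mb: "Br w b \<in> set hb" using prefs_mem[OF hb_mem[OF Br.prems(2)]] by blast
        have "b \<noteq> z" using b F by blast
        then have ne: "idx b \<noteq> q" using idx_inj[OF Br_mem(2)[OF mb] m(2)] by (auto simp: q_def)
        show ?thesis
        proof (cases "idx b < q")
          case True
          have "Imul hb (Br w b) (idx b) \<le> IM l (idx b)" by (rule prefs_Imul_le[OF b])
          then have "0 < (\<beta>(q := \<beta> q - 1)) (idx b)" using ne by (simp add: \<beta>_def)
          moreover have "x (idx b) = 0" using x True idx_range[OF Br_mem(2)[OF mb]] by (simp add: slice_def)
          ultimately show ?thesis using DM_eq_0[OF idx_range[OF Br_mem(2)[OF mb]]] by simp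
        next
          case False
          then have "q < idx b" using ne by simp
          then have "\<beta> q = 0" using prefs_Imul_small[OF hb_mem[OF Br.prems(2)] b] by (simp add: \<beta>_def)
          then show ?thesis by simp
        qed
      qed (simp add: \<beta>_def)
      then show ?thesis using F D by simp
    qed
  qed
  finally show ?case by simp
qed

lemma HX_slice:
  assumes l: "l \<in> {1..N}" and x: "x \<in> slice l"
  shows "X l x k = (if k = l then 1 else 0)"
proof (cases "k \<in> {1..N}")
  case True
  define z where "z = el l"
  have z: "z \<in> set hb" "idx z = l" using hb_mem[OF l] idx_nth[OF l] by (simp_all add: z_def)
  have "vf hb z x k = (if z \<in> prefs (el k) then DM N (\<lambda>j. IM k j - Imul hb z j) x else 0)"
    by (rule vf_slice[OF z(1) True]) (use slice_mono[OF x] lastidx_le[OF z(1)] z in simp)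
  moreover have "z \<in> prefs (el k)" if "k = l" using that by (simp add: z_def)
  ultimately show ?thesis using DM_prefs_slice[OF z(1) True] x z by (auto simp: HX_def z_def)
next
  case False
  then show ?thesis using l vpoly_outside[OF vpoly_HX] by auto
qed

lemma HX_0: "l \<in> {1..N} \<Longrightarrow> X l (\<lambda>_. 0) k = (if k = l then 1 else 0)"
  by (rule HX_slice) (auto simp: slice_def)

end

section \<open>The span of the Hall fields is a Lie algebra\<close>

context hall begin

definition lcomb :: "(nat \<Rightarrow> real) \<Rightarrow> vfield" where
  "lcomb c = (\<lambda>x k. \<Sum>l=1..N. c l * X l x k)"

text \<open>The weight is exact and not just a bound, so degrees can be read off a member of the
  span. The zero field belongs to every weight.\<close>

definition Sp :: "nat \<Rightarrow> vfield \<Rightarrow> bool" where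
  "Sp w Z \<longleftrightarrow> (\<exists>c. (\<forall>l. c l \<noteq> 0 \<longrightarrow> l \<in> {1..N} \<and> W l = w) \<and> Z = lcomb c)"

lemma SpE:
  assumes "Sp w Z" obtains c where "\<And>l. c l \<noteq> 0 \<Longrightarrow> l \<in> {1..N} \<and> W l = w" "Z = lcomb c"
  using assms unfolding Sp_def by metis

lemma SpI: "Z = lcomb c \<Longrightarrow> (\<And>l. c l \<noteq> 0 \<Longrightarrow> l \<in> {1..N} \<and> W l = w) \<Longrightarrow> Sp w Z"
  unfolding Sp_def by (intro exI[of _ c]) simp

lemma Sp_HX: assumes "l \<in> {1..N}" shows "Sp (W l) (X l)"
proof -
  have "X l = lcomb (\<lambda>k. if k = l then 1 else 0)"
  proof (intro ext)
    fix x k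
    have "lcomb (\<lambda>k. if k = l then 1 else 0) x k = (\<Sum>i=1..N. if i = l then X i x k else 0)"
      unfolding lcomb_def by (rule sum.cong) auto
    then show "X l x k = lcomb (\<lambda>k. if k = l then 1 else 0) x k" using assms by simp
  qed
  then show ?thesis unfolding Sp_def using assms by (intro exI[of _ "\<lambda>k. if k = l then 1 else 0"]) auto
qed

lemma Sp_zero: "Sp w (\<lambda>x k. 0)"
  unfolding Sp_def by (rule exI[of _ "\<lambda>_. 0"]) (auto simp: lcomb_def)

lemma Sp_add: assumes "Sp w Y" "Sp w Z" shows "Sp w (\<lambda>x k. Y x k + Z x k)"
proof -
  obtain c where c: "\<And>l. c l \<noteq> 0 \<Longrightarrow> l \<in> {1..N} \<and> W l = w" "Y = lcomb c" using assms(1) by (rule SpE) blast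
  obtain d where d: "\<And>l. d l \<noteq> 0 \<Longrightarrow> l \<in> {1..N} \<and> W l = w" "Z = lcomb d" using assms(2) by (rule SpE) blast
  have "(\<lambda>x k. Y x k + Z x k) = lcomb (\<lambda>l. c l + d l)"
    by (simp add: c d lcomb_def distrib_right sum.distrib)
  moreover have "l \<in> {1..N} \<and> W l = w" if "c l + d l \<noteq> 0" for l
    using c(1)[of l] d(1)[of l] that by (cases "c l = 0") auto
  ultimately show ?thesis by (rule SpI)
qed

lemma Sp_scale: assumes "Sp w Z" shows "Sp w (\<lambda>x k. a * Z x k)"
proof -
  obtain c where c: "\<And>l. c l \<noteq> 0 \<Longrightarrow> l \<in> {1..N} \<and> W l = w" "Z = lcomb c" using assms(1) by (rule SpE) blast
  have "(\<lambda>x k. a * Z x k) = lcomb (\<lambda>l. a * c l)"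
    by (simp add: c lcomb_def sum_distrib_left mult_ac)
  moreover have "l \<in> {1..N} \<and> W l = w" if "a * c l \<noteq> 0" for l using c(1)[of l] that by simp
  ultimately show ?thesis by (rule SpI)
qed

lemma Sp_neg: "Sp w Z \<Longrightarrow> Sp w (\<lambda>x k. - Z x k)"
  using Sp_scale[of w Z "-1"] by simp

lemma Sp_sum: "(\<And>i. i \<in> A \<Longrightarrow> Sp w (Z i)) \<Longrightarrow> Sp w (\<lambda>x k. \<Sum>i\<in>A. Z i x k)"
  by (induction A rule: infinite_finite_induct) (simp_all add: Sp_zero Sp_add)

lemma Sp_vpoly: assumes "Sp w Z" shows "vpoly (int w) Z"
proof -
  obtain c where c: "\<And>l. c l \<noteq> 0 \<Longrightarrow> l \<in> {1..N} \<and> W l = w" "Z = lcomb c" using assms(1) by (rule SpE) blast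
  have "vpoly (int w) (\<lambda>x k. c l * X l x k)" for l
    using c(1)[of l] vpoly_scale[OF vpoly_HX[of l]] vpoly_zero by (cases "c l = 0") auto
  then show ?thesis unfolding c(2) lcomb_def by (rule vpoly_sum)
qed

lemma Sp_at0:
  assumes "Sp w Z"
  shows "Z (\<lambda>_. 0) l \<noteq> 0 \<Longrightarrow> l \<in> {1..N} \<and> W l = w" and "Z = lcomb (Z (\<lambda>_. 0))"
proof -
  obtain c where c: "\<And>l. c l \<noteq> 0 \<Longrightarrow> l \<in> {1..N} \<and> W l = w" "Z = lcomb c" using assms(1) by (rule SpE) blast
  have "Z (\<lambda>_. 0) = c"
  proof
    fix k
    have "Z (\<lambda>_. 0) k = (\<Sum>l=1..N. if l = k then c l else 0)"
      unfolding c(2) lcomb_def by (rule sum.cong) (auto simp: HX_0)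
    also have "\<dots> = c k" using c(1)[of k] by auto
    finally show "Z (\<lambda>_. 0) k = c k" .
  qed
  then show "Z (\<lambda>_. 0) l \<noteq> 0 \<Longrightarrow> l \<in> {1..N} \<and> W l = w" and "Z = lcomb (Z (\<lambda>_. 0))"
    using c by auto
qed

lemma lie_lcomb_left:
  assumes "vpoly b Y"
  shows "lie N (lcomb c) Y = (\<lambda>x k. \<Sum>l=1..N. c l * lie N (X l) Y x k)"
  unfolding lcomb_def by (intro ext lie_sum_left[OF vpoly_HX assms])

lemma Sp_lie_left:
  assumes "Sp a Z" "vpoly b Y" "\<And>l. l \<in> {1..N} \<Longrightarrow> W l = a \<Longrightarrow> Sp w (lie N (X l) Y)"
  shows "Sp w (lie N Z Y)"
proof -
  obtain c where c: "\<And>l. c l \<noteq> 0 \<Longrightarrow> l \<in> {1..N} \<and> W l = a" "Z = lcomb c" using assms(1) by (rule SpE) blast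
  have "Sp w (\<lambda>x k. c l * lie N (X l) Y x k)" for l
    using c(1)[of l] Sp_scale[OF assms(3)[of l]] Sp_zero by (cases "c l = 0") auto
  then show ?thesis unfolding c(2) lie_lcomb_left[OF assms(2)] by (rule Sp_sum)
qed

lemma Sp_lie_right:
  assumes "Sp a Z" "vpoly b Y" "\<And>l. l \<in> {1..N} \<Longrightarrow> W l = a \<Longrightarrow> Sp w (lie N Y (X l))"
  shows "Sp w (lie N Y Z)"
proof -
  have "Sp w (lie N (X l) Y)" if "l \<in> {1..N}" "W l = a" for l
    using Sp_neg[OF assms(3)[OF that]] unfolding lie_anti[of Y "X l"] by simp
  then have "Sp w (lie N Z Y)" by (rule Sp_lie_left[OF assms(1,2)])
  then show ?thesis using Sp_neg unfolding lie_anti[of Y Z] by blast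
qed

text \<open>Hall's collection step. If [X_a, X_b] with X_a = [X_p, X_q] is not basic, then b < q, and by the
  Jacobi identity it is a combination of brackets of the same total weight whose smaller index exceeds b.\<close>

lemma lie_HX_step:
  assumes ab: "a \<in> {1..N}" "b \<in> {1..N}" "b < a"
    and IH1: "\<And>c d. c \<in> {1..N} \<Longrightarrow> d \<in> {1..N} \<Longrightarrow> W c + W d < W a + W b \<Longrightarrow> Sp (W c + W d) (lie N (X c) (X d))"
    and IH2: "\<And>c d. c \<in> {1..N} \<Longrightarrow> d \<in> {1..N} \<Longrightarrow> W c + W d = W a + W b \<Longrightarrow> b < min c d \<Longrightarrow> Sp (W c + W d) (lie N (X c) (X d))"
  shows "Sp (W a + W b) (lie N (X a) (X b))"
proof (cases "s < W a + W b")
  case True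
  have "lie N (X a) (X b) = (\<lambda>x k. 0)"
    by (intro ext vpoly_large_zero[OF vpoly_lie[OF vpoly_HX vpoly_HX]]) (use True in simp)
  then show ?thesis using Sp_zero by simp
next
  case le: False
  define u v where "u = el a" and "v = el b"
  have u: "u \<in> set hb" "idx u = a" "wt u = W a" and v: "v \<in> set hb" "idx v = b" "wt v = W b"
    using hb_mem idx_nth ab by (simp_all add: u_def v_def W_def)
  have HXu: "X a = vf hb u" and HXv: "X b = vf hb v" by (simp_all add: HX_def u_def v_def)
  show ?thesis
  proof (cases "lastidx hb u \<le> b")
    case True
    have m: "Br u v \<in> set hb" by (rule Br_memI) (use u v ab True le in auto)
    have "lie N (X a) (X b) = X (idx (Br u v))" by (simp add: HX_idx[OF m] HXu HXv)
    moreover have "W (idx (Br u v)) = W a + W b" using W_idx[OF m] u v by simp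
    ultimately show ?thesis using Sp_HX[OF idx_range[OF m]] by simp
  next
    case False
    then obtain w z where uwz: "u = Br w z" by (cases u) auto
    note m = Br_mem[OF u(1)[unfolded uwz]]
    define p q where "p = idx w" and "q = idx z"
    have pq: "p \<in> {1..N}" "q \<in> {1..N}" "q < p" "b < q"
      using m idx_range False by (simp_all add: p_def q_def uwz)
    have Wpq: "W p = wt w" "W q = wt z" using m W_idx by (simp_all add: p_def q_def)
    then have Wa: "W a = W p + W q" using u by (simp add: uwz)
    have HXa: "X a = lie N (X p) (X q)"
      using HXu m by (simp add: uwz p_def q_def HX_idx)
    have jac: "lie N (X a) (X b) = (\<lambda>x k. lie N (lie N (X p) (X b)) (X q) x k
       + lie N (X p) (lie N (X q) (X b)) x k)"
      unfolding HXa by (intro ext lie_jacobi[OF vpoly_HX vpoly_HX vpoly_HX])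
    \<comment> \<open>Elements heavier than \<open>el b\<close> come after it in the Hall order.
      Expanding an inner bracket with \<open>X b\<close> therefore gives indices
      \<open>l > b\<close> only, and as \<open>p\<close> and \<open>q\<close> also exceed
      \<open>b\<close>, the smaller index has grown.\<close>
    have gt: "b < l" if "l \<in> {1..N}" "W l = W c + W b" for l c
      by (rule W_less[OF ab(2) that(1)]) (use that W_pos[of c] in simp)
    have s1: "Sp (W p + W b) (lie N (X p) (X b))"
      by (rule IH1) (use pq ab Wa W_pos[of q] in simp_all)
    have s2: "Sp (W q + W b) (lie N (X q) (X b))"
      by (rule IH1) (use pq ab Wa W_pos[of p] in simp_all)
    have "Sp (W a + W b) (lie N (lie N (X p) (X b)) (X q))"
    proof (rule Sp_lie_left[OF s1 vpoly_HX])
      fix l assume l: "l \<in> {1..N}" "W l = W p + W b"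
      have "Sp (W l + W q) (lie N (X l) (X q))"
        by (rule IH2) (use l pq Wa gt[OF l] in auto)
      then show "Sp (W a + W b) (lie N (X l) (X q))" using l Wa by (simp add: ac_simps)
    qed
    moreover have "Sp (W a + W b) (lie N (X p) (lie N (X q) (X b)))"
    proof (rule Sp_lie_right[OF s2 vpoly_HX])
      fix l assume l: "l \<in> {1..N}" "W l = W q + W b"
      have "Sp (W p + W l) (lie N (X p) (X l))"
        by (rule IH2) (use l pq Wa gt[OF l] in auto)
      then show "Sp (W a + W b) (lie N (X p) (X l))" using l Wa by (simp add: ac_simps)
    qed
    ultimately show ?thesis unfolding jac by (rule Sp_add)
  qed
qed

text \<open>Termination of the collection: the outer induction is on the total weight, the inner
  one, at fixed weight, on how far the smaller index is from its upper bound
  \<open>N\<close>.\<close>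

lemma Sp_lie_HX:
  "a \<in> {1..N} \<Longrightarrow> b \<in> {1..N} \<Longrightarrow> Sp (W a + W b) (lie N (X a) (X b))"
proof (induction "W a + W b" arbitrary: a b rule: less_induct)
  case outer: less
  define T where "T = W a + W b"
  have "Sp (W c + W d) (lie N (X c) (X d))"
    if "c \<in> {1..N}" "d \<in> {1..N}" "W c + W d = T" for c d
    using that
  proof (induction "N - min c d" arbitrary: c d rule: less_induct)
    case inner: less
    have step: "Sp (W c' + W d') (lie N (X c') (X d'))"
      if "c' \<in> {1..N}" "d' \<in> {1..N}" "d' < c'" "W c' + W d' = T" "min c' d' = min c d" for c' d'
    proof (rule lie_HX_step[OF that(1-3)])
      fix e f assume "e \<in> {1..N}" "f \<in> {1..N}" "W e + W f < W c' + W d'"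
      then show "Sp (W e + W f) (lie N (X e) (X f))"
        using outer.hyps that by (simp add: T_def)
    next
      fix e f assume a: "e \<in> {1..N}" "f \<in> {1..N}" "W e + W f = W c' + W d'" "d' < min e f"
      show "Sp (W e + W f) (lie N (X e) (X f))"
        by (rule inner.hyps[OF _ a(1,2)]) (use a that in auto)
    qed
    consider "d < c" | "c < d" | "c = d" by linarith
    then show ?case
    proof cases
      case 1 then show ?thesis using step[of c d] inner.prems by simp
    next
      case 2
      then have "Sp (W d + W c) (lie N (X d) (X c))"
        using step[of d c] inner.prems by (simp add: min.commute add.commute)
      then show ?thesis using Sp_neg unfolding lie_anti[of "X c"] by (simp add: add.commute)
    next
      case 3
      then have "lie N (X c) (X d) = (\<lambda>x k. 0)" by (intro ext) (simp add: lie_act)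
      then show ?thesis using Sp_zero by simp
    qed
  qed
  then show ?case using outer.prems by (simp add: T_def)
qed

lemma Sp_lie:
  assumes "Sp a Y" "Sp b Z" shows "Sp (a + b) (lie N Y Z)"
proof (rule Sp_lie_left[OF assms(1) Sp_vpoly[OF assms(2)]])
  fix l assume l: "l \<in> {1..N}" "W l = a"
  show "Sp (a + b) (lie N (X l) Z)"
  proof (rule Sp_lie_right[OF assms(2) vpoly_HX])
    fix k assume "k \<in> {1..N}" "W k = b"
    then show "Sp (a + b) (lie N (X l) (X k))" using Sp_lie_HX[of l k] l by simp
  qed
qed

lemma Sp_vf: "u \<in> set hb \<Longrightarrow> Sp (wt u) (vf hb u)"
  using Sp_HX[OF idx_range] by (simp add: HX_idx W_idx)

lemma Sp_large: "Sp w Z \<Longrightarrow> s < w \<Longrightarrow> Z x k = 0"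
  using vpoly_large_zero[OF Sp_vpoly] by simp

section \<open>Iterated brackets with arbitrary starting field and index list\<close>

definition brk :: "vfield \<Rightarrow> (nat \<Rightarrow> nat) \<Rightarrow> nat list \<Rightarrow> vfield" where
  "brk Z \<alpha> js = foldl (\<lambda>Y j. ((\<lambda>Z. lie N Z (X j)) ^^ \<alpha> j) Y) Z js"

lemma itbr_brk: "itbr hb i \<alpha> = brk (X i) \<alpha> [1..<Suc N]"
  by (simp add: itbr_def brk_def)

lemma brk_Nil [simp]: "brk Z \<alpha> [] = Z"
  and brk_Cons: "brk Z \<alpha> (j # js) = brk (((\<lambda>Z. lie N Z (X j)) ^^ \<alpha> j) Z) \<alpha> js"
  and brk_append: "brk Z \<alpha> (js @ ks) = brk (brk Z \<alpha> js) \<alpha> ks"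
  by (simp_all add: brk_def)

lemma Sp_lie_pow:
  assumes "j \<in> {1..N}" "Sp w Z" shows "Sp (w + k * W j) (((\<lambda>Z. lie N Z (X j)) ^^ k) Z)"
proof (induction k)
  case (Suc k)
  then show ?case using Sp_lie[OF Suc Sp_HX[OF assms(1)]] by (simp add: algebra_simps)
qed (use assms in simp)

lemma Sp_brk:
  "set js \<subseteq> {1..N} \<Longrightarrow> Sp w Z \<Longrightarrow> Sp (w + (\<Sum>j\<leftarrow>js. \<alpha> j * W j)) (brk Z \<alpha> js)"
proof (induction js arbitrary: w Z)
  case (Cons j js)
  then show ?case using Cons.IH[OF _ Sp_lie_pow[of j w Z "\<alpha> j"]] by (simp add: brk_Cons algebra_simps)
qed simp

lemma lie_pow_lcomb:
  assumes "j \<in> {1..N}" "\<And>l. l \<in> A \<Longrightarrow> Sp (w l) (Z l)"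
  shows "((\<lambda>Z. lie N Z (X j)) ^^ k) (\<lambda>x i. \<Sum>l\<in>A. c l * Z l x i)
    = (\<lambda>x i. \<Sum>l\<in>A. c l * ((\<lambda>Z. lie N Z (X j)) ^^ k) (Z l) x i)"
proof (induction k)
  case (Suc k)
  have v: "vpoly (int (w l + k * W j)) (((\<lambda>Z. lie N Z (X j)) ^^ k) (Z l))" if "l \<in> A" for l
    by (rule Sp_vpoly[OF Sp_lie_pow[OF assms(1) assms(2)[OF that]]])
  have "((\<lambda>Z. lie N Z (X j)) ^^ Suc k) (\<lambda>x i. \<Sum>l\<in>A. c l * Z l x i)
     = lie N (\<lambda>x i. \<Sum>l\<in>A. c l * ((\<lambda>Z. lie N Z (X j)) ^^ k) (Z l) x i) (X j)" by (simp add: Suc)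
  also have "\<dots> = (\<lambda>x i. \<Sum>l\<in>A. c l * ((\<lambda>Z. lie N Z (X j)) ^^ Suc k) (Z l) x i)"
    by (intro ext) (simp add: lie_sum_left[OF v vpoly_HX])
  finally show ?case .
qed simp

lemma brk_lcomb:
  assumes "set js \<subseteq> {1..N}" "\<And>l. l \<in> A \<Longrightarrow> Sp (w l) (Z l)"
  shows "brk (\<lambda>x i. \<Sum>l\<in>A. c l * Z l x i) \<alpha> js = (\<lambda>x i. \<Sum>l\<in>A. c l * brk (Z l) \<alpha> js x i)"
  using assms
proof (induction js arbitrary: w Z)
  case (Cons j js)
  have j: "j \<in> {1..N}" and js: "set js \<subseteq> {1..N}" using Cons.prems(1) by auto
  have "brk (\<lambda>x i. \<Sum>l\<in>A. c l * ((\<lambda>Z. lie N Z (X j)) ^^ \<alpha> j) (Z l) x i) \<alpha> js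
      = (\<lambda>x i. \<Sum>l\<in>A. c l * brk (((\<lambda>Z. lie N Z (X j)) ^^ \<alpha> j) (Z l)) \<alpha> js x i)"
    by (rule Cons.IH[OF js, of "\<lambda>l. w l + \<alpha> j * W j"]) (intro Sp_lie_pow[OF j] Cons.prems(2))
  then show ?case by (simp add: brk_Cons lie_pow_lcomb[OF j Cons.prems(2)])
qed simp

lemma brk_zero_exp: "(\<And>j. j \<in> set js \<Longrightarrow> \<alpha> j = 0) \<Longrightarrow> brk Z \<alpha> js = Z"
  by (induction js) (simp_all add: brk_Cons)

lemma brk_cong: "(\<And>j. j \<in> set js \<Longrightarrow> \<alpha> j = \<beta> j) \<Longrightarrow> brk Z \<alpha> js = brk Z \<beta> js"
  by (induction js arbitrary: Z) (simp_all add: brk_Cons)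

text \<open>With no exponents below \<open>m\<close>, the iteration starts with brackets by
  \<open>X m\<close>, so one more such bracket in front only raises the exponent of
  \<open>m\<close>. This is the algebraic counterpart of \<open>- d/dx_m\<close> lowering that
  exponent.\<close>

lemma brk_shift:
  assumes m: "m \<in> {1..N}" and "\<And>j. 1 \<le> j \<Longrightarrow> j < m \<Longrightarrow> \<beta> j = 0"
  shows "brk (lie N Z (X m)) \<beta> [1..<Suc N] = brk Z (\<beta>(m := Suc (\<beta> m))) [1..<Suc N]"
proof -
  have l: "[1..<Suc N] = [1..<m] @ m # [Suc m..<Suc N]"
    using m by (metis atLeastAtMost_iff less_Suc_eq_le less_imp_le_nat upt_add_eq_append upt_conv_Cons le_add_diff_inverse)
  have "brk (((\<lambda>Z. lie N Z (X m)) ^^ \<beta> m) (lie N Z (X m))) \<beta> [Suc m..<Suc N]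
     = brk (((\<lambda>Z. lie N Z (X m)) ^^ Suc (\<beta> m)) Z) (\<beta>(m := Suc (\<beta> m))) [Suc m..<Suc N]"
    unfolding funpow_Suc_right o_def by (rule brk_cong) auto
  moreover have "brk Y \<gamma> [1..<m] = Y" if "\<And>j. 1 \<le> j \<Longrightarrow> j < m \<Longrightarrow> \<gamma> j = 0" for Y \<gamma>
    by (rule brk_zero_exp) (use that in auto)
  ultimately show ?thesis using assms unfolding l brk_append brk_Cons by simp
qed

end

section \<open>Extremal polynomials as matrix entries of the adjoint action\<close>

declare upt_Suc [simp del]

context hall begin

text \<open>A finite box outside which all iterated brackets vanish by weight, since one exponent
  above \<open>s\<close> already exceeds the step.\<close>

definition multis :: "(nat \<Rightarrow> nat) set" where
  "multis = {\<alpha>. (\<forall>j. j \<in> {1..N} \<longrightarrow> \<alpha> j \<in> {0..s}) \<and> (\<forall>j. j \<notin> {1..N} \<longrightarrow> \<alpha> j = 0)}"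

lemma finite_multis: "finite multis"
proof -
  have "finite {f. \<forall>x. (x \<in> {1..N} \<longrightarrow> f x \<in> {0..s}) \<and> (x \<notin> {1..N} \<longrightarrow> f x = (0::nat))}"
    by (rule finite_set_of_finite_funs) auto
  then show ?thesis by (rule finite_subset[rotated]) (auto simp: multis_def)
qed

abbreviation brkN :: "vfield \<Rightarrow> (nat \<Rightarrow> nat) \<Rightarrow> vfield" where
  "brkN Z \<alpha> \<equiv> brk Z \<alpha> [1..<Suc N]"

lemma Sp_brkN: "Sp w Z \<Longrightarrow> Sp (w + (\<Sum>j=1..N. \<alpha> j * W j)) (brkN Z \<alpha>)"
proof -
  assume a: "Sp w Z"
  have "(\<Sum>j\<leftarrow>[1..<Suc N]. \<alpha> j * W j) = (\<Sum>j=1..N. \<alpha> j * W j)"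
    by (subst sum_list_distinct_conv_sum_set) (simp_all add: atLeastLessThanSuc_atLeastAtMost)
  then show ?thesis using Sp_brk[of "[1..<Suc N]" w Z \<alpha>] a by (simp add: subset_iff)
qed

lemma brkN_large:
  assumes "Sp w Z" "j \<in> {1..N}" "s < w + \<alpha> j" shows "brkN Z \<alpha> x k = 0"
proof (rule Sp_large[OF Sp_brkN[OF assms(1)]])
  have "\<alpha> j * 1 \<le> \<alpha> j * W j" using W_pos[of j] by (intro mult_le_mono) auto
  also have "\<dots> \<le> (\<Sum>j=1..N. \<alpha> j * W j)" by (rule member_le_sum) (use assms in auto)
  finally show "s < w + (\<Sum>j=1..N. \<alpha> j * W j)" using assms(3) by simp
qed

text \<open>The a-th coordinate of Ad(x) Z. Fields in the span are identified with their value at 0, which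
  lists their coefficients in the Hall basis.\<close>

definition F :: "nat \<Rightarrow> vfield \<Rightarrow> point \<Rightarrow> real" where
  "F a Z x = (\<Sum>\<alpha>\<in>multis. DM N \<alpha> x * brkN Z \<alpha> (\<lambda>_. 0) a)"

text \<open>A nonzero coefficient forces the weight of \<open>\<alpha>\<close> to be
  \<open>W a - w\<close>, and this weight is the degree of \<open>DM N \<alpha>\<close>; so all
  surviving terms have the same degree.\<close>

lemma wpoly_F: assumes "Sp w Z" shows "wpoly (int (W a) - int w) (F a Z)"
  unfolding F_def
proof (rule wpoly_sum)
  fix \<alpha>
  show "wpoly (int (W a) - int w) (\<lambda>x. DM N \<alpha> x * brkN Z \<alpha> (\<lambda>_. 0) a)"
  proof (cases "brkN Z \<alpha> (\<lambda>_. 0) a = 0")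
    case False
    then have "W a = w + (\<Sum>j=1..N. \<alpha> j * W j)" using Sp_at0(1)[OF Sp_brkN[OF assms]] by blast
    then have "int (W a) = int w + int (\<Sum>j=1..N. \<alpha> j * W j)" by (simp only: of_nat_add)
    then have "int (W a) - int w = (\<Sum>j=1..N. int (\<alpha> j) * int (W j)) + 0" by (simp only: of_nat_sum of_nat_mult)
    then show ?thesis by (rule wpoly_mult_deg[OF wpoly_DM const])
  qed (simp add: zero)
qed

lemma F_at0: assumes "Sp w Z" shows "F a Z (\<lambda>_. 0) = Z (\<lambda>_. 0) a"
proof -
  have "F a Z (\<lambda>_. 0) = (\<Sum>\<alpha>\<in>multis. if \<alpha> = (\<lambda>_. 0) then Z (\<lambda>_. 0) a else 0)"
    unfolding F_def
  proof (rule sum.cong[OF refl])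
    fix \<alpha> assume \<alpha>: "\<alpha> \<in> multis"
    show "DM N \<alpha> (\<lambda>_. 0) * brkN Z \<alpha> (\<lambda>_. 0) a = (if \<alpha> = (\<lambda>_. 0) then Z (\<lambda>_. 0) a else 0)"
    proof (cases "\<alpha> = (\<lambda>_. 0)")
      case True
      then show ?thesis by (simp add: DM_zero brk_zero_exp)
    next
      case False
      then obtain j where "\<alpha> j \<noteq> 0" by auto
      moreover from this have "j \<in> {1..N}" using \<alpha> by (auto simp: multis_def)
      ultimately have "DM N \<alpha> (\<lambda>_. 0) = 0" using DM_eq_0[of j N \<alpha> "\<lambda>_. 0"] by simp
      then show ?thesis using False by simp
    qed
  qed
  also have "\<dots> = Z (\<lambda>_. 0) a" using finite_multis by (simp add: multis_def)
  finally show ?thesis .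
qed

lemma F_expand: assumes "Sp w Z" shows "F a Z x = (\<Sum>l=1..N. Z (\<lambda>_. 0) l * F a (X l) x)"
proof -
  have e: "brkN Z \<alpha> y k = (\<Sum>l=1..N. Z (\<lambda>_. 0) l * brkN (X l) \<alpha> y k)" for \<alpha> y k
  proof -
    have "brkN (\<lambda>x i. \<Sum>l=1..N. Z (\<lambda>_. 0) l * X l x i) \<alpha> = (\<lambda>x i. \<Sum>l=1..N. Z (\<lambda>_. 0) l * brkN (X l) \<alpha> x i)"
      by (rule brk_lcomb[OF _ Sp_HX]) auto
    with arg_cong[OF Sp_at0(2)[OF assms, unfolded lcomb_def], of "\<lambda>Z. brkN Z \<alpha>"]
    have "brkN Z \<alpha> = (\<lambda>x i. \<Sum>l=1..N. Z (\<lambda>_. 0) l * brkN (X l) \<alpha> x i)" by (rule trans)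
    then show ?thesis by (rule fun_cong[OF fun_cong])
  qed
  have "F a Z x = (\<Sum>\<alpha>\<in>multis. \<Sum>l=1..N. Z (\<lambda>_. 0) l * (DM N \<alpha> x * brkN (X l) \<alpha> (\<lambda>_. 0) a))"
    unfolding F_def e by (simp add: sum_distrib_left mult_ac)
  also have "\<dots> = (\<Sum>l=1..N. \<Sum>\<alpha>\<in>multis. Z (\<lambda>_. 0) l * (DM N \<alpha> x * brkN (X l) \<alpha> (\<lambda>_. 0) a))"
    by (rule sum.swap)
  finally show ?thesis by (simp add: F_def sum_distrib_left)
qed

lemma F_zero_field: "(\<And>x k. Z x k = 0) \<Longrightarrow> F a Z x = 0"
proof -
  assume "\<And>x k. Z x k = 0"
  then have "Z = (\<lambda>x k. 0)" by (intro ext)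
  then show ?thesis using F_expand[OF Sp_zero[of 1], of a x] by simp
qed

lemma F_add3:
  assumes "Sp w Z" "Sp w Z1" "Sp w Z2" "\<And>k. Z (\<lambda>_. 0) k = Z1 (\<lambda>_. 0) k + Z2 (\<lambda>_. 0) k"
  shows "F a Z x = F a Z1 x + F a Z2 x"
  unfolding F_expand[OF assms(1)] F_expand[OF assms(2)] F_expand[OF assms(3)] assms(4)
  by (simp add: distrib_right sum.distrib)

lemma F_neg: assumes "Sp w Z" shows "F a (\<lambda>x k. - Z x k) x = - F a Z x"
  unfolding F_expand[OF assms] F_expand[OF Sp_neg[OF assms]] by (simp add: sum_negf)

text \<open>On the slice, terms with an exponent below \<open>m\<close> vanish. In the others
  \<open>- d/dx_m\<close> lowers the exponent of \<open>m\<close>, and \<open>brk_shift\<close>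
  turns the lost exponent into a bracket with \<open>X m\<close>.\<close>

lemma pd_F_slice:
  assumes Z: "Sp w Z" and w: "0 < w" and m: "m \<in> {1..N}" and x: "x \<in> slice m"
  shows "pd (F a Z) m x = - F a (lie N Z (X m)) x"
proof -
  let ?c = "\<lambda>\<alpha>. brkN Z \<alpha> (\<lambda>_. 0) a"
  have "pd (F a Z) m x = (\<Sum>\<alpha>\<in>multis. pd (\<lambda>x. ?c \<alpha> * DM N \<alpha> x) m x)"
    unfolding F_def mult.commute[of "DM N _ _"] by (rule pd_sum[OF wpoly_scale[OF wpoly_DM]])
  also have "\<dots> = (\<Sum>\<alpha>\<in>multis. ?c \<alpha> * pd (DM N \<alpha>) m x)"
    by (simp add: pd_scale[OF wpoly_DM])
  also have "\<dots> = - (\<Sum>\<alpha>\<in>multis. if \<alpha> m = 0 then 0 else ?c \<alpha> * DM N (\<alpha>(m := \<alpha> m - 1)) x)"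
    unfolding sum_negf[symmetric] by (rule sum.cong) (auto simp: pd_DM[OF m])
  also have "(\<Sum>\<alpha>\<in>multis. if \<alpha> m = 0 then 0 else ?c \<alpha> * DM N (\<alpha>(m := \<alpha> m - 1)) x)
      = (\<Sum>\<beta>\<in>multis. DM N \<beta> x * brkN (lie N Z (X m)) \<beta> (\<lambda>_. 0) a)"
  proof -
    let ?f = "\<lambda>\<alpha>. if \<alpha> m = 0 then 0 else ?c \<alpha> * DM N (\<alpha>(m := \<alpha> m - 1)) x"
    let ?g = "\<lambda>\<beta>. DM N \<beta> x * brkN (lie N Z (X m)) \<beta> (\<lambda>_. 0) a"
    define S where "S = {\<alpha> \<in> multis. \<alpha> m \<noteq> 0 \<and> (\<forall>j. 1 \<le> j \<and> j < m \<longrightarrow> \<alpha> j = 0)}"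
    \<comment> \<open>The value \<open>\<beta> m = s\<close> is excluded because raising it leaves
      the box. Such terms are zero: \<open>s\<close> further brackets of
      \<open>lie N Z (X m)\<close> with \<open>X m\<close> exceed the step.\<close>
    define T where "T = {\<beta> \<in> multis. \<beta> m \<noteq> s \<and> (\<forall>j. 1 \<le> j \<and> j < m \<longrightarrow> \<beta> j = 0)}"
    have small: "DM N \<gamma> x = 0" if "1 \<le> j" "j < m" "\<gamma> j \<noteq> 0" for \<gamma> j
      by (rule DM_eq_0[of j]) (use that m x in \<open>auto simp: slice_def\<close>)
    have "sum ?f multis = sum ?f S"
    proof (rule sum.mono_neutral_right[OF finite_multis])
      show "\<forall>\<alpha>\<in>multis - S. ?f \<alpha> = 0"
      proof
        fix \<alpha> assume "\<alpha> \<in> multis - S"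
        then have "\<alpha> m = 0 \<or> (\<exists>j. 1 \<le> j \<and> j < m \<and> \<alpha> j \<noteq> 0)" unfolding S_def by blast
        then show "?f \<alpha> = 0"
        proof (elim disjE exE conjE)
          fix j assume "1 \<le> j" "j < m" "\<alpha> j \<noteq> 0"
          then have "DM N (\<alpha>(m := \<alpha> m - 1)) x = 0" by (intro small[of j]) simp_all
          then show ?thesis by (simp only: mult_zero_right if_cancel)
        qed (simp only: if_True refl)
      qed
    qed (auto simp: S_def)
    also have "sum ?f S = sum ?g T"
    proof (rule sum.reindex_bij_witness[where j = "\<lambda>\<alpha>. \<alpha>(m := \<alpha> m - 1)" and i = "\<lambda>\<beta>. \<beta>(m := Suc (\<beta> m))"])
      fix \<alpha> assume "\<alpha> \<in> S"
      then have \<alpha>: "\<alpha> \<in> multis" "\<alpha> m \<noteq> 0" "\<And>j. 1 \<le> j \<Longrightarrow> j < m \<Longrightarrow> \<alpha> j = 0" unfolding S_def by auto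
      show bk: "(\<alpha>(m := \<alpha> m - 1))(m := Suc ((\<alpha>(m := \<alpha> m - 1)) m)) = \<alpha>"
        using \<alpha>(2) by (intro ext) simp
      have "\<alpha> m \<le> s" using \<alpha>(1) m by (simp add: multis_def)
      then have "\<alpha> m - 1 \<le> s" "\<alpha> m - 1 \<noteq> s" using \<alpha>(2) by linarith+
      then show "\<alpha>(m := \<alpha> m - 1) \<in> T" using \<alpha> m unfolding T_def multis_def by simp
      have "brkN (lie N Z (X m)) (\<alpha>(m := \<alpha> m - 1)) = brkN Z \<alpha>"
        using brk_shift[OF m, of "\<alpha>(m := \<alpha> m - 1)" Z] \<alpha>(3) bk by simp
      then show "?g (\<alpha>(m := \<alpha> m - 1)) = ?f \<alpha>" using \<alpha>(2) by simp
    next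
      fix \<beta> assume "\<beta> \<in> T"
      then have \<beta>: "\<beta> \<in> multis" "\<beta> m \<noteq> s" "\<And>j. 1 \<le> j \<Longrightarrow> j < m \<Longrightarrow> \<beta> j = 0" unfolding T_def by auto
      show "(\<beta>(m := Suc (\<beta> m)))(m := (\<beta>(m := Suc (\<beta> m))) m - 1) = \<beta>" by (intro ext) simp
      have "Suc (\<beta> m) \<le> s" using \<beta>(1,2) m by (simp add: multis_def le_neq_implies_less Suc_leI)
      then show "\<beta>(m := Suc (\<beta> m)) \<in> S" using \<beta> m unfolding S_def multis_def by simp
    qed
    also have "sum ?g T = sum ?g multis"
    proof (rule sum.mono_neutral_left[OF finite_multis])
      show "\<forall>\<beta>\<in>multis - T. ?g \<beta> = 0"
      proof
        fix \<beta> assume "\<beta> \<in> multis - T"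
        then have "\<beta> m = s \<or> (\<exists>j. 1 \<le> j \<and> j < m \<and> \<beta> j \<noteq> 0)" unfolding T_def by blast
        then show "?g \<beta> = 0"
        proof (elim disjE exE conjE)
          fix j assume "1 \<le> j" "j < m" "\<beta> j \<noteq> 0"
          then have "DM N \<beta> x = 0" by (rule small)
          then show ?thesis by (simp only: mult_zero_left)
        next
          assume "\<beta> m = s"
          then have "brkN (lie N Z (X m)) \<beta> (\<lambda>_. 0) a = 0"
            by (intro brkN_large[OF Sp_lie[OF Z Sp_HX[OF m]] m]) (use w in simp)
          then show ?thesis by (simp only: mult_zero_right)
        qed
      qed
    qed (auto simp: T_def)
    finally show ?thesis .
  qed
  finally show ?thesis by (simp only: F_def[of a "lie N Z (X m)" x])
qed

lemma act_HX_slice: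
  assumes "m \<in> {1..N}" "x \<in> slice m" shows "act (X m) f x = pd f m x"
proof -
  have "act (X m) f x = (\<Sum>j=1..N. if j = m then pd f m x else 0)"
    unfolding act_def by (rule sum.cong) (auto simp: HX_slice[OF assms])
  then show ?thesis using assms by simp
qed

text \<open>For \<open>m < idx u\<close> this says that \<open>vf hb u\<close> is tangent to the
  slice of \<open>m\<close> and to its subslice \<open>x m = 0\<close>, so identities valid only
  there may be differentiated along it.\<close>

lemma vf_slice_zero:
  assumes "u \<in> set hb" "lastidx hb u \<le> m" "x \<in> slice m" "l \<in> {1..N}" "l < idx u"
  shows "vf hb u x l = 0"
proof -
  have "u \<notin> prefs (el l)" using prefs_mem[OF hb_mem[OF assms(4)], of u] idx_nth[OF assms(4)] assms(5) by auto
  then show ?thesis using vf_slice[OF assms(1,4) slice_mono[OF assms(3,2)]] by simp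
qed

text \<open>The defect D_Z = X_u F_Z + F_[Z,u] vanishes on the next slice by assumption, and by the Jacobi identity
  its x_m-derivative is -D_[Z,m]. So it vanishes by induction on decreasing weights of u and of Z.\<close>

lemma slice_step:
  assumes m: "m \<in> {1..N}"
    and next_slice: "\<And>u w Z x. u \<in> set hb \<Longrightarrow> Suc m \<le> idx u \<Longrightarrow> lastidx hb u \<le> Suc m \<Longrightarrow> Sp w Z \<Longrightarrow> 0 < w \<Longrightarrow>
        x \<in> slice (Suc m) \<Longrightarrow> act (vf hb u) (F a Z) x = - F a (lie N Z (vf hb u)) x"
    and u: "u \<in> set hb" "m \<le> idx u" "lastidx hb u \<le> m"
    and Z: "Sp w Z" "0 < w" and x: "x \<in> slice m"
  shows "act (vf hb u) (F a Z) x = - F a (lie N Z (vf hb u)) x"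
  using u Z x
proof (induction "s - wt u" arbitrary: u w Z x rule: less_induct)
  case outer: less
  note u = outer.prems(1-3)
  show ?case
  proof (cases "idx u = m")
    case True
    then have "vf hb u = X m" using HX_idx[OF u(1)] by simp
    then show ?thesis using act_HX_slice[OF m outer.prems(6)] pd_F_slice[OF outer.prems(4,5) m outer.prems(6)] by simp
  next
    case False
    then have mu: "m < idx u" using u by simp
    define q where "q = el m"
    have q: "q \<in> set hb" "idx q = m" "wt q = W m" and HXm: "X m = vf hb q"
      using hb_mem[OF m] idx_nth[OF m] by (simp_all add: q_def W_def HX_def)
    have uq: "lie N (vf hb u) (X m) = vf hb (Br u q)" by (simp add: HXm)
    have Su: "Sp (wt u) (vf hb u)" by (rule Sp_vf[OF u(1)])
    have Sm: "Sp (W m) (X m)" by (rule Sp_HX[OF m])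
    note vu = Sp_vpoly[OF Su] and vm = Sp_vpoly[OF Sm]
    \<comment> \<open>From \<open>lastidx hb u \<le> m < idx u\<close>, the bracket
      \<open>Br u q\<close> is again basic unless its weight exceeds \<open>s\<close>; its last
      letter is \<open>m\<close>, so the outer hypothesis applies. In the other case the field is
      zero.\<close>
    have comm: "act (vf hb (Br u q)) (F a Z) y = - F a (lie N Z (vf hb (Br u q))) y"
      if "Sp w Z" "0 < w" "y \<in> slice m" for w Z y
    proof (cases "wt u + W m \<le> s")
      case True
      have mem: "Br u q \<in> set hb" by (rule Br_memI) (use u q mu True in auto)
      show ?thesis
        by (rule outer.hyps[OF _ mem])
          (use that Br_mem(4)[OF mem] mu q True W_pos[of m] in auto)
    next
      case False
      have z: "vf hb (Br u q) = (\<lambda>x k. 0)"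
        by (intro ext vpoly_large_zero[OF vpoly_vf]) (use False q in simp)
      have "lie N Z (\<lambda>x k. 0) = (\<lambda>x k. 0)"
        using lie_sum_right[of "{}" "\<lambda>_. 0" "\<lambda>_ _ _. 0" _ Z "\<lambda>_. 0"] Sp_vpoly[OF that(1)] by (intro ext) simp
      then show ?thesis unfolding z by (simp add: F_zero_field act_def)
    qed
    show ?thesis
      using outer.prems(4-6)
    \<comment> \<open>\<open>Suc s\<close> instead of \<open>s\<close>: the measure must still drop
      in the case \<open>w = s\<close>.\<close>
    proof (induction "Suc s - w" arbitrary: w Z x rule: less_induct)
      case inner: less
      note Z = inner.prems(1,2)
      show ?case
      proof (cases "s < w")
        case True
        have "Z = (\<lambda>x k. 0)" by (intro ext Sp_large[OF Z(1) True])
        moreover have "lie N (\<lambda>x k. 0) (vf hb u) = (\<lambda>x k. 0)"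
          using lie_sum_left[of "{}" "\<lambda>_. 0" "\<lambda>_ _ _. 0" _ "vf hb u" "\<lambda>_. 0"] vu by (intro ext) simp
        moreover have "F a (\<lambda>x k. 0) = (\<lambda>x. 0)" by (intro ext F_zero_field) simp
        ultimately show ?thesis by (simp add: act_def)
      next
        case False
        define D where "D = (\<lambda>x. act (vf hb u) (F a Z) x + F a (lie N Z (vf hb u)) x)"
        have SZu: "Sp (w + wt u) (lie N Z (vf hb u))" by (rule Sp_lie[OF Z(1) Su])
        have SZm: "Sp (w + W m) (lie N Z (X m))" by (rule Sp_lie[OF Z(1) Sm])
        note wF = wpoly_F[OF Z(1), of a]
        have w1: "wpoly (int (W a) - int w - int (wt u)) (act (vf hb u) (F a Z))" by (rule wpoly_act[OF vu wF])
        note w2 = wpoly_F[OF SZu, of a]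
        have "wpoly (int (W a) - int w - int (wt u)) (F a (lie N Z (vf hb u)))"
          using w2 by (simp add: algebra_simps)
        with w1 have wD: "wpoly (int (W a) - int w - int (wt u)) D" unfolding D_def by (rule add)
        have pdD: "pd D m y = 0" if y: "y \<in> slice m" for y
        proof -
          have "pd D m y = pd (act (vf hb u) (F a Z)) m y + pd (F a (lie N Z (vf hb u))) m y"
            unfolding D_def by (rule pd_add[OF w1 w2])
          also have "pd (F a (lie N Z (vf hb u))) m y = - F a (lie N (lie N Z (vf hb u)) (X m)) y"
            by (rule pd_F_slice[OF SZu _ m y]) (use Z in simp)
          also have "pd (act (vf hb u) (F a Z)) m y = act (X m) (act (vf hb u) (F a Z)) y"
            by (rule act_HX_slice[OF m y, symmetric])
          also have "\<dots> = act (vf hb u) (act (X m) (F a Z)) y - act (vf hb (Br u q)) (F a Z) y"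
            using act_lie[OF vu vm wF, of y] by (simp add: uq)
          also have "act (vf hb (Br u q)) (F a Z) y = - F a (lie N Z (vf hb (Br u q))) y"
            by (rule comm[OF Z y])
          \<comment> \<open>The formula for \<open>act (X m) (F a Z)\<close> holds on the slice
            only. It may be differentiated by \<open>vf hb u\<close> because only directions
            \<open>l \<ge> idx u > m\<close> contribute, and these stay in the slice.\<close>
          also have "act (vf hb u) (act (X m) (F a Z)) y = act (vf hb u) (\<lambda>x. - 1 * F a (lie N Z (X m)) x) y"
            unfolding act_def[of "vf hb u"]
          proof (rule sum.cong[OF refl])
            fix l assume l: "l \<in> {1..N}"
            show "vf hb u y l * pd (act (X m) (F a Z)) l y = vf hb u y l * pd (\<lambda>x. - 1 * F a (lie N Z (X m)) x) l y"
            proof (cases "l < idx u")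
              case True
              then show ?thesis using vf_slice_zero[OF u(1,3) y l] by simp
            next
              case False
              have "pd (act (X m) (F a Z)) l y = pd (\<lambda>x. - 1 * F a (lie N Z (X m)) x) l y"
              proof (rule pd_cong)
                fix t
                have "y(l := t) \<in> slice m" by (rule slice_upd[OF y]) (use False mu in simp)
                then show "act (X m) (F a Z) (y(l := t)) = - 1 * F a (lie N Z (X m)) (y(l := t))"
                  using act_HX_slice[OF m] pd_F_slice[OF Z m] by simp
              qed
              then show ?thesis by simp
            qed
          qed
          also have "\<dots> = - act (vf hb u) (F a (lie N Z (X m))) y"
            using act_scale[OF wpoly_F[OF SZm], of "vf hb u" "-1" a y] by simp
          also have "act (vf hb u) (F a (lie N Z (X m))) y = - F a (lie N (lie N Z (X m)) (vf hb u)) y"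
            by (rule inner.hyps[OF _ SZm _ y]) (use Z False W_pos[of m] in auto)
          also have "F a (lie N (lie N Z (vf hb u)) (X m)) y
              = F a (lie N (lie N Z (X m)) (vf hb u)) y + F a (lie N Z (vf hb (Br u q))) y"
          proof (rule F_add3)
            show "Sp (w + wt u + W m) (lie N (lie N Z (vf hb u)) (X m))" by (rule Sp_lie[OF SZu Sm])
            show "Sp (w + wt u + W m) (lie N (lie N Z (X m)) (vf hb u))"
              using Sp_lie[OF SZm Su] by (simp add: ac_simps)
            show "Sp (w + wt u + W m) (lie N Z (vf hb (Br u q)))"
              using Sp_lie[OF Z(1) Sp_lie[OF Su Sm]] by (simp add: uq ac_simps)
            show "lie N (lie N Z (vf hb u)) (X m) (\<lambda>_. 0) k = lie N (lie N Z (X m)) (vf hb u) (\<lambda>_. 0) k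
               + lie N Z (vf hb (Br u q)) (\<lambda>_. 0) k" for k
              using lie_jacobi[OF Sp_vpoly[OF Z(1)] vu vm] by (simp only: uq)
          qed
          finally show ?thesis by simp
        qed
        \<comment> \<open>\<open>D\<close> is constant in \<open>x m\<close>, so it can be evaluated
          at \<open>x m = 0\<close>, a point of the next slice.\<close>
        have "D x = D (x(m := 0))"
        proof -
          have "\<forall>t. ((\<lambda>t. D (x(m := t))) has_real_derivative 0) (at t)"
            using wpoly_DERIV[OF wD, of x m] pdD[OF slice_upd[OF inner.prems(3)]] by simp
          then have "(\<lambda>t. D (x(m := t))) (x m) = (\<lambda>t. D (x(m := t))) 0" by (rule DERIV_isconst_all)
          then show ?thesis by simp
        qed
        also have "\<dots> = 0"
        proof -
          have "x(m := 0) \<in> slice (Suc m)" using inner.prems(3) by (auto simp: slice_def less_Suc_eq)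
          then show ?thesis using next_slice[OF u(1) _ _ Z] mu u(3) by (simp add: D_def)
        qed
        finally show ?thesis by (simp add: D_def)
      qed
    qed
  qed
qed

text \<open>The descent starts at \<open>m = Suc N\<close>, where no Hall element has an index large
  enough and the claim is void.\<close>

lemma act_F_slice:
  assumes "1 \<le> m" "m \<le> Suc N" "u \<in> set hb" "m \<le> idx u" "lastidx hb u \<le> m" "Sp w Z" "0 < w" "x \<in> slice m"
  shows "act (vf hb u) (F a Z) x = - F a (lie N Z (vf hb u)) x"
  using assms(2,1,3-8)
proof (induction arbitrary: u w Z x rule: inc_induct)
  case base
  then show ?case using idx_range[of u] by simp
next
  case (step m)
  show ?case
    by (rule slice_step[OF _ step.IH step.prems(2-7)]) (use step in auto)
qed

text \<open>A generator has \<open>lastidx\<close> 0 and positive index, so \<open>m = 1\<close> is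
  admissible, and \<open>slice 1\<close> is the whole space.\<close>

theorem act_F_gen:
  assumes "i \<in> {1..r}" "Sp w Z" "0 < w"
  shows "act (X i) (F a Z) x = - F a (lie N Z (X i)) x"
proof -
  have "X i = vf hb (Gen i)" using Gen_mem[OF assms(1)] by (simp add: HX_def)
  moreover have "act (vf hb (Gen i)) (F a Z) x = - F a (lie N Z (vf hb (Gen i))) x"
    by (rule act_F_slice[of 1]) (use Gen_mem[OF assms(1)] assms in \<open>auto simp: slice_def\<close>)
  ultimately show ?thesis by simp
qed

section \<open>Structure constants, unitriangular matrices and extremal polynomials\<close>

definition ad :: "nat \<Rightarrow> nat \<Rightarrow> nat \<Rightarrow> real" where
  "ad i j l = lie N (X i) (X j) (\<lambda>_. 0) l"

lemma lie_HX_ad: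
  assumes "i \<in> {1..N}" "j \<in> {1..N}"
  shows "lie N (X i) (X j) x k = (\<Sum>l=1..N. ad i j l * X l x k)"
  unfolding ad_def using fun_cong[OF fun_cong[OF Sp_at0(2)[OF Sp_lie_HX[OF assms], unfolded lcomb_def]]] .

lemma ad_less:
  assumes "i \<in> {1..N}" "j \<in> {1..N}" "ad i j l \<noteq> 0" shows "l \<in> {1..N}" "j < l"
proof -
  have l: "l \<in> {1..N}" "W l = W i + W j" using Sp_at0(1)[OF Sp_lie_HX[OF assms(1,2)]] assms(3) by (auto simp: ad_def)
  then show "l \<in> {1..N}" "j < l" using W_less[OF assms(2) l(1)] W_pos[of i] by auto
qed

lemma act_F_HX:
  assumes i: "i \<in> {1..r}" and j: "j \<in> {1..N}"
  shows "act (X i) (F a (X j)) x = (\<Sum>l=1..N. ad i j l * F a (X l) x)"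
proof -
  have iN: "i \<in> {1..N}" using Gen_mem(3)[OF i] .
  have "act (X i) (F a (X j)) x = - F a (lie N (X j) (X i)) x"
    by (rule act_F_gen[OF i Sp_HX[OF j] W_pos])
  also have "\<dots> = F a (lie N (X i) (X j)) x"
    using F_neg[OF Sp_lie_HX[OF j iN], of a x] unfolding lie_anti[of "X i"] by simp
  also have "\<dots> = (\<Sum>l=1..N. ad i j l * F a (X l) x)"
    unfolding ad_def by (rule F_expand[OF Sp_lie_HX[OF iN j]])
  finally show ?thesis .
qed

text \<open>The entry has degree \<open>W a - W l\<close>, which is not positive since indices are
  ordered by weight: negative degree gives 0, and degree 0 gives a constant that can be computed at
  the origin. The same count proves \<open>HX_unitri\<close>.\<close>

lemma F_unitri:
  assumes "a \<in> {1..N}" "l \<in> {1..N}" "a \<le> l"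
  shows "F a (X l) x = (if a = l then 1 else 0)"
proof (cases "W a = W l")
  case True
  then have "F a (X l) x = F a (X l) (\<lambda>_. 0)" using wpoly_F[OF Sp_HX[OF assms(2)], of a] by (intro wpoly_deg0) simp
  then show ?thesis by (simp add: F_at0[OF Sp_HX[OF assms(2)]] HX_0[OF assms(2)])
next
  case False
  then have "W a < W l" using W_mono[OF assms] by simp
  then show ?thesis using wpoly_neg[OF wpoly_F[OF Sp_HX[OF assms(2)]], of a x] by auto
qed

lemma HX_unitri:
  assumes "a \<in> {1..N}" "l \<in> {1..N}" "a \<le> l"
  shows "X l x a = (if a = l then 1 else 0)"
proof (cases "W a = W l")
  case True
  then have "X l x a = X l (\<lambda>_. 0) a" using vpoly_comp[OF vpoly_HX assms(1), of l] by (intro wpoly_deg0) simp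
  then show ?thesis by (simp add: HX_0[OF assms(2)])
next
  case False
  then have "W a < W l" using W_mono[OF assms] by simp
  then show ?thesis using wpoly_neg[OF vpoly_comp[OF vpoly_HX assms(1), of l], of x] by auto
qed

text \<open>At the origin the Hall fields are the standard basis, so the coefficients selected by
  \<open>THE\<close> are unique and equal to the components of the iterated bracket there.\<close>

lemma sconst_brk:
  assumes "i \<in> {1..N}" shows "sconst hb i \<alpha> = brkN (X i) \<alpha> (\<lambda>_. 0)"
proof -
  note S = Sp_brkN[OF Sp_HX[OF assms], of \<alpha>]
  show ?thesis unfolding sconst_def itbr_brk
  proof (rule the_equality)
    show "(\<forall>k. k \<notin> {1..N} \<longrightarrow> brkN (X i) \<alpha> (\<lambda>_. 0) k = 0) \<and>
      brkN (X i) \<alpha> = (\<lambda>x j. \<Sum>k=1..N. brkN (X i) \<alpha> (\<lambda>_. 0) k * X k x j)"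
      using Sp_at0[OF S] unfolding lcomb_def by blast
  next
    fix c assume c: "(\<forall>k. k \<notin> {1..N} \<longrightarrow> c k = 0) \<and> brkN (X i) \<alpha> = (\<lambda>x j. \<Sum>k=1..N. c k * X k x j)"
    show "c = brkN (X i) \<alpha> (\<lambda>_. 0)"
    proof
      fix k
      have "brkN (X i) \<alpha> (\<lambda>_. 0) k = (\<Sum>l=1..N. c l * X l (\<lambda>_. 0) k)" using c by simp
      also have "\<dots> = (\<Sum>l=1..N. if l = k then c l else 0)" by (rule sum.cong) (auto simp: HX_0)
      also have "\<dots> = c k" using c by auto
      finally show "c k = brkN (X i) \<alpha> (\<lambda>_. 0) k" by simp
    qed
  qed
qed

text \<open>Brackets with an exponent above \<open>s\<close> vanish, so the infinite sum lives on
  \<open>multis\<close> and can be regrouped by the basis index \<open>a\<close>.\<close>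

lemma extP_F:
  assumes i: "i \<in> {1..N}" shows "extP hb v i x = (\<Sum>a=1..N. v a * F a (X i) x)"
proof -
  let ?t = "\<lambda>\<alpha>. (-1) ^ mabs N \<alpha> / real (mfact N \<alpha>) * (\<Sum>k=1..N. sconst hb i \<alpha> k * v k) * mono N x \<alpha>"
  let ?S = "{\<alpha>. \<forall>j. j \<notin> {1..N} \<longrightarrow> \<alpha> j = (0::nat)}"
  have t: "?t \<alpha> = DM N \<alpha> x * (\<Sum>k=1..N. brkN (X i) \<alpha> (\<lambda>_. 0) k * v k)" for \<alpha>
    by (simp add: DM_mono sconst_brk[OF i])
  have "extP hb v i x = infsum ?t multis"
    unfolding extP_def
  proof (rule infsum_cong_neutral)
    fix \<alpha> assume "\<alpha> \<in> ?S - multis"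
    then obtain j where j: "j \<in> {1..N}" "s < \<alpha> j" by (force simp: multis_def)
    then have "brkN (X i) \<alpha> (\<lambda>_. 0) k = 0" for k by (intro brkN_large[OF Sp_HX[OF i] j(1)]) simp
    then show "?t \<alpha> = 0" unfolding t by simp
  qed (auto simp: multis_def)
  also have "\<dots> = (\<Sum>\<alpha>\<in>multis. ?t \<alpha>)" by (rule infsum_finite[OF finite_multis])
  also have "\<dots> = (\<Sum>\<alpha>\<in>multis. \<Sum>a=1..N. v a * (DM N \<alpha> x * brkN (X i) \<alpha> (\<lambda>_. 0) a))"
    unfolding t by (simp add: sum_distrib_left mult_ac)
  also have "\<dots> = (\<Sum>a=1..N. \<Sum>\<alpha>\<in>multis. v a * (DM N \<alpha> x * brkN (X i) \<alpha> (\<lambda>_. 0) a))" by (rule sum.swap)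
  finally show ?thesis by (simp add: F_def sum_distrib_left)
qed

end

section \<open>Dimension and orthogonality\<close>

definition dot :: "nat \<Rightarrow> point \<Rightarrow> point \<Rightarrow> real" where
  "dot n u v = (\<Sum>l=1..n. u l * v l)"

lemma dot_commute: "dot n u v = dot n v u"
  by (simp add: dot_def mult.commute)

lemma dot_sum_left: "dot n (\<lambda>l. \<Sum>i\<in>A. c i * w i l) v = (\<Sum>i\<in>A. c i * dot n (w i) v)"
proof -
  have "dot n (\<lambda>l. \<Sum>i\<in>A. c i * w i l) v = (\<Sum>l=1..n. \<Sum>i\<in>A. c i * (w i l * v l))"
    by (simp add: dot_def sum_distrib_right mult.assoc)
  also have "\<dots> = (\<Sum>i\<in>A. \<Sum>l=1..n. c i * (w i l * v l))" by (rule sum.swap)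
  finally show ?thesis by (simp add: dot_def sum_distrib_left)
qed

lemma dot_self_zero: "dot n u u = 0 \<Longrightarrow> l \<in> {1..n} \<Longrightarrow> u l = 0"
  unfolding dot_def by (subst (asm) sum_nonneg_eq_0_iff) auto

text \<open>Gaussian elimination on the last equation: either its coefficients are all zero, or a
  pivot unknown \<open>p\<close> is solved for and substituted, which gives the matrix
  \<open>b\<close>. The dimension is a term here, and the counting arguments below all rest on this
  lemma.\<close>

lemma homogeneous_solution:
  fixes a :: "nat \<Rightarrow> nat \<Rightarrow> real"
  assumes "finite J" "m < card J"
  shows "\<exists>x. (\<exists>j\<in>J. x j \<noteq> 0) \<and> (\<forall>j. j \<notin> J \<longrightarrow> x j = 0) \<and> (\<forall>i<m. (\<Sum>j\<in>J. a i j * x j) = 0)"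
  using assms
proof (induction m arbitrary: J a)
  case 0
  then obtain p where "p \<in> J" by fastforce
  then show ?case by (intro exI[of _ "\<lambda>j. if j = p then 1 else 0"]) auto
next
  case (Suc m)
  show ?case
  proof (cases "\<exists>p\<in>J. a m p \<noteq> 0")
    case False
    obtain x where x: "\<exists>j\<in>J. x j \<noteq> 0" "\<forall>j. j \<notin> J \<longrightarrow> x j = 0" "\<forall>i<m. (\<Sum>j\<in>J. a i j * x j) = 0"
      using Suc.IH[of J a] Suc.prems by auto
    have "(\<Sum>j\<in>J. a m j * x j) = 0" using False by simp
    then show ?thesis using x by (metis less_Suc_eq)
  next
    case True
    then obtain p where p: "p \<in> J" "a m p \<noteq> 0" by blast
    define b where "b i j = a i j - a i p * a m j / a m p" for i j
    have "m < card (J - {p})" using Suc.prems p by simp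
    with Suc.IH[of "J - {p}" b] Suc.prems obtain x where x: "\<exists>j\<in>J-{p}. x j \<noteq> 0"
      "\<forall>j. j \<notin> J-{p} \<longrightarrow> x j = 0" "\<forall>i<m. (\<Sum>j\<in>J-{p}. b i j * x j) = 0" by auto
    define S where "S = (\<Sum>j\<in>J-{p}. a m j * x j)"
    define y where "y = x(p := - S / a m p)"
    have sum_y: "(\<Sum>j\<in>J. a i j * y j) = (\<Sum>j\<in>J-{p}. a i j * x j) - a i p * S / a m p" for i
    proof -
      have "(\<Sum>j\<in>J. a i j * y j) = a i p * y p + (\<Sum>j\<in>J-{p}. a i j * y j)"
        using p Suc.prems by (simp add: sum.remove)
      also have "(\<Sum>j\<in>J-{p}. a i j * y j) = (\<Sum>j\<in>J-{p}. a i j * x j)"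
        by (rule sum.cong) (auto simp: y_def)
      finally show ?thesis by (simp add: y_def)
    qed
    have "(\<Sum>j\<in>J. a i j * y j) = 0" if "i < Suc m" for i
    proof (cases "i = m")
      case True
      then show ?thesis using p by (simp add: sum_y S_def)
    next
      case False
      then have "(\<Sum>j\<in>J-{p}. b i j * x j) = 0" using x that by simp
      moreover have "(\<Sum>j\<in>J-{p}. b i j * x j) = (\<Sum>j\<in>J-{p}. a i j * x j) - a i p * S / a m p"
      proof -
        have "b i j * x j = a i j * x j - a i p * (a m j * x j) / a m p" for j
          by (simp add: b_def algebra_simps)
        then show ?thesis by (simp add: S_def sum_subtractf sum_distrib_left sum_divide_distrib)
      qed
      ultimately show ?thesis by (simp add: sum_y)
    qed
    moreover have "\<exists>j\<in>J. y j \<noteq> 0" using x(1) by (auto simp: y_def)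
    moreover have "\<forall>j. j \<notin> J \<longrightarrow> y j = 0" using x(2) p by (auto simp: y_def)
    ultimately show ?thesis by blast
  qed
qed

lemma lin_indepD: "lin_indep n m w \<Longrightarrow> (\<And>l. l \<in> {1..n} \<Longrightarrow> (\<Sum>i<m. c i * w i l) = 0) \<Longrightarrow> i < m \<Longrightarrow> c i = 0"
  unfolding lin_indep_def by blast

lemma lin_indepI: "(\<And>c i. (\<And>l. l \<in> {1..n} \<Longrightarrow> (\<Sum>i<m. c i * w i l) = 0) \<Longrightarrow> i < m \<Longrightarrow> c i = 0) \<Longrightarrow> lin_indep n m w"
  unfolding lin_indep_def by blast

text \<open>If \<open>d + m > n\<close>, the joint family is dependent. Moving the
  \<open>u\<close>-part of the relation to the other side exhibits a vector in both spans, hence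
  orthogonal to itself.\<close>

lemma orthogonal_indep_card:
  assumes w: "lin_indep n d w" and u: "lin_indep n m u"
    and orth: "\<And>i j. i < d \<Longrightarrow> j < m \<Longrightarrow> dot n (w i) (u j) = 0"
  shows "d + m \<le> n"
proof (rule ccontr)
  assume "\<not> d + m \<le> n"
  then have "n < card {..<d+m}" by simp
  from homogeneous_solution[OF _ this, of "\<lambda>l k. if k < d then w k (Suc l) else u (k - d) (Suc l)"]
  obtain c where c: "\<exists>j\<in>{..<d+m}. c j \<noteq> 0"
    "\<forall>l<n. (\<Sum>k<d+m. (if k < d then w k (Suc l) else u (k - d) (Suc l)) * c k) = 0" by auto
  define y where "y = (\<lambda>l. \<Sum>i<d. c i * w i l)"
  have sp: "y l + (\<Sum>j<m. c (d + j) * u j l) = 0" if "l \<in> {1..n}" for l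
  proof -
    have "(\<Sum>k<d+m. (if k < d then w k l else u (k - d) l) * c k) = 0"
    proof -
      have l: "Suc (l - 1) = l" "l - 1 < n" using that by auto
      show ?thesis using c(2)[rule_format, OF l(2)] unfolding l(1) .
    qed
    moreover have "(\<Sum>k<d+m. (if k < d then w k l else u (k - d) l) * c k)
      = (\<Sum>k<d. (if k < d then w k l else u (k - d) l) * c k) + (\<Sum>k=d..<d+m. (if k < d then w k l else u (k - d) l) * c k)"
      unfolding lessThan_atLeast0 by (rule sum.atLeastLessThan_concat[symmetric]) auto
    moreover have "(\<Sum>k=d..<d+m. (if k < d then w k l else u (k - d) l) * c k) = (\<Sum>j<m. c (d + j) * u j l)"
      by (rule sum.reindex_bij_witness[where i="\<lambda>j. d + j" and j="\<lambda>k. k - d"]) auto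
    moreover have "(\<Sum>k<d. (if k < d then w k l else u (k - d) l) * c k) = y l"
      unfolding y_def by (rule sum.cong) (auto simp: mult.commute)
    ultimately show ?thesis by linarith
  qed
  have "dot n y y = dot n (\<lambda>l. \<Sum>j<m. (- c (d + j)) * u j l) y"
    unfolding dot_def by (rule sum.cong) (use sp in \<open>auto simp: sum_negf add_eq_0_iff2\<close>)
  also have "\<dots> = (\<Sum>j<m. - c (d + j) * dot n (u j) y)" by (rule dot_sum_left)
  also have "\<dots> = 0"
    by (rule sum.neutral) (auto simp: dot_commute[of n "u _"] y_def dot_sum_left orth)
  finally have y0: "y l = 0" if "l \<in> {1..n}" for l using dot_self_zero that by blast
  have "c i = 0" if "i < d" for i using lin_indepD[OF w _ that] y0 by (simp add: y_def)
  moreover have "c (d + j) = 0" if "j < m" for j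
    using lin_indepD[OF u, of "\<lambda>j. c (d + j)"] sp y0 that by simp
  ultimately have "c k = 0" if "k < d + m" for k using that by (metis add_diff_inverse_nat nat_add_left_cancel_less)
  then show False using c(1) by auto
qed

lemma lin_indep_le: assumes "lin_indep n d w" shows "d \<le> n"
  using orthogonal_indep_card[OF assms, of 0 w] by (simp add: lin_indep_def)

lemma dimR_family: obtains w where "\<And>i. i < dimR n S \<Longrightarrow> w i \<in> S" "lin_indep n (dimR n S) w"
proof -
  let ?P = "\<lambda>k. \<exists>w. (\<forall>i<k. w i \<in> S) \<and> lin_indep n k w"
  have "?P (GREATEST k. ?P k)"
    by (rule GreatestI_nat[of ?P 0 n]) (auto simp: lin_indep_def[of n 0] intro: lin_indep_le)
  then show ?thesis using that unfolding dimR_def by blast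
qed

lemma dimR_ge: assumes "\<And>i. i < k \<Longrightarrow> w i \<in> S" "lin_indep n k w" shows "k \<le> dimR n S"
  unfolding dimR_def by (rule Greatest_le_nat[of _ k n]) (use assms in \<open>auto intro: lin_indep_le\<close>)

text \<open>The next vector solves \<open>d + q\<close> homogeneous equations in \<open>n\<close>
  unknowns. Pairwise orthogonality is built in because, for nonzero vectors, it yields
  independence.\<close>

lemma orthogonal_family:
  fixes w :: "nat \<Rightarrow> point"
  assumes "q + d \<le> n"
  shows "\<exists>u. (\<forall>i<q. u i \<in> Rn n \<and> dot n (u i) (u i) \<noteq> 0 \<and> (\<forall>j<d. dot n (w j) (u i) = 0))
     \<and> (\<forall>i<q. \<forall>j<q. i \<noteq> j \<longrightarrow> dot n (u i) (u j) = 0)"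
  using assms
proof (induction q)
  case (Suc q)
  have "q + d \<le> n" using Suc.prems by simp
  from Suc.IH[OF this] obtain u where u0: "\<forall>i<q. u i \<in> Rn n \<and> dot n (u i) (u i) \<noteq> 0 \<and> (\<forall>j<d. dot n (w j) (u i) = 0)"
    "\<forall>i<q. \<forall>j<q. i \<noteq> j \<longrightarrow> dot n (u i) (u j) = 0" by (elim exE conjE)
  note u = u0(1)[rule_format] u0(2)[rule_format]
  have "d + q < card {1..n}" using Suc.prems by simp
  from homogeneous_solution[OF _ this, of "\<lambda>i l. if i < d then w i l else u (i - d) l"]
  obtain x where x: "\<exists>j\<in>{1..n}. x j \<noteq> 0" "\<forall>j. j \<notin> {1..n} \<longrightarrow> x j = 0"
    "\<forall>i<d+q. (\<Sum>l\<in>{1..n}. (if i < d then w i l else u (i - d) l) * x l) = 0" by auto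
  have xw: "dot n (w j) x = 0" if "j < d" for j
    using x(3)[rule_format, of j] that by (simp add: dot_def)
  have xu: "dot n (u j) x = 0" if "j < q" for j
    using x(3)[rule_format, of "d + j"] that by (simp add: dot_def)
  have xx: "dot n x x \<noteq> 0" using x(1) dot_self_zero by blast
  have xR: "x \<in> Rn n" using x(2) by (simp add: Rn_def)
  show ?case
  proof (intro exI[of _ "u(q := x)"] conjI allI impI)
    fix i assume "i < Suc q"
    then show "(u(q := x)) i \<in> Rn n" "dot n ((u(q := x)) i) ((u(q := x)) i) \<noteq> 0"
      using u(1)[of i] xR xx by (cases "i = q"; simp)+
  next
    fix i j assume "i < Suc q" "j < d"
    then show "dot n (w j) ((u(q := x)) i) = 0"
      using u(1)[of i] xw by (cases "i = q") auto
  next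
    fix i j assume "i < Suc q" "j < Suc q" "i \<noteq> j"
    then consider "i < q" "j < q" | "i = q" "j < q" | "i < q" "j = q" by linarith
    then show "dot n ((u(q := x)) i) ((u(q := x)) j) = 0"
      by cases (use \<open>i \<noteq> j\<close> u(2) xu dot_commute[of n x] in auto)
  qed
qed simp

lemma orthogonal_lin_indep:
  assumes "\<And>i. i < q \<Longrightarrow> dot n (u i) (u i) \<noteq> 0" "\<And>i j. i < q \<Longrightarrow> j < q \<Longrightarrow> i \<noteq> j \<Longrightarrow> dot n (u i) (u j) = 0"
  shows "lin_indep n q u"
proof (rule lin_indepI)
  fix c i assume c: "\<And>l. l \<in> {1..n} \<Longrightarrow> (\<Sum>i<q. c i * u i l) = 0" and i: "i < q"
  have "(\<Sum>j<q. c j * dot n (u j) (u i)) = dot n (\<lambda>l. \<Sum>j<q. c j * u j l) (u i)" by (rule dot_sum_left[symmetric])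
  also have "\<dots> = 0" unfolding dot_def by (rule sum.neutral) (use c in auto)
  also have "(\<Sum>j<q. c j * dot n (u j) (u i)) = (\<Sum>j<q. if j = i then c i * dot n (u i) (u i) else 0)"
    by (rule sum.cong) (use assms(2) i in auto)
  finally show "c i = 0" using i assms(1)[OF i] by simp
qed

text \<open>\<open>S\<close> is an arbitrary set, so no subspace property of the image of the
  differential enters. A maximal independent family \<open>w\<close> in \<open>S\<close> suffices:
  adjoining any \<open>x\<close> of \<open>S\<close> destroys independence, so \<open>x\<close> lies
  in the span of \<open>w\<close>.\<close>

lemma dimR_orthogonal_family:
  assumes "m + dimR n S \<le> n"
  obtains u where "\<And>i. i < m \<Longrightarrow> u i \<in> Rn n" "lin_indep n m u" "\<And>i x. i < m \<Longrightarrow> x \<in> S \<Longrightarrow> dot n x (u i) = 0"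
proof -
  define d where "d = dimR n S"
  obtain w where w: "\<And>i. i < d \<Longrightarrow> w i \<in> S" "lin_indep n d w"
    using dimR_family[where n=n and S=S] unfolding d_def by metis
  have "m + d \<le> n" using assms by (simp add: d_def)
  from orthogonal_family[OF this, of w]
  obtain u where u0: "\<forall>i<m. u i \<in> Rn n \<and> dot n (u i) (u i) \<noteq> 0 \<and> (\<forall>j<d. dot n (w j) (u i) = 0)"
    "\<forall>i<m. \<forall>j<m. i \<noteq> j \<longrightarrow> dot n (u i) (u j) = 0" by (elim exE conjE)
  note u = u0(1)[rule_format] u0(2)[rule_format]
  have orth: "dot n x (u i) = 0" if i: "i < m" and x: "x \<in> S" for i x
  proof -
    have mem: "(w(d := x)) i \<in> S" if "i < Suc d" for i using that w(1) x by (cases "i = d") auto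
    have "\<not> lin_indep n (Suc d) (w(d := x))"
    proof
      assume "lin_indep n (Suc d) (w(d := x))"
      with mem have "Suc d \<le> dimR n S" by (rule dimR_ge)
      then show False by (simp add: d_def)
    qed
    then obtain c k where c: "\<And>l. l \<in> {1..n} \<Longrightarrow> (\<Sum>i<Suc d. c i * (w(d := x)) i l) = 0" "k < Suc d" "c k \<noteq> 0"
      unfolding lin_indep_def by blast
    have e: "(\<Sum>i<d. c i * w i l) + c d * x l = 0" if "l \<in> {1..n}" for l
    proof -
      have "(\<Sum>i<d. c i * (w(d := x)) i l) = (\<Sum>i<d. c i * w i l)" by (rule sum.cong) auto
      then show ?thesis using c(1)[OF that] by simp
    qed
    have "c d \<noteq> 0"
    proof
      assume "c d = 0"
      then have "c i = 0" if "i < d" for i using lin_indepD[OF w(2) _ that] e by simp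
      then show False using c(2,3) \<open>c d = 0\<close> by (metis less_Suc_eq)
    qed
    \<comment> \<open>The sum over one index brings the multiple of \<open>x\<close> into the shape
      of \<open>dot_sum_left\<close>.\<close>
    have "dot n (\<lambda>l. \<Sum>i<d. c i * w i l) (u i) = dot n (\<lambda>l. \<Sum>i\<in>{0::nat}. - c d * x l) (u i)"
      unfolding dot_def by (rule sum.cong) (use e in \<open>auto simp: add_eq_0_iff2\<close>)
    also have "\<dots> = - c d * dot n x (u i)" by (subst dot_sum_left) simp
    also have "dot n (\<lambda>l. \<Sum>i<d. c i * w i l) (u i) = 0"
      unfolding dot_sum_left by (rule sum.neutral) (use u(1)[OF i] in auto)
    finally show ?thesis using \<open>c d \<noteq> 0\<close> by simp
  qed
  show ?thesis
    by (rule that[of u]) (use u orth orthogonal_lin_indep[of m n u] in auto)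
qed

text \<open>Solve the homogeneous system with one additional unknown (index 0) multiplying the right-hand side.\<close>

lemma injective_imp_surjective:
  fixes U :: "nat \<Rightarrow> nat \<Rightarrow> real"
  assumes inj: "\<And>v a. (\<And>l. l \<in> {1..n} \<Longrightarrow> (\<Sum>a=1..n. v a * U a l) = 0) \<Longrightarrow> a \<in> {1..n} \<Longrightarrow> v a = 0"
  obtains v where "v \<in> Rn n" "\<And>l. l \<in> {1..n} \<Longrightarrow> (\<Sum>a=1..n. v a * U a l) = z l"
proof -
  have "n < card {0..n}" by simp
  from homogeneous_solution[OF _ this, of "\<lambda>i a. if a = 0 then - z (Suc i) else U a (Suc i)"]
  obtain x where x: "\<exists>a\<in>{0..n}. x a \<noteq> 0"
    "\<forall>i<n. (\<Sum>a=0..n. (if a = 0 then - z (Suc i) else U a (Suc i)) * x a) = 0" by auto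
  have e: "(\<Sum>a=1..n. x a * U a l) = x 0 * z l" if "l \<in> {1..n}" for l
  proof -
    have "(\<Sum>a=0..n. (if a = 0 then - z l else U a l) * x a) = 0"
    proof -
      have l: "Suc (l - 1) = l" "l - 1 < n" using that by auto
      show ?thesis using x(2)[rule_format, OF l(2)] unfolding l(1) .
    qed
    moreover have "{0..n} = insert 0 {1..n}" by auto
    moreover have "(\<Sum>a=1..n. (if a = 0 then - z l else U a l) * x a) = (\<Sum>a=1..n. x a * U a l)"
      by (rule sum.cong) auto
    ultimately show ?thesis by (simp add: mult.commute[of "x 0"])
  qed
  have x0: "x 0 \<noteq> 0"
  proof
    assume "x 0 = 0"
    then have "x a = 0" if "a \<in> {1..n}" for a using inj[of x a] e that by simp
    then show False using x(1) \<open>x 0 = 0\<close> by (metis atLeastAtMost_iff le0 less_one not_le)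
  qed
  define v where "v = (\<lambda>a. if a \<in> {1..n} then x a / x 0 else 0)"
  show ?thesis
  proof (rule that[of v])
    show "v \<in> Rn n" by (simp add: Rn_def v_def)
    fix l assume l: "l \<in> {1..n}"
    have "(\<Sum>a=1..n. v a * U a l) = (\<Sum>a=1..n. x a * U a l) / x 0"
      unfolding sum_divide_distrib by (rule sum.cong) (auto simp: v_def)
    then show "(\<Sum>a=1..n. v a * U a l) = z l" using e[OF l] x0 by simp
  qed
qed

lemma unitriangular_injective:
  fixes U :: "nat \<Rightarrow> nat \<Rightarrow> real"
  assumes U: "\<And>a l. a \<in> {1..n} \<Longrightarrow> l \<in> {1..n} \<Longrightarrow> a \<le> l \<Longrightarrow> U a l = (if a = l then 1 else 0)"
    and v: "\<And>l. l \<in> {1..n} \<Longrightarrow> (\<Sum>a=1..n. v a * U a l) = 0" and a: "a \<in> {1..n}"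
  shows "v a = 0"
  using a
proof (induction "n - a" arbitrary: a rule: less_induct)
  case less
  have "(\<Sum>b=1..n. v b * U b a) = (\<Sum>b=1..n. if b = a then v a else 0)"
  proof (rule sum.cong[OF refl])
    fix b assume b: "b \<in> {1..n}"
    show "v b * U b a = (if b = a then v a else 0)"
    proof (cases "b \<le> a")
      case True
      then show ?thesis using U[OF b less.prems] by simp
    next
      case False
      then have "v b = 0" using less.hyps[of b] b less.prems by auto
      then show ?thesis using False by simp
    qed
  qed
  then show ?case using v[OF less.prems] less.prems by simp
qed

text \<open>Change of covector: both matrices are invertible, so the equation determines
  \<open>v\<close> from \<open>w\<close> by an injective map. One matrix will hold the fields at the
  end point, the other the adjoint action there; the symmetric roles allow both directions of the
  theorem.\<close>

lemma lin_indep_transfer: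
  fixes A B :: "nat \<Rightarrow> nat \<Rightarrow> real"
  assumes A: "\<And>a l. a \<in> {1..n} \<Longrightarrow> l \<in> {1..n} \<Longrightarrow> a \<le> l \<Longrightarrow> A a l = (if a = l then 1 else 0)"
    and B: "\<And>a l. a \<in> {1..n} \<Longrightarrow> l \<in> {1..n} \<Longrightarrow> a \<le> l \<Longrightarrow> B a l = (if a = l then 1 else 0)"
    and w: "lin_indep n m w"
  obtains v where "\<And>i. v i \<in> Rn n" "lin_indep n m v"
    "\<And>i l. l \<in> {1..n} \<Longrightarrow> (\<Sum>a=1..n. v i a * B a l) = (\<Sum>a=1..n. w i a * A a l)"
proof -
  have "\<exists>v. v \<in> Rn n \<and> (\<forall>l\<in>{1..n}. (\<Sum>a=1..n. v a * B a l) = (\<Sum>a=1..n. w i a * A a l))" for i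
  proof -
    have "v a = 0" if "\<And>l. l \<in> {1..n} \<Longrightarrow> (\<Sum>a=1..n. v a * B a l) = 0" "a \<in> {1..n}" for v a
      by (rule unitriangular_injective[of n B v a]) (use B that in auto)
    then obtain v where "v \<in> Rn n" "\<And>l. l \<in> {1..n} \<Longrightarrow> (\<Sum>a=1..n. v a * B a l) = (\<Sum>a=1..n. w i a * A a l)"
      by (rule injective_imp_surjective[where U=B and z="\<lambda>l. \<Sum>a=1..n. w i a * A a l" and n=n]) blast+
    then show ?thesis by blast
  qed
  then obtain v where v: "\<And>i. v i \<in> Rn n" "\<And>i l. l \<in> {1..n} \<Longrightarrow> (\<Sum>a=1..n. v i a * B a l) = (\<Sum>a=1..n. w i a * A a l)"
    by metis
  have comb: "(\<Sum>a=1..n. (\<Sum>i<m. c i * z i a) * M a l) = (\<Sum>i<m. c i * (\<Sum>a=1..n. z i a * M a l))"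
    for c and z :: "nat \<Rightarrow> point" and M :: "nat \<Rightarrow> nat \<Rightarrow> real" and l
  proof -
    have "(\<Sum>a=1..n. (\<Sum>i<m. c i * z i a) * M a l) = (\<Sum>a=1..n. \<Sum>i<m. c i * (z i a * M a l))"
      by (simp add: sum_distrib_right mult.assoc)
    also have "\<dots> = (\<Sum>i<m. \<Sum>a=1..n. c i * (z i a * M a l))" by (rule sum.swap)
    finally show ?thesis by (simp add: sum_distrib_left)
  qed
  have "lin_indep n m v"
  proof (rule lin_indepI)
    fix c i assume c: "\<And>l. l \<in> {1..n} \<Longrightarrow> (\<Sum>i<m. c i * v i l) = 0" and i: "i < m"
    have "(\<Sum>a=1..n. (\<Sum>i<m. c i * w i a) * A a l) = 0" if l: "l \<in> {1..n}" for l
    proof -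
      have "(\<Sum>a=1..n. (\<Sum>i<m. c i * w i a) * A a l) = (\<Sum>i<m. c i * (\<Sum>a=1..n. v i a * B a l))"
        unfolding v(2)[OF l] by (rule comb)
      also have "\<dots> = (\<Sum>a=1..n. (\<Sum>i<m. c i * v i a) * B a l)" by (rule comb[symmetric])
      also have "\<dots> = 0" using c by simp
      finally show ?thesis .
    qed
    then have "(\<Sum>i<m. c i * w i a) = 0" if "a \<in> {1..n}" for a
      by (intro unitriangular_injective[of n A "\<lambda>a. \<Sum>i<m. c i * w i a" a]) (use A that in auto)
    then show "c i = 0" by (rule lin_indepD[OF w _ i])
  qed
  then show ?thesis using that v by blast
qed

section \<open>Trajectories and their variations\<close>

text \<open>Solves a triangular system one unknown at a time: \<open>Q q\<close> sees only
  components up to \<open>q\<close>, so later choices do not disturb it. The components will be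
  functions of time, with integration as the single step.\<close>

lemma triangular_choice:
  fixes Q :: "nat \<Rightarrow> (nat \<Rightarrow> 'a) \<Rightarrow> bool"
  assumes step: "\<And>q c. 1 \<le> q \<Longrightarrow> q \<le> n \<Longrightarrow> (\<And>j. 1 \<le> j \<Longrightarrow> j < q \<Longrightarrow> Q j c) \<Longrightarrow> \<exists>z. Q q (c(q := z))"
    and loc: "\<And>q c c'. (\<And>j. j \<le> q \<Longrightarrow> c j = c' j) \<Longrightarrow> Q q c \<Longrightarrow> Q q c'"
  obtains c where "\<And>q. q \<in> {1..n} \<Longrightarrow> Q q c" "\<And>q. q \<notin> {1..n} \<Longrightarrow> c q = d"
proof -
  have "p \<le> n \<Longrightarrow> \<exists>c. (\<forall>q\<in>{1..p}. Q q c) \<and> (\<forall>q. q \<notin> {1..p} \<longrightarrow> c q = d)" for p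
  proof (induction p)
    case 0
    then show ?case by (intro exI[of _ "\<lambda>_. d"]) simp
  next
    case (Suc p)
    then have "p \<le> n" by simp
    from Suc.IH[OF this] obtain c where c0: "\<forall>q\<in>{1..p}. Q q c" "\<forall>q. q \<notin> {1..p} \<longrightarrow> c q = d" by (elim exE conjE)
    note c = c0(1)[rule_format] c0(2)[rule_format]
    have "\<exists>z. Q (Suc p) (c(Suc p := z))"
      by (rule step) (use Suc.prems c(1) in auto)
    then obtain z where z: "Q (Suc p) (c(Suc p := z))" by blast
    have "Q q (c(Suc p := z))" if "q \<in> {1..Suc p}" for q
    proof (cases "q = Suc p")
      case False
      then show ?thesis by (intro loc[OF _ c(1)]) (use that in auto)
    qed (use z in simp)
    moreover have "(c(Suc p := z)) q = d" if "q \<notin> {1..Suc p}" for q using that c(2)[of q] by auto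
    ultimately show ?case by blast
  qed
  from this[of n] show ?thesis using that by blast
qed

lemma prim_lip: "prim F f \<Longrightarrow> lip F"
  by (simp add: prim_def)

lemma prim_AE: "prim F f \<Longrightarrow> AE t in lborel. t \<in> {0..1} \<longrightarrow> (F has_real_derivative f t) (at t within {0..1})"
  by (simp add: prim_def)

lemma primI: "lip F \<Longrightarrow> AE t in lborel. t \<in> {0..1} \<longrightarrow> (F has_real_derivative f t) (at t within {0..1}) \<Longrightarrow> prim F f"
  by (simp add: prim_def)

lemma prim_const: "prim (\<lambda>t. c) (\<lambda>t. 0)"
  by (rule primI[OF lip_const], rule AE_I2) simp

lemma prim_add: assumes "prim F f" "prim G g" shows "prim (\<lambda>t. F t + G t) (\<lambda>t. f t + g t)"
proof (rule primI)
  show "lip (\<lambda>t. F t + G t)" by (intro lip_add prim_lip[OF assms(1)] prim_lip[OF assms(2)])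
  show "AE t in lborel. t \<in> {0..1} \<longrightarrow> ((\<lambda>t. F t + G t) has_real_derivative f t + g t) (at t within {0..1})"
    using prim_AE[OF assms(1)] prim_AE[OF assms(2)]
  proof eventually_elim
    case (elim t)
    show ?case
    proof
      assume t: "t \<in> {0..1}"
      show "((\<lambda>t. F t + G t) has_real_derivative f t + g t) (at t within {0..1})"
        by (rule DERIV_add[OF elim(1)[rule_format, OF t] elim(2)[rule_format, OF t]])
    qed
  qed
qed

lemma prim_mult: assumes "prim F f" "prim G g" shows "prim (\<lambda>t. F t * G t) (\<lambda>t. f t * G t + g t * F t)"
proof (rule primI)
  show "lip (\<lambda>t. F t * G t)" by (intro lip_mult prim_lip[OF assms(1)] prim_lip[OF assms(2)])
  show "AE t in lborel. t \<in> {0..1} \<longrightarrow> ((\<lambda>t. F t * G t) has_real_derivative f t * G t + g t * F t) (at t within {0..1})"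
    using prim_AE[OF assms(1)] prim_AE[OF assms(2)]
  proof eventually_elim
    case (elim t)
    show ?case
    proof
      assume t: "t \<in> {0..1}"
      show "((\<lambda>t. F t * G t) has_real_derivative f t * G t + g t * F t) (at t within {0..1})"
        by (rule DERIV_mult[OF elim(1)[rule_format, OF t] elim(2)[rule_format, OF t]])
    qed
  qed
qed

lemma prim_cmult: assumes "prim F f" shows "prim (\<lambda>t. c * F t) (\<lambda>t. c * f t)"
  using prim_mult[OF prim_const[of c] assms] by (simp add: mult.commute)

lemma prim_sum:
  "finite A \<Longrightarrow> (\<And>i. i \<in> A \<Longrightarrow> prim (F i) (f i)) \<Longrightarrow> prim (\<lambda>t. \<Sum>i\<in>A. F i t) (\<lambda>t. \<Sum>i\<in>A. f i t)"
  by (induction A rule: finite_induct) (simp_all add: prim_const prim_add)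

text \<open>Polynomials in e whose coefficients are Lipschitz functions of t, paired with their derivative at e = 0.
  Perturbed trajectories depend polynomially on e, because the control system is triangular.\<close>

inductive pfam :: "(real \<Rightarrow> real \<Rightarrow> real) \<Rightarrow> (real \<Rightarrow> real) \<Rightarrow> bool" where
  base: "lip a \<Longrightarrow> pfam (\<lambda>e. a) (\<lambda>t. 0)"
| shift: "pfam G G' \<Longrightarrow> pfam (\<lambda>e t. e * G e t) (\<lambda>t. G 0 t)"
| add: "pfam G G' \<Longrightarrow> pfam H H' \<Longrightarrow> pfam (\<lambda>e t. G e t + H e t) (\<lambda>t. G' t + H' t)"

lemma pfam_deriv: "pfam G G' \<Longrightarrow> ((\<lambda>e. G e t) has_real_derivative G' t) (at 0)"
proof (induction rule: pfam.induct)
  case (shift G G')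
  show ?case using DERIV_mult[OF DERIV_ident shift.IH] by simp
next
  case (add G G' H H')
  show ?case by (rule DERIV_add[OF add.IH])
qed simp

lemma pfam_eqI: "pfam G G' \<Longrightarrow> G = H \<Longrightarrow> G' = H' \<Longrightarrow> pfam H H'"
  by simp

lemma pfam_zero: "pfam (\<lambda>e t. 0) (\<lambda>t. 0)"
  by (rule base[OF lip_const])

lemma pfam_mult_lip: "pfam G G' \<Longrightarrow> lip a \<Longrightarrow> pfam (\<lambda>e t. a t * G e t) (\<lambda>t. a t * G' t)"
proof (induction rule: pfam.induct)
  case (base b)
  show ?case by (rule pfam_eqI[OF pfam.base[OF lip_mult[OF base.prems base.hyps]]]) (intro ext; simp)+
next
  case (shift G G')
  show ?case by (rule pfam_eqI[OF pfam.shift[OF shift.IH[OF shift.prems]]]) (intro ext; simp)+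
next
  case (add G G' H H')
  show ?case by (rule pfam_eqI[OF pfam.add[OF add.IH(1)[OF add.prems] add.IH(2)[OF add.prems]]])
      (intro ext; simp add: distrib_left)+
qed

lemma pfam_mult:
  assumes H: "pfam H H'"
  shows "pfam G G' \<Longrightarrow> pfam (\<lambda>e t. G e t * H e t) (\<lambda>t. G' t * H 0 t + G 0 t * H' t)"
proof (induction rule: pfam.induct)
  case (base a)
  show ?case by (rule pfam_eqI[OF pfam_mult_lip[OF H base.hyps]]) (intro ext; simp)+
next
  case (shift G G')
  show ?case by (rule pfam_eqI[OF pfam.shift[OF shift.IH]]) (intro ext; simp)+
next
  case (add G G' K K')
  show ?case by (rule pfam_eqI[OF pfam.add[OF add.IH]]) (intro ext; simp add: algebra_simps)+
qed

text \<open>Integration in \<open>t\<close> acts on each coefficient of the polynomial in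
  \<open>e\<close>, so exchanging it with the derivative at \<open>e = 0\<close> is purely
  algebraic.\<close>

lemma pfam_integral:
  assumes "pfam G G'" "ess_bdd f"
  shows "\<exists>K K'. pfam K K' \<and> (\<forall>e. prim (K e) (\<lambda>t. f t * G e t) \<and> K e 0 = 0) \<and> prim K' (\<lambda>t. f t * G' t) \<and> K' 0 = 0"
  using assms(1)
proof (induction rule: pfam.induct)
  case (base a)
  obtain A where A: "prim A (\<lambda>t. f t * a t)" "A 0 = 0"
    by (rule ess_bdd_prim[OF ess_bdd_mult[OF assms(2) lip_ess_bdd[OF base]]])
  have "prim (\<lambda>t. 0) (\<lambda>t. f t * 0)" using prim_const[of 0] by simp
  then show ?case using A pfam.base[OF prim_lip[OF A(1)]] by (intro exI[of _ "\<lambda>e. A"] exI[of _ "\<lambda>t. 0"]) simp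
next
  case (shift G G')
  then obtain K K' where K: "pfam K K'" "\<And>e. prim (K e) (\<lambda>t. f t * G e t)" "\<And>e. K e 0 = 0" by blast
  have "prim (\<lambda>t. e * K e t) (\<lambda>t. f t * (e * G e t))" for e
    using prim_cmult[OF K(2), of e e] by (simp add: mult.left_commute)
  then show ?case using K pfam.shift[OF K(1)]
    by (intro exI[of _ "\<lambda>e t. e * K e t"] exI[of _ "\<lambda>t. K 0 t"]) simp
next
  case (add G G' H H')
  obtain K K' where K: "pfam K K'" "\<And>e. prim (K e) (\<lambda>t. f t * G e t)" "\<And>e. K e 0 = 0"
    "prim K' (\<lambda>t. f t * G' t)" "K' 0 = 0" using add.IH(1) by blast
  obtain L L' where L: "pfam L L'" "\<And>e. prim (L e) (\<lambda>t. f t * H e t)" "\<And>e. L e 0 = 0"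
    "prim L' (\<lambda>t. f t * H' t)" "L' 0 = 0" using add.IH(2) by blast
  have "prim (\<lambda>t. K e t + L e t) (\<lambda>t. f t * (G e t + H e t))" for e
    using prim_add[OF K(2) L(2)] by (simp add: distrib_left)
  moreover have "prim (\<lambda>t. K' t + L' t) (\<lambda>t. f t * (G' t + H' t))"
    using prim_add[OF K(4) L(4)] by (simp add: distrib_left)
  ultimately show ?case using K L pfam.add[OF K(1) L(1)]
    by (intro exI[of _ "\<lambda>e t. K e t + L e t"] exI[of _ "\<lambda>t. K' t + L' t"]) simp
qed

section \<open>Controls, and polynomials composed with families of curves\<close>

lemma controls_ess_bdd:
  assumes "h \<in> controls r" "j \<in> {1..r}" shows "ess_bdd (h j)"
proof -
  have m: "h j \<in> borel_measurable lborel" and "\<exists>B. AE t in lborel. t \<in> {0..1} \<longrightarrow> \<bar>h j t\<bar> \<le> B"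
    using assms by (simp_all add: controls_def)
  then obtain B where B: "AE t in lborel. t \<in> {0..1} \<longrightarrow> \<bar>h j t\<bar> \<le> B" by (elim exE)
  show ?thesis
    by (rule ess_bddI[OF _ B], rule measurable_restrict_space1, rule measurable_completion) (rule m)
qed

lemma controls_lin:
  assumes "h \<in> controls r" "k \<in> controls r" shows "(\<lambda>j t. h j t + e * k j t) \<in> controls r"
  unfolding controls_def
proof (intro CollectI ballI conjI)
  fix j assume j: "j \<in> {1..r}"
  have m: "h j \<in> borel_measurable lborel" "k j \<in> borel_measurable lborel"
    using assms j by (simp_all add: controls_def)
  then show "(\<lambda>t. h j t + e * k j t) \<in> borel_measurable lborel" by simp
  have "ess_bdd (\<lambda>t. h j t + e * k j t)"
    by (intro ess_bdd_add ess_bdd_mult controls_ess_bdd[OF assms(1) j] controls_ess_bdd[OF assms(2) j] lip_ess_bdd lip_const)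
  then show "\<exists>B. AE t in lborel. t \<in> {0..1} \<longrightarrow> \<bar>h j t + e * k j t\<bar> \<le> B" by (simp add: ess_bdd_def)
qed

context graded begin

lemma wpoly_lip:
  assumes "wpoly d f" "\<And>k. k \<in> {1..n} \<Longrightarrow> lip (\<lambda>t. g t k)" shows "lip (\<lambda>t. f (g t))"
  using assms(1)
proof (induction rule: wpoly.induct)
  case (var j)
  then show ?case by (rule assms(2))
qed (intro lip_const lip_add lip_mult; assumption)+

lemma prim_chain:
  assumes f: "wpoly d f" and g: "\<And>k. k \<in> {1..n} \<Longrightarrow> prim (\<lambda>t. g t k) (\<lambda>t. g' t k)"
  shows "prim (\<lambda>t. f (g t)) (\<lambda>t. \<Sum>k=1..n. pd f k (g t) * g' t k)"
proof (rule primI)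
  show "lip (\<lambda>t. f (g t))" by (rule wpoly_lip[OF f prim_lip[OF g]])
  have "AE t in lborel. \<forall>k\<in>{1..n}. t \<in> {0..1} \<longrightarrow> ((\<lambda>t. g t k) has_real_derivative g' t k) (at t within {0..1})"
    by (rule AE_finite_allI) (simp, rule prim_AE[OF g])
  then show "AE t in lborel. t \<in> {0..1} \<longrightarrow>
      ((\<lambda>t. f (g t)) has_real_derivative (\<Sum>k=1..n. pd f k (g t) * g' t k)) (at t within {0..1})"
  proof eventually_elim
    case (elim t)
    show ?case
    proof
      assume t: "t \<in> {0..1}"
      show "((\<lambda>t. f (g t)) has_real_derivative (\<Sum>k=1..n. pd f k (g t) * g' t k)) (at t within {0..1})"
        by (rule wpoly_chain[OF f]) (rule elim[rule_format, OF _ t])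
    qed
  qed
qed

lemma pfam_wpoly:
  assumes "wpoly d f" "\<And>k. k \<in> {1..n} \<Longrightarrow> pfam (G k) (y k)"
  shows "pfam (\<lambda>e t. f (\<lambda>k. G k e t)) (\<lambda>t. \<Sum>k=1..n. pd f k (\<lambda>k. G k 0 t) * y k t)"
  using assms(1)
proof (induction rule: wpoly.induct)
  case (const c)
  show ?case by (rule pfam_eqI[OF pfam.base[OF lip_const[of c]]]) simp_all
next
  case (zero d)
  show ?case by (rule pfam_eqI[OF pfam_zero]) simp_all
next
  case (var j)
  have "(\<Sum>k=1..n. pd (\<lambda>x. x j) k x * y k t) = y j t" for x t
  proof -
    have "(\<Sum>k=1..n. pd (\<lambda>x. x j) k x * y k t) = (\<Sum>k=1..n. if j = k then y k t else 0)"
      by (rule sum.cong) (auto simp: pd_var)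
    then show ?thesis using var by simp
  qed
  then show ?case by (intro pfam_eqI[OF assms(2)[OF var]]) simp_all
next
  case (add d f g)
  show ?case by (rule pfam_eqI[OF pfam.add[OF add.IH]])
      (intro ext; simp add: pd_add[OF add.hyps] distrib_right sum.distrib)+
next
  case (mult d f e g)
  show ?case by (rule pfam_eqI[OF pfam_mult[OF mult.IH(2,1)]])
      (intro ext; simp add: pd_mult[OF mult.hyps] distrib_right distrib_left sum.distrib sum_distrib_left sum_distrib_right mult_ac)+
qed

end

section \<open>The control system in triangular form\<close>

context hall begin

abbreviation hd_ix :: "nat \<Rightarrow> nat" where "hd_ix q \<equiv> lhead (el q)"

lemma hd_ix_range: "q \<in> {1..N} \<Longrightarrow> hd_ix q \<in> {1..r}"
  using lhead_range[OF hb_mem] by simp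

lemma HX_gen: "j \<in> {1..r} \<Longrightarrow> q \<in> {1..N} \<Longrightarrow> X j x q = (if hd_ix q = j then DM N (IM q) x else 0)"
  by (simp only: HX_def Gen_mem(4) vf.simps GG_DM) simp

text \<open>Each coordinate direction occurs in exactly one generator field, that of its head. So
  the system reads: the derivative of coordinate \<open>q\<close> is one control times one
  monomial.\<close>

lemma sum_HX_gen:
  assumes "q \<in> {1..N}" shows "(\<Sum>j=1..r. a j * X j x q) = a (hd_ix q) * DM N (IM q) x"
proof -
  have "(\<Sum>j=1..r. a j * X j x q) = (\<Sum>j=1..r. if j = hd_ix q then a j * DM N (IM q) x else 0)"
    by (rule sum.cong) (use HX_gen[OF _ assms] in auto)
  then show ?thesis using hd_ix_range[OF assms] by simp
qed

text \<open>The source of triangularity: all letters of a Hall element precede it in the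
  order.\<close>

lemma IM_less: "q \<in> {1..N} \<Longrightarrow> IM q j \<noteq> 0 \<Longrightarrow> j \<in> {1..N} \<and> j < q"
  using Imul_support[OF hb_mem, of q j] idx_nth[of q] by simp

lemma DM_local:
  assumes "q \<in> {1..N}" "\<And>j. j \<in> {1..N} \<Longrightarrow> j < q \<Longrightarrow> x j = y j" shows "DM N (IM q) x = DM N (IM q) y"
  unfolding DM_def
proof (rule prod.cong[OF refl])
  fix j assume j: "j \<in> {1..N}"
  show "(- x j) ^ IM q j / fact (IM q j) = (- y j) ^ IM q j / fact (IM q j)"
    by (cases "IM q j = 0") (use assms(2)[OF j] IM_less[OF assms(1), of j] in auto)
qed

lemma pd_DM_local:
  assumes "q \<in> {1..N}" "\<And>j. j \<in> {1..N} \<Longrightarrow> j < q \<Longrightarrow> x j = y j" "i \<in> {1..N}"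
  shows "pd (DM N (IM q)) i x = (if i < q then pd (DM N (IM q)) i y else 0)"
proof (cases "IM q i = 0")
  case True
  then show ?thesis by (simp add: pd_DM[OF assms(3)])
next
  case False
  then have "i < q" using IM_less[OF assms(1)] by blast
  moreover have "pd (DM N (IM q)) i x = pd (DM N (IM q)) i (y(i := x i))"
  proof -
    have "DM N (IM q) (x(i := t)) = DM N (IM q) ((y(i := x i))(i := t))" for t
      by (rule DM_local[OF assms(1)]) (use assms(2) in auto)
    then show ?thesis by (simp add: pd_def)
  qed
  moreover have "y(i := x i) = y" using assms(2)[OF assms(3) \<open>i < q\<close>] by (intro ext) auto
  ultimately show ?thesis by simp
qed

lemma wpoly_DM_IM: "wpoly (\<Sum>j=1..N. int (IM q j) * int (W j)) (DM N (IM q))"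
  by (rule wpoly_DM)

lemma horizontal_prim:
  assumes "horizontal_with hb r \<gamma> h" "q \<in> {1..N}"
  shows "prim (\<lambda>t. \<gamma> t q) (\<lambda>t. h (hd_ix q) t * DM N (IM q) (\<gamma> t))"
proof (rule primI)
  have "\<exists>L. \<forall>s\<in>{0..1}. \<forall>t\<in>{0..1}. \<forall>k. \<bar>\<gamma> s k - \<gamma> t k\<bar> \<le> L * \<bar>s - t\<bar>"
    using assms(1) by (simp add: horizontal_with_def)
  then show "lip (\<lambda>t. \<gamma> t q)" unfolding lip_def by blast
  have "AE t in lborel. t \<in> {0..1} \<longrightarrow>
        (\<forall>k\<in>{1..N}. ((\<lambda>\<tau>. \<gamma> \<tau> k) has_real_derivative
            (\<Sum>j=1..r. h j t * X j (\<gamma> t) k)) (at t within {0..1}))"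
    using assms(1) unfolding horizontal_with_def by (elim conjE)
  then show "AE t in lborel. t \<in> {0..1} \<longrightarrow>
     ((\<lambda>t. \<gamma> t q) has_real_derivative h (hd_ix q) t * DM N (IM q) (\<gamma> t)) (at t within {0..1})"
  proof eventually_elim
    case (elim t)
    show ?case
    proof
      assume "t \<in> {0..1}"
      then have "((\<lambda>\<tau>. \<gamma> \<tau> q) has_real_derivative (\<Sum>j=1..r. h j t * X j (\<gamma> t) q)) (at t within {0..1})"
        using elim assms(2) by blast
      then show "((\<lambda>t. \<gamma> t q) has_real_derivative h (hd_ix q) t * DM N (IM q) (\<gamma> t)) (at t within {0..1})"
        unfolding sum_HX_gen[OF assms(2)] .
    qed
  qed
qed

lemma horizontal_basic:
  assumes "horizontal_with hb r \<gamma> h"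
  shows "h \<in> controls r" "\<gamma> 0 k = 0" "t \<in> {0..1} \<Longrightarrow> \<gamma> t \<in> Rn N"
  using assms by (simp_all add: horizontal_with_def)

lemma horizontalI:
  assumes h: "h \<in> controls r" and z: "\<And>k. \<gamma> 0 k = 0" "\<And>t k. k \<notin> {1..N} \<Longrightarrow> \<gamma> t k = 0"
    and p: "\<And>q. q \<in> {1..N} \<Longrightarrow> prim (\<lambda>t. \<gamma> t q) (\<lambda>t. h (hd_ix q) t * DM N (IM q) (\<gamma> t))"
  shows "horizontal_with hb r \<gamma> h"
  unfolding horizontal_with_def
proof (intro conjI)
  show "\<gamma> 0 = (\<lambda>k. 0)" using z(1) by (intro ext)
  show "\<forall>t\<in>{0..1}. \<gamma> t \<in> Rn N" using z(2) by (simp add: Rn_def)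
  have "\<exists>L\<ge>0. \<forall>s\<in>{0..1}. \<forall>t\<in>{0..1}. \<bar>\<gamma> s k - \<gamma> t k\<bar> \<le> L * \<bar>s - t\<bar>" if "k \<in> {1..N}" for k
    using lipE[OF prim_lip[OF p[OF that]]] by metis
  then obtain L where L: "\<And>k. k \<in> {1..N} \<Longrightarrow> L k \<ge> 0"
    "\<And>k s t. k \<in> {1..N} \<Longrightarrow> s \<in> {0..1} \<Longrightarrow> t \<in> {0..1} \<Longrightarrow> \<bar>\<gamma> s k - \<gamma> t k\<bar> \<le> L k * \<bar>s - t\<bar>" by metis
  show "\<exists>L. \<forall>s\<in>{0..1}. \<forall>t\<in>{0..1}. \<forall>k. \<bar>\<gamma> s k - \<gamma> t k\<bar> \<le> L * \<bar>s - t\<bar>"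
  proof (intro exI[of _ "\<Sum>k=1..N. L k"] ballI allI)
    fix s t :: real and k assume st: "s \<in> {0..1}" "t \<in> {0..1}"
    show "\<bar>\<gamma> s k - \<gamma> t k\<bar> \<le> (\<Sum>k=1..N. L k) * \<bar>s - t\<bar>"
    proof (cases "k \<in> {1..N}")
      case True
      have "L k \<le> (\<Sum>k=1..N. L k)" by (rule member_le_sum) (use True L(1) in auto)
      then have "L k * \<bar>s - t\<bar> \<le> (\<Sum>k=1..N. L k) * \<bar>s - t\<bar>" by (rule mult_right_mono) simp
      then show ?thesis using L(2)[OF True st] by linarith
    next
      case False
      have "0 \<le> (\<Sum>k=1..N. L k)" by (rule sum_nonneg) (rule L(1))
      then show ?thesis using z(2)[OF False] by simp
    qed
  qed
  have "AE t in lborel. \<forall>q\<in>{1..N}. t \<in> {0..1} \<longrightarrow>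
      ((\<lambda>t. \<gamma> t q) has_real_derivative h (hd_ix q) t * DM N (IM q) (\<gamma> t)) (at t within {0..1})"
    by (rule AE_finite_allI) (simp, rule prim_AE[OF p])
  then show "AE t in lborel. t \<in> {0..1} \<longrightarrow>
        (\<forall>k\<in>{1..N}. ((\<lambda>\<tau>. \<gamma> \<tau> k) has_real_derivative
            (\<Sum>j=1..r. h j t * X j (\<gamma> t) k)) (at t within {0..1}))"
  proof eventually_elim
    case (elim t)
    show ?case
    proof (intro impI ballI)
      fix k assume t: "t \<in> {0..1}" and k: "k \<in> {1..N}"
      show "((\<lambda>\<tau>. \<gamma> \<tau> k) has_real_derivative (\<Sum>j=1..r. h j t * X j (\<gamma> t) k)) (at t within {0..1})"
        unfolding sum_HX_gen[OF k] by (rule elim[rule_format, OF k t])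
    qed
  qed
qed (rule h)

lemma horizontal_unique:
  assumes "horizontal_with hb r \<gamma> h" "horizontal_with hb r \<delta> h" "t \<in> {0..1}"
  shows "\<gamma> t = \<delta> t"
proof
  fix q
  have "q \<in> {1..N} \<Longrightarrow> \<forall>t\<in>{0..1}. \<gamma> t q = \<delta> t q"
  proof (induction q rule: less_induct)
    case (less q)
    show ?case
    proof
      fix t :: real assume t: "t \<in> {0..1}"
      show "\<gamma> t q = \<delta> t q"
      proof (rule prim_unique[OF horizontal_prim[OF assms(1) less.prems] horizontal_prim[OF assms(2) less.prems] _ _ t])
        show "AE t in lborel. t \<in> {0..1} \<longrightarrow> h (hd_ix q) t * DM N (IM q) (\<gamma> t) = h (hd_ix q) t * DM N (IM q) (\<delta> t)"
        proof (rule AE_I2, rule impI)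
          fix t :: real assume "t \<in> {0..1}"
          then have "DM N (IM q) (\<gamma> t) = DM N (IM q) (\<delta> t)"
            by (intro DM_local[OF less.prems]) (use less.IH in blast)
          then show "h (hd_ix q) t * DM N (IM q) (\<gamma> t) = h (hd_ix q) t * DM N (IM q) (\<delta> t)" by simp
        qed
        show "\<gamma> 0 q = \<delta> 0 q" using horizontal_basic(2)[OF assms(1)] horizontal_basic(2)[OF assms(2)] by simp
      qed
    qed
  qed
  then show "\<gamma> t q = \<delta> t q"
    using horizontal_basic(3)[OF assms(1,3)] horizontal_basic(3)[OF assms(2,3)] assms(3)
    by (cases "q \<in> {1..N}") (auto simp: Rn_def)
qed

lemma endpt_eq:
  assumes "horizontal_with hb r \<gamma> h" shows "endpt hb r h = \<gamma> 1"
  unfolding endpt_def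
proof (rule the_equality)
  show "\<exists>\<gamma>'. horizontal_with hb r \<gamma>' h \<and> \<gamma> 1 = \<gamma>' 1" using assms by blast
  fix y assume "\<exists>\<gamma>'. horizontal_with hb r \<gamma>' h \<and> y = \<gamma>' 1"
  then obtain \<delta> where "horizontal_with hb r \<delta> h" "y = \<delta> 1" by blast
  then show "y = \<gamma> 1" using horizontal_unique[OF assms, of \<delta> 1] by simp
qed

text \<open>Each coordinate carries its perturbed trajectory together with its first variation.\<close>

definition traj_fam :: "(nat \<Rightarrow> real \<Rightarrow> real) \<Rightarrow> (nat \<Rightarrow> real \<Rightarrow> real) \<Rightarrow> nat
    \<Rightarrow> (nat \<Rightarrow> (real \<Rightarrow> real \<Rightarrow> real) \<times> (real \<Rightarrow> real)) \<Rightarrow> bool" where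
  "traj_fam h k q c \<longleftrightarrow>
     pfam (fst (c q)) (snd (c q)) \<and>
     (\<forall>e. prim (fst (c q) e) (\<lambda>t. (h (hd_ix q) t + e * k (hd_ix q) t) * DM N (IM q) (\<lambda>j. fst (c j) e t))
        \<and> fst (c q) e 0 = 0) \<and>
     prim (snd (c q)) (\<lambda>t. k (hd_ix q) t * DM N (IM q) (\<lambda>j. fst (c j) 0 t)
        + h (hd_ix q) t * (\<Sum>j\<in>{1..<q}. pd (DM N (IM q)) j (\<lambda>j. fst (c j) 0 t) * snd (c j) t)) \<and>
     snd (c q) 0 = 0"

lemma traj_fam_local:
  assumes "q \<in> {1..N}" "\<And>j. j \<le> q \<Longrightarrow> c j = c' j" "traj_fam h k q c" shows "traj_fam h k q c'"
proof -
  have 1: "DM N (IM q) (\<lambda>j. fst (c j) e t) = DM N (IM q) (\<lambda>j. fst (c' j) e t)" for e t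
    by (rule DM_local[OF assms(1)]) (use assms(2) in simp)
  have 2: "(\<Sum>j\<in>{1..<q}. pd (DM N (IM q)) j (\<lambda>j. fst (c j) 0 t) * snd (c j) t)
     = (\<Sum>j\<in>{1..<q}. pd (DM N (IM q)) j (\<lambda>j. fst (c' j) 0 t) * snd (c' j) t)" for t
  proof (rule sum.cong[OF refl])
    fix j assume j: "j \<in> {1..<q}"
    have "pd (DM N (IM q)) j (\<lambda>j. fst (c j) 0 t) = (if j < q then pd (DM N (IM q)) j (\<lambda>j. fst (c' j) 0 t) else 0)"
      by (rule pd_DM_local[OF assms(1)]) (use assms j in auto)
    then show "pd (DM N (IM q)) j (\<lambda>j. fst (c j) 0 t) * snd (c j) t = pd (DM N (IM q)) j (\<lambda>j. fst (c' j) 0 t) * snd (c' j) t"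
      using assms(2)[of j] j by simp
  qed
  show ?thesis using assms(3) unfolding traj_fam_def 1 2 assms(2)[OF order_refl] .
qed

lemma traj_fam_step:
  assumes h: "h \<in> controls r" "k \<in> controls r" and q: "q \<in> {1..N}"
    and prev: "\<And>j. 1 \<le> j \<Longrightarrow> j < q \<Longrightarrow> traj_fam h k j c"
  shows "\<exists>z. traj_fam h k q (c(q := z))"
proof -
  \<comment> \<open>\<open>c\<close> is unconstrained outside \<open>1 \<le> j < q\<close>.
    Replacing it there by zero makes every component a polynomial family and changes nothing, since
    the monomial of \<open>q\<close> ignores those coordinates.\<close>
  define d where "d = (\<lambda>j. if 1 \<le> j \<and> j < q then c j else (\<lambda>e t. 0, \<lambda>t. 0))"
  define E where "E = (\<lambda>e t. DM N (IM q) (\<lambda>j. fst (d j) e t))"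
  define E' where "E' = (\<lambda>t. \<Sum>j=1..N. pd (DM N (IM q)) j (\<lambda>j. fst (d j) 0 t) * snd (d j) t)"
  have "pfam (fst (d j)) (snd (d j))" for j
  proof (cases "1 \<le> j \<and> j < q")
    case True
    then have "d j = c j" by (simp only: d_def if_True simp_thms)
    then show ?thesis using prev[of j] True by (simp add: traj_fam_def)
  next
    case False
    then have "d j = (\<lambda>e t. 0, \<lambda>t. 0)" by (simp only: d_def if_False)
    then show ?thesis by (simp add: pfam_zero)
  qed
  then have E: "pfam E E'" unfolding E_def E'_def by (intro pfam_wpoly[OF wpoly_DM_IM])
  have eh: "ess_bdd (h (hd_ix q))" and ek: "ess_bdd (k (hd_ix q))"
    using controls_ess_bdd[OF _ hd_ix_range[OF q]] h by blast+
  obtain K K' where K: "pfam K K'" "\<And>e. prim (K e) (\<lambda>t. h (hd_ix q) t * E e t)" "\<And>e. K e 0 = 0"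
    "prim K' (\<lambda>t. h (hd_ix q) t * E' t)" "K' 0 = 0" using pfam_integral[OF E eh] by blast
  obtain L L' where L: "pfam L L'" "\<And>e. prim (L e) (\<lambda>t. k (hd_ix q) t * E e t)" "\<And>e. L e 0 = 0"
    using pfam_integral[OF E ek] by blast
  \<comment> \<open>The two summands integrate the \<open>h\<close>-part and the
    \<open>e * k\<close>-part of the control. At \<open>e = 0\<close> the second contributes just
    \<open>L 0\<close> to the derivative.\<close>
  define G where "G = (\<lambda>e t. K e t + e * L e t)"
  define G' where "G' = (\<lambda>t. K' t + L 0 t)"
  have G: "pfam G G'" unfolding G_def G'_def by (rule pfam.add[OF K(1) pfam.shift[OF L(1)]])
  have GE: "prim (G e) (\<lambda>t. (h (hd_ix q) t + e * k (hd_ix q) t) * E e t)" for e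
    using prim_add[OF K(2)[of e] prim_cmult[OF L(2)[of e], of e]] unfolding G_def by (simp add: algebra_simps)
  have GE': "prim G' (\<lambda>t. k (hd_ix q) t * E 0 t + h (hd_ix q) t * E' t)"
    using prim_add[OF K(4) L(2)[of 0]] unfolding G'_def by (simp add: add.commute)
  have 1: "E e t = DM N (IM q) (\<lambda>j. fst ((c(q := (G, G'))) j) e t)" for e t
    unfolding E_def by (rule DM_local[OF q]) (simp add: d_def)
  have 2: "E' t = (\<Sum>j\<in>{1..<q}. pd (DM N (IM q)) j (\<lambda>j. fst ((c(q := (G, G'))) j) 0 t) * snd ((c(q := (G, G'))) j) t)" for t
    unfolding E'_def
  proof (rule sum.mono_neutral_cong_right)
    show "\<forall>j\<in>{1..N} - {1..<q}. pd (DM N (IM q)) j (\<lambda>j. fst (d j) 0 t) * snd (d j) t = 0" by (auto simp: d_def)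
    fix j assume j: "j \<in> {1..<q}"
    have "pd (DM N (IM q)) j (\<lambda>j. fst (d j) 0 t)
        = (if j < q then pd (DM N (IM q)) j (\<lambda>j. fst ((c(q := (G, G'))) j) 0 t) else 0)"
      by (rule pd_DM_local[OF q]) (use j q in \<open>auto simp: d_def\<close>)
    then show "pd (DM N (IM q)) j (\<lambda>j. fst (d j) 0 t) * snd (d j) t
       = pd (DM N (IM q)) j (\<lambda>j. fst ((c(q := (G, G'))) j) 0 t) * snd ((c(q := (G, G'))) j) t"
      using j by (simp add: d_def)
  qed (use q in auto)
  have "traj_fam h k q (c(q := (G, G')))"
    unfolding traj_fam_def 1[symmetric] 2[symmetric]
    using G GE GE' K(3,5) L(3) by (simp add: G_def G'_def)
  then show ?thesis by blast
qed

lemma trajectory_family: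
  assumes h: "h \<in> controls r" "k \<in> controls r"
  obtains c where "\<And>q. q \<in> {1..N} \<Longrightarrow> traj_fam h k q c" "\<And>q. q \<notin> {1..N} \<Longrightarrow> c q = (\<lambda>e t. 0, \<lambda>t. 0)"
proof -
  obtain c where c: "\<And>q. q \<in> {1..N} \<Longrightarrow> q \<in> {1..N} \<longrightarrow> traj_fam h k q c" "\<And>q. q \<notin> {1..N} \<Longrightarrow> c q = (\<lambda>e t. 0, \<lambda>t. 0)"
  proof (rule triangular_choice[where n=N and Q="\<lambda>q c. q \<in> {1..N} \<longrightarrow> traj_fam h k q c" and d="(\<lambda>e t. 0, \<lambda>t. 0)"])
    fix q c assume q: "1 \<le> q" "q \<le> N" and p: "\<And>j. 1 \<le> j \<Longrightarrow> j < q \<Longrightarrow> j \<in> {1..N} \<longrightarrow> traj_fam h k j c"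
    have "\<exists>z. traj_fam h k q (c(q := z))" by (rule traj_fam_step[OF h]) (use q p in auto)
    then show "\<exists>z. q \<in> {1..N} \<longrightarrow> traj_fam h k q (c(q := z))" by blast
  next
    fix q c c' assume "\<And>j. j \<le> q \<Longrightarrow> c j = c' j" "q \<in> {1..N} \<longrightarrow> traj_fam h k q c"
    then show "q \<in> {1..N} \<longrightarrow> traj_fam h k q c'" using traj_fam_local by blast
  qed blast
  then show ?thesis using that by blast
qed

section \<open>First variation of the end point\<close>

definition variation :: "(real \<Rightarrow> point) \<Rightarrow> (nat \<Rightarrow> real \<Rightarrow> real) \<Rightarrow> (nat \<Rightarrow> real \<Rightarrow> real) \<Rightarrow> (nat \<Rightarrow> real \<Rightarrow> real) \<Rightarrow> bool" where
  "variation \<gamma> h k y \<longleftrightarrow> (\<forall>q\<in>{1..N}. y q 0 = 0 \<and>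
     prim (y q) (\<lambda>t. k (hd_ix q) t * DM N (IM q) (\<gamma> t)
        + h (hd_ix q) t * (\<Sum>j=1..N. pd (DM N (IM q)) j (\<gamma> t) * y j t)))"

text \<open>Passes between the truncated sum, local enough for \<open>triangular_choice\<close>, and
  the full chain-rule sum in \<open>variation\<close>.\<close>

lemma sum_pd_DM:
  assumes "q \<in> {1..N}"
  shows "(\<Sum>j=1..N. pd (DM N (IM q)) j x * z j) = (\<Sum>j\<in>{1..<q}. pd (DM N (IM q)) j x * z j)"
proof (rule sum.mono_neutral_right)
  show "\<forall>j\<in>{1..N} - {1..<q}. pd (DM N (IM q)) j x * z j = 0"
    using pd_DM_local[OF assms, of x x] by auto
qed (use assms in auto)

lemma variation_unique:
  assumes "variation \<gamma> h k y" "variation \<gamma> h k z" "q \<in> {1..N}" "t \<in> {0..1}" shows "y q t = z q t"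
proof -
  let ?R = "\<lambda>y q t. k (hd_ix q) t * DM N (IM q) (\<gamma> t)
      + h (hd_ix q) t * (\<Sum>j=1..N. pd (DM N (IM q)) j (\<gamma> t) * y j t)"
  have "q \<in> {1..N} \<Longrightarrow> \<forall>t\<in>{0..1}. y q t = z q t" for q
  proof (induction q rule: less_induct)
    case (less q)
    have yq: "y q 0 = 0" "prim (y q) (?R y q)"
      using assms(1) less.prems unfolding variation_def by blast+
    have zq: "z q 0 = 0" "prim (z q) (?R z q)"
      using assms(2) less.prems unfolding variation_def by blast+
    show ?case
    proof
      fix t :: real assume t: "t \<in> {0..1}"
      show "y q t = z q t"
      proof (rule prim_unique[OF yq(2) zq(2) _ _ t])
        show "AE t in lborel. t \<in> {0..1} \<longrightarrow> ?R y q t = ?R z q t"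
        proof (rule AE_I2, rule impI)
          fix t :: real assume t: "t \<in> {0..1}"
          have "y j t = z j t" if "j \<in> {1..<q}" for j
            by (rule less.IH[rule_format, OF _ _ t]) (use that less.prems in auto)
          then have "(\<Sum>j\<in>{1..<q}. pd (DM N (IM q)) j (\<gamma> t) * y j t) = (\<Sum>j\<in>{1..<q}. pd (DM N (IM q)) j (\<gamma> t) * z j t)"
            by (intro sum.cong) auto
          then show "?R y q t = ?R z q t"
            unfolding sum_pd_DM[OF less.prems] by simp
        qed
      qed (simp add: yq zq)
    qed
  qed
  then show ?thesis using assms(3,4) by blast
qed

text \<open>The perturbed end point is a polynomial in \<open>e\<close> given by the trajectory
  family, and its linear coefficient is the solution of the linearised system at time 1.\<close>

lemma endpt_derivative:
  assumes \<gamma>: "horizontal_with hb r \<gamma> h" and k: "k \<in> controls r"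
  obtains y where "variation \<gamma> h k y"
    "\<And>l. l \<in> {1..N} \<Longrightarrow> ((\<lambda>e. endpt hb r (\<lambda>j t. h j t + e * k j t) l) has_real_derivative y l 1) (at 0)"
proof -
  note h = horizontal_basic(1)[OF \<gamma>]
  obtain c where c: "\<And>q. q \<in> {1..N} \<Longrightarrow> traj_fam h k q c" "\<And>q. q \<notin> {1..N} \<Longrightarrow> c q = (\<lambda>e t. 0, \<lambda>t. 0)"
    using trajectory_family[OF h k] by blast
  define G where "G = (\<lambda>q. fst (c q))"
  define y where "y = (\<lambda>q. snd (c q))"
  have hor: "horizontal_with hb r (\<lambda>t q. G q e t) (\<lambda>j t. h j t + e * k j t)" for e
  proof (rule horizontalI[OF controls_lin[OF h k]])
    show "G q e 0 = 0" for q
      using c(1)[of q] c(2)[of q] by (cases "q \<in> {1..N}") (simp_all add: G_def traj_fam_def)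
    show "G q e t = 0" if "q \<notin> {1..N}" for t q using c(2)[OF that] by (simp add: G_def)
    show "prim (\<lambda>t. G q e t) (\<lambda>t. (h (hd_ix q) t + e * k (hd_ix q) t) * DM N (IM q) (\<lambda>q. G q e t))"
      if "q \<in> {1..N}" for q
      using c(1)[OF that] unfolding traj_fam_def G_def by blast
  qed
  \<comment> \<open>The family is built from the controls alone; uniqueness identifies its member at
    \<open>e = 0\<close> with the given curve on \<open>{0..1}\<close>.\<close>
  have "horizontal_with hb r (\<lambda>t q. G q 0 t) h" using hor[of 0] by simp
  then have G0: "(\<lambda>q. G q 0 t) = \<gamma> t" if "t \<in> {0..1}" for t using horizontal_unique[OF _ \<gamma> that] by blast
  have "variation \<gamma> h k y"
    unfolding variation_def
  proof (intro ballI conjI)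
    fix q assume q: "q \<in> {1..N}"
    then show "y q 0 = 0" using c(1)[OF q] by (simp add: traj_fam_def y_def)
    have "prim (y q) (\<lambda>t. k (hd_ix q) t * DM N (IM q) (\<lambda>j. G j 0 t)
        + h (hd_ix q) t * (\<Sum>j\<in>{1..<q}. pd (DM N (IM q)) j (\<lambda>j. G j 0 t) * y j t))"
      using c(1)[OF q] unfolding traj_fam_def G_def y_def by blast
    then show "prim (y q) (\<lambda>t. k (hd_ix q) t * DM N (IM q) (\<gamma> t)
        + h (hd_ix q) t * (\<Sum>j=1..N. pd (DM N (IM q)) j (\<gamma> t) * y j t))"
      by (rule prim_cong) (use G0 sum_pd_DM[OF q] in simp_all)
  qed
  moreover have "((\<lambda>e. endpt hb r (\<lambda>j t. h j t + e * k j t) l) has_real_derivative y l 1) (at 0)" if l: "l \<in> {1..N}" for l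
  proof -
    have "pfam (G l) (y l)" using c(1)[OF l] by (simp add: traj_fam_def G_def y_def)
    moreover have "(\<lambda>e. endpt hb r (\<lambda>j t. h j t + e * k j t) l) = (\<lambda>e. G l e 1)"
      by (intro ext) (simp add: endpt_eq[OF hor])
    ultimately show ?thesis using pfam_deriv by simp
  qed
  ultimately show ?thesis by (rule that)
qed

end

section \<open>The variation in the left-invariant frame\<close>

text \<open>\<open>A\<close> stands for structure constants, \<open>B j l\<close> for the derivative
  along X_j of a quantity attached to X_l. The \<open>A\<close>-part of \<open>B\<close> cancels the
  \<open>ad\<close>-term of the frame equation and leaves \<open>C\<close>. Two uses:
  \<open>C j l\<close> is X_l applied to a component of X_j for the variation, and 0 for the adjoint
  action.\<close>

lemma frame_algebra:
  fixes kh h c X :: "nat \<Rightarrow> real" and A :: "nat \<Rightarrow> nat \<Rightarrow> nat \<Rightarrow> real" and B C :: "nat \<Rightarrow> nat \<Rightarrow> real"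
  assumes "\<And>j l. j \<in> J \<Longrightarrow> l \<in> L \<Longrightarrow> B j l = C j l + (\<Sum>p\<in>L. A j l p * X p)"
  shows "(\<Sum>l\<in>L. (kh l - (\<Sum>j\<in>J. h j * (\<Sum>p\<in>L. A j p l * c p))) * X l + (\<Sum>j\<in>J. h j * B j l) * c l)
     = (\<Sum>l\<in>L. kh l * X l) + (\<Sum>j\<in>J. h j * (\<Sum>l\<in>L. c l * C j l))"
proof -
  have B: "(\<Sum>j\<in>J. h j * B j l) * c l = (\<Sum>j\<in>J. h j * (c l * C j l)) + (\<Sum>j\<in>J. \<Sum>p\<in>L. h j * (A j l p * c l * X p))"
    if "l \<in> L" for l
    by (simp add: assms that distrib_left sum.distrib sum_distrib_left sum_distrib_right mult_ac)
  have "(\<Sum>l\<in>L. (\<Sum>j\<in>J. h j * (\<Sum>p\<in>L. A j p l * c p)) * X l) = (\<Sum>l\<in>L. \<Sum>j\<in>J. \<Sum>p\<in>L. h j * (A j p l * c p * X l))"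
    by (simp add: sum_distrib_left sum_distrib_right mult_ac)
  also have "\<dots> = (\<Sum>l\<in>L. \<Sum>p\<in>L. \<Sum>j\<in>J. h j * (A j p l * c p * X l))"
    by (intro sum.cong refl sum.swap)
  also have "\<dots> = (\<Sum>p\<in>L. \<Sum>l\<in>L. \<Sum>j\<in>J. h j * (A j p l * c p * X l))" by (rule sum.swap)
  also have "\<dots> = (\<Sum>l\<in>L. \<Sum>j\<in>J. \<Sum>p\<in>L. h j * (A j l p * c l * X p))"
    by (intro sum.cong refl sum.swap)
  finally have 1: "(\<Sum>l\<in>L. (\<Sum>j\<in>J. h j * (\<Sum>p\<in>L. A j p l * c p)) * X l)
     = (\<Sum>l\<in>L. \<Sum>j\<in>J. \<Sum>p\<in>L. h j * (A j l p * c l * X p))" .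
  have 2: "(\<Sum>l\<in>L. \<Sum>j\<in>J. h j * (c l * C j l)) = (\<Sum>j\<in>J. h j * (\<Sum>l\<in>L. c l * C j l))"
    by (subst sum.swap) (simp add: sum_distrib_left)
  have "(\<Sum>l\<in>L. (kh l - (\<Sum>j\<in>J. h j * (\<Sum>p\<in>L. A j p l * c p))) * X l + (\<Sum>j\<in>J. h j * B j l) * c l)
     = (\<Sum>l\<in>L. kh l * X l) - (\<Sum>l\<in>L. (\<Sum>j\<in>J. h j * (\<Sum>p\<in>L. A j p l * c p)) * X l)
       + (\<Sum>l\<in>L. (\<Sum>j\<in>J. h j * B j l) * c l)"
    by (simp add: left_diff_distrib sum_subtractf sum.distrib)
  also have "(\<Sum>l\<in>L. (\<Sum>j\<in>J. h j * B j l) * c l)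
     = (\<Sum>l\<in>L. \<Sum>j\<in>J. h j * (c l * C j l)) + (\<Sum>l\<in>L. \<Sum>j\<in>J. \<Sum>p\<in>L. h j * (A j l p * c l * X p))"
    by (simp add: B sum.distrib cong: sum.cong)
  finally show ?thesis unfolding 1 2 by simp
qed

context hall begin

definition ext_control :: "(nat \<Rightarrow> real \<Rightarrow> real) \<Rightarrow> nat \<Rightarrow> real \<Rightarrow> real" where
  "ext_control k l t = (if l \<in> {1..r} then k l t else 0)"

lemma r_le_N: "r \<le> N"
  using Gen_mem(3)[of r] by (cases "r = 0") auto

lemma sum_ext_control: "(\<Sum>l=1..N. ext_control k l t * f l) = (\<Sum>j=1..r. k j t * f j)"
  by (rule sum.mono_neutral_cong_right) (use r_le_N in \<open>auto simp: ext_control_def\<close>)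

definition frame_coord :: "(nat \<Rightarrow> real \<Rightarrow> real) \<Rightarrow> (nat \<Rightarrow> real \<Rightarrow> real) \<Rightarrow> (nat \<Rightarrow> real \<Rightarrow> real) \<Rightarrow> bool" where
  "frame_coord h k c \<longleftrightarrow> (\<forall>q\<in>{1..N}. c q 0 = 0 \<and>
     prim (c q) (\<lambda>t. ext_control k q t - (\<Sum>i=1..r. h i t * (\<Sum>l=1..N. ad i l q * c l t))))"

lemma sum_ad: assumes "i \<in> {1..r}" "q \<in> {1..N}"
  shows "(\<Sum>l=1..N. ad i l q * f l) = (\<Sum>l\<in>{1..<q}. ad i l q * f l)"
proof (rule sum.mono_neutral_right)
  show "\<forall>l\<in>{1..N} - {1..<q}. ad i l q * f l = 0"
    using ad_less(2)[OF Gen_mem(3)[OF assms(1)]] by fastforce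
qed (use assms in auto)

lemma frame_coord_exists:
  assumes h: "h \<in> controls r" "k \<in> controls r"
  obtains c where "frame_coord h k c"
proof -
  \<comment> \<open>The inner sum is cut to \<open>l < q\<close>: \<open>sum_ad\<close> shows that
    nothing is lost, and the predicate then depends on components up to \<open>q\<close>
    only.\<close>
  let ?Q = "\<lambda>q c. q \<in> {1..N} \<longrightarrow> c q 0 = 0 \<and>
     prim (c q) (\<lambda>t. ext_control k q t - (\<Sum>i=1..r. h i t * (\<Sum>l\<in>{1..<q}. ad i l q * c l t)))"
  obtain c where c: "\<And>q. q \<in> {1..N} \<Longrightarrow> ?Q q c"
  proof (rule triangular_choice[where n=N and Q="?Q" and d="\<lambda>_. 0"])
    fix q and c :: "nat \<Rightarrow> real \<Rightarrow> real"
    assume q: "1 \<le> q" "q \<le> N" and p: "\<And>j. 1 \<le> j \<Longrightarrow> j < q \<Longrightarrow> ?Q j c"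
    have l: "lip (c j)" if "j \<in> {1..<q}" for j using p[of j] that q by (auto intro: prim_lip)
    have "ess_bdd (\<lambda>t. ext_control k q t)"
    proof (cases "q \<in> {1..r}")
      case True
      then show ?thesis using controls_ess_bdd[OF h(2) True] by (simp add: ext_control_def)
    next
      case False
      then have "(\<lambda>t. ext_control k q t) = (\<lambda>t. 0)" by (intro ext) (simp only: ext_control_def if_False)
      then show ?thesis using lip_ess_bdd[OF lip_const] by simp
    qed
    moreover have "ess_bdd (\<lambda>t. -1 * (\<Sum>i=1..r. h i t * (\<Sum>l\<in>{1..<q}. ad i l q * c l t)))"
      by (intro ess_bdd_mult[OF lip_ess_bdd[OF lip_const]] ess_bdd_sum ess_bdd_mult[OF controls_ess_bdd[OF h(1)]]
           lip_ess_bdd lip_sum lip_mult[OF lip_const] l) simp_all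
    ultimately have "ess_bdd (\<lambda>t. ext_control k q t + -1 * (\<Sum>i=1..r. h i t * (\<Sum>l\<in>{1..<q}. ad i l q * c l t)))"
      by (rule ess_bdd_add)
    then obtain z where z: "prim z (\<lambda>t. ext_control k q t + -1 * (\<Sum>i=1..r. h i t * (\<Sum>l\<in>{1..<q}. ad i l q * c l t)))" "z 0 = 0"
      by (rule ess_bdd_prim)
    have "(\<Sum>l\<in>{1..<q}. ad i l q * (c(q := z)) l t) = (\<Sum>l\<in>{1..<q}. ad i l q * c l t)" for i t
      by (rule sum.cong) auto
    then show "\<exists>z. ?Q q (c(q := z))" using z by (intro exI[of _ z]) simp
  next
    fix q and c c' :: "nat \<Rightarrow> real \<Rightarrow> real"
    assume e: "\<And>j. j \<le> q \<Longrightarrow> c j = c' j" and Q: "?Q q c"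
    have "(\<Sum>l\<in>{1..<q}. ad i l q * c l t) = (\<Sum>l\<in>{1..<q}. ad i l q * c' l t)" for i t
      by (rule sum.cong) (use e in auto)
    then show "?Q q c'" using Q e[of q] by simp
  qed blast
  have "frame_coord h k c"
    unfolding frame_coord_def
  proof (intro ballI conjI)
    fix q assume q: "q \<in> {1..N}"
    then show "c q 0 = 0" using c by blast
    have "prim (c q) (\<lambda>t. ext_control k q t - (\<Sum>i=1..r. h i t * (\<Sum>l\<in>{1..<q}. ad i l q * c l t)))" using c[OF q] q by blast
    then show "prim (c q) (\<lambda>t. ext_control k q t - (\<Sum>i=1..r. h i t * (\<Sum>l=1..N. ad i l q * c l t)))"
    proof (rule prim_cong)
      fix t :: real
      show "ext_control k q t - (\<Sum>i=1..r. h i t * (\<Sum>l\<in>{1..<q}. ad i l q * c l t))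
         = ext_control k q t - (\<Sum>i=1..r. h i t * (\<Sum>l=1..N. ad i l q * c l t))"
        by (intro arg_cong2[where f="(-)"] refl sum.cong) (use sum_ad[OF _ q] in simp)
    qed simp
  qed
  then show ?thesis by (rule that)
qed

lemma prim_act:
  assumes \<gamma>: "horizontal_with hb r \<gamma> h" and f: "wpoly d f"
  shows "prim (\<lambda>t. f (\<gamma> t)) (\<lambda>t. \<Sum>j=1..r. h j t * act (X j) f (\<gamma> t))"
proof (rule prim_cong[OF prim_chain[OF f horizontal_prim[OF \<gamma>]]])
  fix t :: real
  have "(\<Sum>k=1..N. pd f k (\<gamma> t) * (h (hd_ix k) t * DM N (IM k) (\<gamma> t)))
     = (\<Sum>k=1..N. \<Sum>j=1..r. h j t * (X j (\<gamma> t) k * pd f k (\<gamma> t)))"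
  proof (rule sum.cong[OF refl])
    fix k assume k: "k \<in> {1..N}"
    show "pd f k (\<gamma> t) * (h (hd_ix k) t * DM N (IM k) (\<gamma> t)) = (\<Sum>j=1..r. h j t * (X j (\<gamma> t) k * pd f k (\<gamma> t)))"
      unfolding sum_HX_gen[OF k, of "\<lambda>j. h j t" "\<gamma> t", symmetric] by (simp add: sum_distrib_left mult_ac)
  qed
  also have "\<dots> = (\<Sum>j=1..r. \<Sum>k=1..N. h j t * (X j (\<gamma> t) k * pd f k (\<gamma> t)))" by (rule sum.swap)
  finally show "(\<Sum>k=1..N. pd f k (\<gamma> t) * (h (hd_ix k) t * DM N (IM k) (\<gamma> t)))
     = (\<Sum>j=1..r. h j t * act (X j) f (\<gamma> t))" by (simp add: act_def sum_distrib_left)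
qed simp_all

text \<open>The bracket terms of [X_j, X_l] cancel the \<open>ad\<close>-terms. What remains are the
  derivatives of the components of the X_j along the variation itself, that is, the linearised
  control system.\<close>

lemma frame_variation:
  assumes \<gamma>: "horizontal_with hb r \<gamma> h" and c: "frame_coord h k c"
  shows "variation \<gamma> h k (\<lambda>q t. \<Sum>l=1..N. c l t * X l (\<gamma> t) q)"
  unfolding variation_def
proof (intro ballI conjI)
  fix q assume q: "q \<in> {1..N}"
  show "(\<Sum>l=1..N. c l 0 * X l (\<gamma> 0) q) = 0" using c by (simp add: frame_coord_def)
  have "prim (\<lambda>t. \<Sum>l=1..N. c l t * X l (\<gamma> t) q)
    (\<lambda>t. \<Sum>l=1..N. (ext_control k l t - (\<Sum>j=1..r. h j t * (\<Sum>p=1..N. ad j p l * c p t))) * X l (\<gamma> t) q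
       + (\<Sum>j=1..r. h j t * act (X j) (\<lambda>x. X l x q) (\<gamma> t)) * c l t)"
    by (intro prim_sum prim_mult prim_act[OF \<gamma> vpoly_wpoly[OF vpoly_HX]])
       (use c in \<open>auto simp: frame_coord_def\<close>)
  then show "prim (\<lambda>t. \<Sum>l=1..N. c l t * X l (\<gamma> t) q)
     (\<lambda>t. k (hd_ix q) t * DM N (IM q) (\<gamma> t)
        + h (hd_ix q) t * (\<Sum>j=1..N. pd (DM N (IM q)) j (\<gamma> t) * (\<Sum>l=1..N. c l t * X l (\<gamma> t) j)))"
  proof (rule prim_cong)
    fix t :: real
    have B: "act (X j) (\<lambda>x. X l x q) (\<gamma> t) = act (X l) (\<lambda>x. X j x q) (\<gamma> t)
        + (\<Sum>p=1..N. ad j l p * X p (\<gamma> t) q)" if "j \<in> {1..r}" "l \<in> {1..N}" for j l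
      using lie_HX_ad[OF Gen_mem(3)[OF that(1)] that(2), of "\<gamma> t" q] by (simp add: lie_act)
    let ?lhs = "(\<Sum>l=1..N. (ext_control k l t - (\<Sum>j=1..r. h j t * (\<Sum>p=1..N. ad j p l * c p t))) * X l (\<gamma> t) q
       + (\<Sum>j=1..r. h j t * act (X j) (\<lambda>x. X l x q) (\<gamma> t)) * c l t)"
    have "?lhs = (\<Sum>l=1..N. ext_control k l t * X l (\<gamma> t) q)
       + (\<Sum>j=1..r. h j t * (\<Sum>l=1..N. c l t * act (X l) (\<lambda>x. X j x q) (\<gamma> t)))"
      by (rule frame_algebra) (use B in simp)
    also have "(\<Sum>l=1..N. ext_control k l t * X l (\<gamma> t) q) = k (hd_ix q) t * DM N (IM q) (\<gamma> t)"
      unfolding sum_ext_control by (rule sum_HX_gen[OF q])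
    also have "(\<Sum>j=1..r. h j t * (\<Sum>l=1..N. c l t * act (X l) (\<lambda>x. X j x q) (\<gamma> t)))
       = (\<Sum>j=1..r. if j = hd_ix q then h j t * (\<Sum>l=1..N. c l t * act (X l) (DM N (IM q)) (\<gamma> t)) else 0)"
    proof (rule sum.cong[OF refl])
      fix j assume j: "j \<in> {1..r}"
      have e: "(\<lambda>x. X j x q) = (if j = hd_ix q then DM N (IM q) else (\<lambda>x. 0))"
        by (intro ext) (simp add: HX_gen[OF j q])
      show "h j t * (\<Sum>l=1..N. c l t * act (X l) (\<lambda>x. X j x q) (\<gamma> t))
         = (if j = hd_ix q then h j t * (\<Sum>l=1..N. c l t * act (X l) (DM N (IM q)) (\<gamma> t)) else 0)"
        unfolding e by (simp add: act_def)
    qed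
    also have "\<dots> = h (hd_ix q) t * (\<Sum>l=1..N. c l t * act (X l) (DM N (IM q)) (\<gamma> t))"
      using hd_ix_range[OF q] by simp
    also have "(\<Sum>l=1..N. c l t * act (X l) (DM N (IM q)) (\<gamma> t))
       = (\<Sum>l=1..N. \<Sum>j=1..N. pd (DM N (IM q)) j (\<gamma> t) * (c l t * X l (\<gamma> t) j))"
      by (simp add: act_def sum_distrib_left mult_ac)
    also have "\<dots> = (\<Sum>j=1..N. pd (DM N (IM q)) j (\<gamma> t) * (\<Sum>l=1..N. c l t * X l (\<gamma> t) j))"
      by (subst sum.swap) (simp add: sum_distrib_left)
    finally show "?lhs
      = k (hd_ix q) t * DM N (IM q) (\<gamma> t)
        + h (hd_ix q) t * (\<Sum>j=1..N. pd (DM N (IM q)) j (\<gamma> t) * (\<Sum>l=1..N. c l t * X l (\<gamma> t) j))" .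
  qed simp
qed

lemma frame_pairing:
  assumes \<gamma>: "horizontal_with hb r \<gamma> h" and c: "frame_coord h k c"
  shows "prim (\<lambda>t. \<Sum>a=1..N. v a * (\<Sum>l=1..N. c l t * F a (X l) (\<gamma> t)))
     (\<lambda>t. \<Sum>j=1..r. k j t * extP hb v j (\<gamma> t))"
proof -
  have a: "prim (\<lambda>t. \<Sum>l=1..N. c l t * F a (X l) (\<gamma> t)) (\<lambda>t. \<Sum>j=1..r. k j t * F a (X j) (\<gamma> t))" for a
  proof -
    have "prim (\<lambda>t. \<Sum>l=1..N. c l t * F a (X l) (\<gamma> t))
      (\<lambda>t. \<Sum>l=1..N. (ext_control k l t - (\<Sum>j=1..r. h j t * (\<Sum>p=1..N. ad j p l * c p t))) * F a (X l) (\<gamma> t)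
         + (\<Sum>j=1..r. h j t * act (X j) (F a (X l)) (\<gamma> t)) * c l t)"
    proof (intro prim_sum prim_mult)
      fix l assume l: "l \<in> {1..N}"
      show "prim (c l) (\<lambda>t. ext_control k l t - (\<Sum>j=1..r. h j t * (\<Sum>p=1..N. ad j p l * c p t)))"
        using c l by (simp add: frame_coord_def)
      show "prim (\<lambda>t. F a (X l) (\<gamma> t)) (\<lambda>t. \<Sum>j=1..r. h j t * act (X j) (F a (X l)) (\<gamma> t))"
        by (rule prim_act[OF \<gamma> wpoly_F[OF Sp_HX[OF l]]])
    qed simp
    then show ?thesis
    proof (rule prim_cong)
      fix t :: real
      let ?lhs = "(\<Sum>l=1..N. (ext_control k l t - (\<Sum>j=1..r. h j t * (\<Sum>p=1..N. ad j p l * c p t))) * F a (X l) (\<gamma> t)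
         + (\<Sum>j=1..r. h j t * act (X j) (F a (X l)) (\<gamma> t)) * c l t)"
      \<comment> \<open>By \<open>act_F_HX\<close> the derivative of \<open>F a (X l)\<close> along
        X_j is exactly the structure-constant term, so the remainder in \<open>frame_algebra\<close>
        is zero and only the source \<open>k\<close> survives.\<close>
      have "?lhs = (\<Sum>l=1..N. ext_control k l t * F a (X l) (\<gamma> t)) + (\<Sum>j=1..r. h j t * (\<Sum>l=1..N. c l t * 0))"
        by (rule frame_algebra) (use act_F_HX in simp)
      then show "?lhs = (\<Sum>j=1..r. k j t * F a (X j) (\<gamma> t))"
        by (simp only: sum_ext_control) simp
    qed simp
  qed
  have "prim (\<lambda>t. \<Sum>a=1..N. v a * (\<Sum>l=1..N. c l t * F a (X l) (\<gamma> t)))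
     (\<lambda>t. \<Sum>a=1..N. v a * (\<Sum>j=1..r. k j t * F a (X j) (\<gamma> t)))"
    by (intro prim_sum prim_cmult a) simp
  then show ?thesis
  proof (rule prim_cong)
    fix t :: real
    have "(\<Sum>a=1..N. v a * (\<Sum>j=1..r. k j t * F a (X j) (\<gamma> t)))
       = (\<Sum>a=1..N. \<Sum>j=1..r. k j t * (v a * F a (X j) (\<gamma> t)))"
      by (simp add: sum_distrib_left mult_ac)
    also have "\<dots> = (\<Sum>j=1..r. \<Sum>a=1..N. k j t * (v a * F a (X j) (\<gamma> t)))" by (rule sum.swap)
    also have "\<dots> = (\<Sum>j=1..r. k j t * extP hb v j (\<gamma> t))"
      by (rule sum.cong[OF refl]) (simp add: extP_F[OF Gen_mem(3)] sum_distrib_left)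
    finally show "(\<Sum>a=1..N. v a * (\<Sum>j=1..r. k j t * F a (X j) (\<gamma> t))) = (\<Sum>j=1..r. k j t * extP hb v j (\<gamma> t))" .
  qed simp
qed

text \<open>The hypothesis on \<open>v\<close> says that the covector \<open>u\<close>, evaluated on
  the frame at the end point, agrees with \<open>v\<close> composed with the adjoint action there.
  Hence the pairing of \<open>v\<close> with the transported frame coordinates ends at the pairing
  of \<open>u\<close> with the variation.\<close>

lemma variation_pairing:
  assumes \<gamma>: "horizontal_with hb r \<gamma> h" and k: "k \<in> controls r" and y: "variation \<gamma> h k y"
    and v: "\<And>l. l \<in> {1..N} \<Longrightarrow> (\<Sum>a=1..N. v a * F a (X l) (\<gamma> 1)) = (\<Sum>a=1..N. u a * X l (\<gamma> 1) a)"
  obtains \<beta> where "prim \<beta> (\<lambda>t. \<Sum>j=1..r. k j t * extP hb v j (\<gamma> t))" "\<beta> 0 = 0"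
    "\<beta> 1 = (\<Sum>a=1..N. u a * y a 1)"
proof -
  obtain c where c: "frame_coord h k c"
    using frame_coord_exists[OF horizontal_basic(1)[OF \<gamma>] k] .
  define \<beta> where "\<beta> = (\<lambda>t. \<Sum>a=1..N. v a * (\<Sum>l=1..N. c l t * F a (X l) (\<gamma> t)))"
  have swap: "(\<Sum>a=1..N. w a * (\<Sum>l=1..N. c l t * G a l)) = (\<Sum>l=1..N. c l t * (\<Sum>a=1..N. w a * G a l))"
    for w :: "nat \<Rightarrow> real" and G t
  proof -
    have "(\<Sum>a=1..N. w a * (\<Sum>l=1..N. c l t * G a l)) = (\<Sum>a=1..N. \<Sum>l=1..N. c l t * (w a * G a l))"
      by (simp add: sum_distrib_left mult_ac)
    also have "\<dots> = (\<Sum>l=1..N. \<Sum>a=1..N. c l t * (w a * G a l))" by (rule sum.swap)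
    finally show ?thesis by (simp add: sum_distrib_left)
  qed
  show ?thesis
  proof (rule that[of \<beta>])
    show "prim \<beta> (\<lambda>t. \<Sum>j=1..r. k j t * extP hb v j (\<gamma> t))"
      unfolding \<beta>_def by (rule frame_pairing[OF \<gamma> c])
    show "\<beta> 0 = 0" using c by (simp add: \<beta>_def frame_coord_def)
    have "y a 1 = (\<Sum>l=1..N. c l 1 * X l (\<gamma> 1) a)" if "a \<in> {1..N}" for a
      using variation_unique[OF y frame_variation[OF \<gamma> c] that, of 1] by simp
    then have "(\<Sum>a=1..N. u a * y a 1) = (\<Sum>a=1..N. u a * (\<Sum>l=1..N. c l 1 * X l (\<gamma> 1) a))" by simp
    also have "\<dots> = (\<Sum>l=1..N. c l 1 * (\<Sum>a=1..N. u a * X l (\<gamma> 1) a))" by (rule swap)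
    also have "\<dots> = (\<Sum>l=1..N. c l 1 * (\<Sum>a=1..N. v a * F a (X l) (\<gamma> 1)))"
      by (rule sum.cong[OF refl]) (simp only: v)
    also have "\<dots> = \<beta> 1" unfolding \<beta>_def by (rule swap[symmetric])
    finally show "\<beta> 1 = (\<Sum>a=1..N. u a * y a 1)" by simp
  qed
qed

section \<open>The annihilator of the differential and the corank\<close>

lemma lip_extP:
  assumes \<gamma>: "horizontal_with hb r \<gamma> h" and j: "j \<in> {1..r}"
  shows "lip (\<lambda>t. extP hb v j (\<gamma> t))"
  unfolding extP_F[OF Gen_mem(3)[OF j]]
  by (intro lip_sum lip_mult[OF lip_const] wpoly_lip[OF wpoly_F[OF Sp_HX[OF Gen_mem(3)[OF j]]]]
      prim_lip[OF horizontal_prim[OF \<gamma>]]) simp_all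

lemma annihilator_iff:
  assumes \<gamma>: "horizontal_with hb r \<gamma> h"
    and v: "\<And>l. l \<in> {1..N} \<Longrightarrow> (\<Sum>a=1..N. v a * F a (X l) (\<gamma> 1)) = (\<Sum>a=1..N. u a * X l (\<gamma> 1) a)"
  shows "(\<forall>D\<in>dE_image hb r h. dot N D u = 0) \<longleftrightarrow> (\<forall>t\<in>{0..1}. \<gamma> t \<in> Zv hb r v)"
proof
  assume R: "\<forall>t\<in>{0..1}. \<gamma> t \<in> Zv hb r v"
  show "\<forall>D\<in>dE_image hb r h. dot N D u = 0"
  proof
    fix D assume "D \<in> dE_image hb r h"
    then obtain k where k: "k \<in> controls r" and D: "\<And>l. l \<in> {1..N} \<Longrightarrow>
      ((\<lambda>e. endpt hb r (\<lambda>j t. h j t + e * k j t) l) has_real_derivative D l) (at 0)"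
      unfolding dE_image_def by blast
    obtain y where y: "variation \<gamma> h k y" "\<And>l. l \<in> {1..N} \<Longrightarrow>
      ((\<lambda>e. endpt hb r (\<lambda>j t. h j t + e * k j t) l) has_real_derivative y l 1) (at 0)"
      using endpt_derivative[OF \<gamma> k] by blast
    obtain \<beta> where \<beta>: "prim \<beta> (\<lambda>t. \<Sum>j=1..r. k j t * extP hb v j (\<gamma> t))" "\<beta> 0 = 0" "\<beta> 1 = (\<Sum>a=1..N. u a * y a 1)"
      using variation_pairing[OF \<gamma> k y(1) v] by blast
    have "prim \<beta> (\<lambda>t. 0)"
    proof (rule prim_cong[OF \<beta>(1)])
      fix t :: real assume "t \<in> {0..1}"
      then have "extP hb v j (\<gamma> t) = 0" if "j \<in> {1..r}" for j using R that by (simp add: Zv_def)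
      then show "(\<Sum>j=1..r. k j t * extP hb v j (\<gamma> t)) = 0" by simp
    qed simp
    then have "\<beta> 1 = 0"
      by (rule prim_unique[OF _ prim_const[of 0]]) (simp_all add: \<beta>(2))
    moreover have "D a = y a 1" if "a \<in> {1..N}" for a using DERIV_unique[OF D[OF that] y(2)[OF that]] .
    ultimately show "dot N D u = 0" by (simp add: dot_def \<beta>(3) mult.commute)
  qed
next
  assume L: "\<forall>D\<in>dE_image hb r h. dot N D u = 0"
  \<comment> \<open>The extremal polynomials themselves serve as test control, so the derivative of
    the pairing is a sum of squares. The cut-off is needed because a control is Borel measurable on
    the whole line, while the curve is arbitrary outside \<open>{0..1}\<close>.\<close>
  define k where "k = (\<lambda>j t. if t \<in> {0..1} then extP hb v j (\<gamma> t) else 0)"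
  have k: "k \<in> controls r"
    unfolding controls_def
  proof (intro CollectI ballI conjI)
    fix j assume j: "j \<in> {1..r}"
    note l = lip_extP[OF \<gamma> j, of v]
    have "(\<lambda>t. indicator {0..1} t *\<^sub>R extP hb v j (\<gamma> t)) \<in> borel_measurable borel"
      by (rule borel_measurable_continuous_on_indicator[OF _ lip_continuous[OF l]]) simp
    moreover have "(\<lambda>t. indicator {0..1} t *\<^sub>R extP hb v j (\<gamma> t)) = k j"
      by (intro ext) (simp add: k_def indicator_def)
    ultimately show "k j \<in> borel_measurable lborel" by simp
    obtain B where "\<And>t. t \<in> {0..1} \<Longrightarrow> \<bar>extP hb v j (\<gamma> t)\<bar> \<le> B" using lip_bounded[OF l] by blast
    then have "AE t in lborel. t \<in> {0..1} \<longrightarrow> \<bar>k j t\<bar> \<le> B" by (intro AE_I2) (simp add: k_def)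
    then show "\<exists>B. AE t in lborel. t \<in> {0..1} \<longrightarrow> \<bar>k j t\<bar> \<le> B" by (rule exI)
  qed
  obtain y where y: "variation \<gamma> h k y" "\<And>l. l \<in> {1..N} \<Longrightarrow>
      ((\<lambda>e. endpt hb r (\<lambda>j t. h j t + e * k j t) l) has_real_derivative y l 1) (at 0)"
    using endpt_derivative[OF \<gamma> k] by blast
  obtain \<beta> where \<beta>: "prim \<beta> (\<lambda>t. \<Sum>j=1..r. k j t * extP hb v j (\<gamma> t))" "\<beta> 0 = 0" "\<beta> 1 = (\<Sum>a=1..N. u a * y a 1)"
    using variation_pairing[OF \<gamma> k y(1) v] by blast
  define D where "D = (\<lambda>l. if l \<in> {1..N} then y l 1 else 0)"
  have "D \<in> dE_image hb r h"
    unfolding dE_image_def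
  proof (intro CollectI conjI bexI[OF _ k] ballI)
    show "D \<in> Rn N" by (auto simp: Rn_def D_def)
    fix l assume l: "l \<in> {1..N}"
    then have "D l = y l 1" by (simp only: D_def if_True)
    then show "((\<lambda>e. endpt hb r (\<lambda>j t. h j t + e * k j t) l) has_real_derivative D l) (at 0)" using y(2)[OF l] by simp
  qed
  then have "dot N D u = 0" using L by blast
  then have "\<beta> 1 = 0" unfolding \<beta>(3) dot_def D_def by (simp add: mult.commute)
  have sq: "prim \<beta> (\<lambda>t. \<Sum>j=1..r. extP hb v j (\<gamma> t) * extP hb v j (\<gamma> t))"
    by (rule prim_cong[OF \<beta>(1)]) (simp_all add: k_def)
  show "\<forall>t\<in>{0..1}. \<gamma> t \<in> Zv hb r v"
  proof
    fix t :: real assume t: "t \<in> {0..1}"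
    have "(\<Sum>j=1..r. extP hb v j (\<gamma> t) * extP hb v j (\<gamma> t)) = 0"
    proof (rule prim_nonneg_zero[OF sq _ _ _ t])
      show "continuous_on {0..1} (\<lambda>t. \<Sum>j=1..r. extP hb v j (\<gamma> t) * extP hb v j (\<gamma> t))"
        by (intro lip_continuous lip_sum lip_mult lip_extP[OF \<gamma>]) simp_all
      show "\<beta> 1 = \<beta> 0" using \<open>\<beta> 1 = 0\<close> \<beta>(2) by simp
    qed (simp add: sum_nonneg)
    then have "extP hb v j (\<gamma> t) = 0" if "j \<in> {1..r}" for j
      using that by (subst (asm) sum_nonneg_eq_0_iff) auto
    then show "\<gamma> t \<in> Zv hb r v" using horizontal_basic(3)[OF \<gamma> t] by (simp add: Zv_def)
  qed
qed

text \<open>Corank \<open>m\<close> is read as at least \<open>m\<close>, in accordance with the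
  existence of \<open>m\<close> independent vectors, a condition inherited by subfamilies. The exact
  corank, if positive, is thus the largest \<open>m\<close> for which such vectors exist.\<close>

theorem corank_iff:
  assumes \<gamma>: "horizontal_with hb r \<gamma> h" and m: "1 \<le> m"
  shows "(abnormal_extremal hb r h \<and> m \<le> corank hb r h) \<longleftrightarrow>
         (\<exists>v. (\<forall>i<m. v i \<in> Rn N) \<and> lin_indep N m v \<and> (\<forall>i<m. \<forall>t\<in>{0..1}. \<gamma> t \<in> Zv hb r (v i)))"
proof -
  let ?A = "\<lambda>a l. X l (\<gamma> 1) a" and ?B = "\<lambda>a l. F a (X l) (\<gamma> 1)"
  show ?thesis
  proof
    assume "abnormal_extremal hb r h \<and> m \<le> corank hb r h"
    then have "m \<le> N - dimR N (dE_image hb r h)" by (simp add: corank_def)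
    \<comment> \<open>The subtraction is truncated; \<open>1 \<le> m\<close> excludes the truncated
      case.\<close>
    then have "m + dimR N (dE_image hb r h) \<le> N" using m by linarith
    then obtain u where u: "lin_indep N m u" "\<And>i x. i < m \<Longrightarrow> x \<in> dE_image hb r h \<Longrightarrow> dot N x (u i) = 0"
      using dimR_orthogonal_family by blast
    obtain v where v: "\<And>i. v i \<in> Rn N" "lin_indep N m v"
      "\<And>i l. l \<in> {1..N} \<Longrightarrow> (\<Sum>a=1..N. v i a * ?B a l) = (\<Sum>a=1..N. u i a * ?A a l)"
      using lin_indep_transfer[of N ?A ?B, OF HX_unitri F_unitri u(1)] by blast
    have "\<forall>t\<in>{0..1}. \<gamma> t \<in> Zv hb r (v i)" if "i < m" for i
      using annihilator_iff[OF \<gamma> v(3)] u(2)[OF that] by blast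
    then show "\<exists>v. (\<forall>i<m. v i \<in> Rn N) \<and> lin_indep N m v \<and> (\<forall>i<m. \<forall>t\<in>{0..1}. \<gamma> t \<in> Zv hb r (v i))"
      using v(1,2) by blast
  next
    assume "\<exists>v. (\<forall>i<m. v i \<in> Rn N) \<and> lin_indep N m v \<and> (\<forall>i<m. \<forall>t\<in>{0..1}. \<gamma> t \<in> Zv hb r (v i))"
    then obtain v where v: "lin_indep N m v" "\<And>i. i < m \<Longrightarrow> \<forall>t\<in>{0..1}. \<gamma> t \<in> Zv hb r (v i)" by blast
    obtain u where u: "\<And>i. u i \<in> Rn N" "lin_indep N m u"
      "\<And>i l. l \<in> {1..N} \<Longrightarrow> (\<Sum>a=1..N. u i a * ?A a l) = (\<Sum>a=1..N. v i a * ?B a l)"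
      using lin_indep_transfer[of N ?B ?A, OF F_unitri HX_unitri v(1)] by blast
    have orth: "dot N D (u i) = 0" if "D \<in> dE_image hb r h" "i < m" for D i
      using annihilator_iff[OF \<gamma> u(3)[symmetric]] v(2)[OF that(2)] that(1) by blast
    obtain w where w: "\<And>i. i < dimR N (dE_image hb r h) \<Longrightarrow> w i \<in> dE_image hb r h" "lin_indep N (dimR N (dE_image hb r h)) w"
      using dimR_family by blast
    have "dimR N (dE_image hb r h) + m \<le> N"
      by (rule orthogonal_indep_card[OF w(2) u(2)]) (use orth w(1) in blast)
    then have "m \<le> corank hb r h" by (simp add: corank_def)
    moreover have "dE_image hb r h \<noteq> Rn N"
    proof
      assume "dE_image hb r h = Rn N"
      \<comment> \<open>If the differential were onto, \<open>u 0\<close> would lie in its image and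
        be orthogonal to itself. Index 0 is available because \<open>1 \<le> m\<close>.\<close>
      then have "dot N (u 0) (u 0) = 0" using orth[of "u 0" 0] u(1) m by simp
      then have "u 0 l = 0" if "l \<in> {1..N}" for l using dot_self_zero that by blast
      moreover have "(\<Sum>i<m. (if i = 0 then 1 else 0) * u i l) = u 0 l" for l
      proof -
        have "(\<Sum>i<m. (if i = 0 then 1 else 0) * u i l) = (\<Sum>i<m. if i = 0 then u 0 l else 0)"
          by (rule sum.cong) auto
        then show ?thesis using m by simp
      qed
      ultimately have "(if (0::nat) = 0 then 1 else 0) = (0::real)"
        using lin_indepD[OF u(2), of "\<lambda>i. if i = 0 then 1 else 0" 0] m by simp
      then show False by simp
    qed
    ultimately show "abnormal_extremal hb r h \<and> m \<le> corank hb r h" by (simp add: abnormal_extremal_def)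
  qed
qed

end

theorem theorem4p9:
  fixes r s m :: nat and hb :: "br list"
    and \<gamma> :: "real \<Rightarrow> nat \<Rightarrow> real" and h :: "nat \<Rightarrow> real \<Rightarrow> real"
  assumes "2 \<le> r" and "2 \<le> s" and "hall_basis r s hb"
    and "horizontal_with hb r \<gamma> h"
    and "1 \<le> m"
  shows "(abnormal_extremal hb r h \<and> m \<le> corank hb r h) \<longleftrightarrow>
         (\<exists>v :: nat \<Rightarrow> nat \<Rightarrow> real.
            (\<forall>i<m. v i \<in> Rn (length hb)) \<and> lin_indep (length hb) m v \<and>
            (\<forall>i<m. \<forall>t\<in>{0..1}. \<gamma> t \<in> Zv hb r (v i)))"
proof -
  interpret hall r s hb by standard (rule assms(3))
  show ?thesis by (rule corank_iff[OF assms(4,5)])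
qed

end
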